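(* Let $n\ge1$. For every $f\in\mathcal{V}_n^{(0)}$, one has $\frac15\,U^{(0)}(f)\in\mathcal{V}^{(1)}_{5n-2}$.
   Context: $q=e^{2\pi i\tau}$, $E_2(\tau)=1-24\sum_{n\ge1}\frac{nq^n}{1-q^n}$, $F(\tau)=\frac1{24}(50E_2(10\tau)-25E_2(5\tau)-2E_2(2\tau)+E_2(\tau))$, $Z(\tau)=q^2\prod_{m\ge1}\frac{1-q^{50m}}{1-q^{2m}}$, $y=y(\tau)=q\prod_{m\ge1}\frac{(1-q^{2m})(1-q^{10m})^3}{(1-q^m)^3(1-q^{5m})}$. For $f=\sum_{m\ge M}a(m)q^m$, $U_5(f)=\sum_{5m\ge M}a(5m)q^m$; $U^{(1)}(f)=U_5(Ff)/F$, $U^{(0)}(f)=U_5(FZf)/F$. A function $s:\mathbb{Z}\to\mathbb{Z}$ is discrete if $s(m)=0$ for all sufficiently large $m$. Let $\theta(m)=\lfloor\frac{5m-5}{6}\rfloor$ for $m=1,2$ and $\theta(m)=\lfloor\frac{5m-5}{6}\rfloor-1$ for $m\ge3$; $\phi(m)=\lfloor\frac{5m-5}{6}\rfloor$ for $1\le m\le3$ and $\phi(m)=\lfloor\frac{5m-5}{6}\rfloor-1$ for $m\ge4$. For $n\ge1$ define $\mathcal{V}^{(0)}_n=\{(1+5y)^{-n}\sum_{m\ge1}s(m)5^{\phi(m)}y^m : s\text{ discrete}\}$ and $\mathcal{V}^{(1)}_n=\{(1+5y)^{-n}\sum_{m\ge1}s(m)5^{\theta(m)}y^m : s\text{ discrete}\}$.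 *)

theory Defs
  imports "HOL-Analysis.Analysis" "HOL-Computational_Algebra.Computational_Algebra"
begin

text \<open>
  Functions of \<open>\<tau>\<close> are represented by their \<open>q\<close>-expansions, with the formal variable in the role of
  \<open>q = exp (2 * pi * i * \<tau>)\<close>: substituting \<open>k * \<tau>\<close> for \<open>\<tau>\<close> is composition with \<open>q ^ k\<close>. The elements
  of the modules below involve negative powers of \<open>1 + 5 * y\<close> and may have poles in the upper
  half-plane, so in general they have a \<open>q\<close>-expansion only around \<open>q = 0\<close>; this expansion is what
  the operator \<open>U5\<close> acts on. Infinite sums and products are limits in the metric topology of formal
  power series, i.e. coefficientwise limits.
\<close>

definition E2 :: "complex fps" where
  "E2 = 1 - 24 * (\<Sum>n. of_nat (Suc n) * fps_X ^ Suc n / (1 - fps_X ^ Suc n))"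

definition F :: "complex fls" where
  "F = 1 / 24 * fps_to_fls (50 * (E2 oo fps_X ^ 10) - 25 * (E2 oo fps_X ^ 5)
                              - 2 * (E2 oo fps_X ^ 2) + E2)"

definition Z :: "complex fls" where
  "Z = fps_to_fls (fps_X ^ 2 *
         prodinf (\<lambda>m. (1 - fps_X ^ (50 * Suc m)) / (1 - fps_X ^ (2 * Suc m))))"

definition y :: "complex fls" where
  "y = fps_to_fls (fps_X *
         prodinf (\<lambda>m. ((1 - fps_X ^ (2 * Suc m)) * (1 - fps_X ^ (10 * Suc m)) ^ 3) /
                      ((1 - fps_X ^ Suc m) ^ 3 * (1 - fps_X ^ (5 * Suc m)))))"

definition U5 :: "complex fls \<Rightarrow> complex fls" where
  "U5 f = Abs_fls (\<lambda>m. fls_nth f (5 * m))"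

definition U0 :: "complex fls \<Rightarrow> complex fls" where
  "U0 f = U5 (F * Z * f) / F"

definition discrete_fun :: "(int \<Rightarrow> int) \<Rightarrow> bool" where
  "discrete_fun s \<longleftrightarrow> (\<exists>N. \<forall>m\<ge>N. s m = 0)"

text \<open>Only the values at \<open>m \<ge> 1\<close> matter; there both exponents are nonnegative.\<close>

definition \<theta> :: "int \<Rightarrow> int" where
  "\<theta> m = (if m \<le> 2 then (5 * m - 5) div 6 else (5 * m - 5) div 6 - 1)"

definition \<phi> :: "int \<Rightarrow> int" where
  "\<phi> m = (if m \<le> 3 then (5 * m - 5) div 6 else (5 * m - 5) div 6 - 1)"

text \<open>
  For discrete \<open>s\<close> the index set below is finite, and dropping the indices with \<open>s m = 0\<close> does not
  change the sum over all \<open>m \<ge> 1\<close>.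
\<close>

definition V :: "(int \<Rightarrow> int) \<Rightarrow> nat \<Rightarrow> complex fls set" where
  "V e n = {(1 + 5 * y) powi (- int n) *
              (\<Sum>m\<in>{m. m \<ge> 1 \<and> s m \<noteq> 0}. of_int (s m) * 5 powi e m * y powi m) | s. discrete_fun s}"

definition V0 :: "nat \<Rightarrow> complex fls set" where
  "V0 n = V \<phi> n"

definition V1 :: "nat \<Rightarrow> complex fls set" where
  "V1 n = V \<theta> n"


text \<open>The limits and typedef abstractions used above are well defined.\<close>

lemma fls_nth_U5: "fls_nth (U5 f) m = fls_nth f (5 * m)"
  unfolding U5_def
proof (rule nth_Abs_fls_lower_bound)
  show "\<forall>k < min 0 (fls_subdegree f). fls_nth f (5 * k) = 0"
    by (auto intro!: fls_eq0_below_subdegree)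
qed

lemma finite_discrete_support:
  assumes "discrete_fun s"
  shows "finite {m. m \<ge> 1 \<and> s m \<noteq> 0}"
proof -
  from assms obtain N where "\<forall>m\<ge>N. s m = 0"
    by (auto simp: discrete_fun_def)
  hence "{m. m \<ge> 1 \<and> s m \<noteq> 0} \<subseteq> {1..N}"
    by (smt (verit) atLeastAtMost_iff mem_Collect_eq subsetI)
  thus ?thesis
    using finite_subset by blast
qed

lemma fps_sums:
  fixes f :: "nat \<Rightarrow> complex fps"
  assumes "\<And>n k. k \<ge> n \<Longrightarrow> fps_nth (f k) n = 0"
  shows "f sums Abs_fps (\<lambda>n. \<Sum>k<n. fps_nth (f k) n)"
  unfolding sums_def
proof (rule tendsto_fpsI)
  fix n
  show "\<forall>\<^sub>F N in sequentially. fps_nth (sum f {..<N}) n =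
          fps_nth (Abs_fps (\<lambda>n. \<Sum>k<n. fps_nth (f k) n)) n"
    using eventually_ge_at_top[of n]
  proof eventually_elim
    case (elim N)
    have "(\<Sum>k<N. fps_nth (f k) n) = (\<Sum>k<n. fps_nth (f k) n)"
      using elim assms by (intro sum.mono_neutral_right) auto
    thus ?case
      by (simp add: fps_sum_nth)
  qed
qed

lemma Lambert_nth_eq_0:
  assumes "k \<ge> n"
  shows "fps_nth (of_nat (Suc k) * fps_X ^ Suc k / (1 - fps_X ^ Suc k) :: complex fps) n = 0"
proof -
  have "(of_nat (Suc k) * fps_X ^ Suc k / (1 - fps_X ^ Suc k) :: complex fps) =
          fps_X ^ Suc k * (of_nat (Suc k) * inverse (1 - fps_X ^ Suc k))"
    by (simp add: fps_divide_unit mult_ac)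
  thus ?thesis
    using assms by (simp only: fps_X_power_mult_nth) auto
qed

lemma E2_summable:
  "summable (\<lambda>n. of_nat (Suc n) * fps_X ^ Suc n / (1 - fps_X ^ Suc n) :: complex fps)"
  using fps_sums[OF Lambert_nth_eq_0] by (rule sums_summable)

lemma E2_nth_0: "fps_nth E2 0 = 1"
proof -
  have "fps_nth (\<Sum>n. of_nat (Suc n) * fps_X ^ Suc n / (1 - fps_X ^ Suc n) :: complex fps) 0 = 0"
    using sums_unique[OF fps_sums[OF Lambert_nth_eq_0], symmetric] by simp
  thus ?thesis
    by (simp add: E2_def fps_mult_nth)
qed

lemma F_nonzero: "F \<noteq> 0"
proof -
  have "fls_nth F 0 = 1 / 24 * fls_nth (fps_to_fls (50 * (E2 oo fps_X ^ 10) - 25 * (E2 oo fps_X ^ 5)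
                              - 2 * (E2 oo fps_X ^ 2) + E2)) 0"
  proof -
    have "(1 / 24 :: complex fls) = fls_const (1 / 24)"
      by (simp flip: fls_const_divide_const)
    thus ?thesis
      unfolding F_def by (simp only: fls_times_conv_fps_times) simp
  qed
  hence "fls_nth F 0 = 1"
    by (simp add: E2_nth_0 fps_mult_nth)
  thus ?thesis
    by auto
qed

lemma fps_convergent_prod:
  fixes h :: "nat \<Rightarrow> complex fps"
  assumes h: "\<And>k. fps_X ^ Suc k dvd h k - 1"
  shows "convergent_prod h"
proof -
  define P where "P = Abs_fps (\<lambda>n. fps_nth (\<Prod>k\<le>n. h k) n)"
  have nth: "fps_nth (a * h k) n = fps_nth a n" if "n \<le> k" for a :: "complex fps" and k n
  proof -
    from h[of k] obtain r where r: "h k - 1 = fps_X ^ Suc k * r" ..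
    have "a * h k = a + fps_X ^ Suc k * (a * r)"
      using r by (simp add: algebra_simps)
    thus ?thesis
      using that by (simp only: fps_add_nth fps_X_power_mult_nth) auto
  qed
  have stable: "fps_nth (\<Prod>k\<le>N. h k) n = fps_nth P n" if "n \<le> N" for n N
    using that
  proof (induction N rule: dec_induct)
    case base
    show ?case by (simp add: P_def)
  next
    case (step N)
    thus ?case using nth[of n "Suc N"] by simp
  qed
  have lim: "(\<lambda>N. \<Prod>k\<le>N. h k) \<longlonglongrightarrow> P"
  proof (rule tendsto_fpsI)
    fix n
    show "\<forall>\<^sub>F N in sequentially. fps_nth (\<Prod>k\<le>N. h k) n = fps_nth P n"
      using eventually_ge_at_top[of n] by eventually_elim (rule stable)
  qed
  have "fps_nth P 0 = 1"
    using nth[of 0 0 1] by (simp add: P_def)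
  hence "P \<noteq> 0"
    by auto
  with lim have "raw_has_prod h 0 P"
    by (simp add: raw_has_prod_def)
  thus ?thesis
    unfolding convergent_prod_def by blast
qed

lemma dvd_mult_minus_1:
  fixes p a b :: "complex fps"
  assumes "p dvd a - 1" "p dvd b - 1"
  shows "p dvd a * b - 1"
proof -
  have "a * b - 1 = (a - 1) * b + (b - 1)"
    by (simp add: algebra_simps)
  thus ?thesis
    using assms by (metis dvd_add dvd_mult2)
qed

lemma dvd_divide_minus_1:
  fixes p a b :: "complex fps"
  assumes "p dvd a - 1" "p dvd b - 1" "fps_nth b 0 \<noteq> 0"
  shows "p dvd a / b - 1"
proof -
  have "a / b - 1 = ((a - 1) - (b - 1)) * inverse b"
    using assms(3) by (simp add: fps_divide_unit algebra_simps inverse_mult_eq_1')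
  thus ?thesis
    using assms by (metis dvd_diff dvd_mult2)
qed

lemma dvd_power_minus_1:
  fixes p a :: "complex fps"
  assumes "p dvd a - 1"
  shows "p dvd a ^ n - 1"
  by (induction n) (auto intro: dvd_mult_minus_1[OF assms])

lemma dvd_one_minus_X_power:
  assumes "k \<le> m"
  shows "fps_X ^ k dvd (1 - fps_X ^ m) - (1 :: complex fps)"
  using assms by (simp add: le_imp_power_dvd)

lemma Z_convergent_prod:
  "convergent_prod (\<lambda>m. (1 - fps_X ^ (50 * Suc m)) / (1 - fps_X ^ (2 * Suc m)) :: complex fps)"
  by (intro fps_convergent_prod dvd_divide_minus_1 dvd_one_minus_X_power) auto

lemma y_convergent_prod:
  "convergent_prod (\<lambda>m. ((1 - fps_X ^ (2 * Suc m)) * (1 - fps_X ^ (10 * Suc m)) ^ 3) /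
      ((1 - fps_X ^ Suc m) ^ 3 * (1 - fps_X ^ (5 * Suc m))) :: complex fps)"
  by (intro fps_convergent_prod dvd_divide_minus_1 dvd_mult_minus_1 dvd_power_minus_1
            dvd_one_minus_X_power) auto

end

theory Submission
  imports Defs
begin

text \<open>
  Write \<open>E k\<close> for the Euler product in \<open>q ^ k\<close> and \<open>\<sigma>\<close> for the substitution of \<open>q ^ 5\<close> for \<open>q\<close>.
  Both \<open>y\<close> and \<open>Z\<close> are eta quotients, and in terms of the Hauptmodul
  \<open>hq = q E(10)^5 E(1) / (E(2) E(5)^5)\<close> one has \<open>y = hq / (1 - 4 hq)\<close> and \<open>F = q d/dq (log hq)\<close>.
  The five-dissections \<open>E 1 / (q E 25) = 1/r - 1 - r\<close> and \<open>E 2 / (q^2 E 50) = 1/s - 1 - s\<close>, together with the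
  dissection of \<open>(E 1)^2 / E 2 = \<Sum> (-1)^n q^(n^2)\<close>, give the algebraic relation between \<open>r\<close> and \<open>s\<close>
  and express all of this rationally through \<open>K = r s^2\<close> and \<open>r\<close>, where \<open>K\<close> and \<open>r^5\<close> are series in \<open>q^5\<close>.
  Hence \<open>U5\<close> is evaluated by reading off the part of degree 0 modulo 5 in \<open>r\<close>.
  The degree 5 equation of \<open>y\<close> over \<open>\<sigma> y\<close> then yields recurrences in both exponents for
  \<open>U0 (y^m (1 + 5 y)^(-n))\<close>, starting from five explicit values with \<open>n = 1\<close>. A weight on polynomials that is
  multiplicative (a Gauss norm with \<open>y\<close> of 5-adic size \<open>5^(5/6)\<close>) is preserved by these
  recurrences, and this bound is strong enough for the theorem except in the coefficient of \<open>y\<close> for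
  \<open>m = 1, 2\<close>, which is tracked separately.
\<close>

section \<open>Bilateral theta series\<close>

text \<open>No modular forms enter: all functions are formal Laurent series, and every identity
  between eta quotients has to come from theta series. \<open>U5\<close> changes the variable, which
  hides algebraic relations; so \<open>U0\<close> is studied through \<open>\<sigma>\<close>,
  because \<open>\<sigma>\<close> after \<open>U5\<close> is a projection for which the series in
  q^5 are scalars. The obstacle is the presence of \<open>F\<close> and \<open>Z\<close> under
  \<open>U5\<close>: the degree 5 equation only propagates values, and some have to be found
  explicitly. With hq = (qa / qb) qV, where qa and qb are the dissected quotients, \<open>F\<close>
  has the denominators qa and qb and \<open>Z\<close> the denominator qb, so monomials in qa and qb
  that cancel them can be treated. These lead to negative powers of y times 1 + 5 y, which is why
  values are computed at n = -1 and m = -2, ..., -6 and then carried to n = 1. The slope 5/6 of the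
  norm is that of \<open>\<theta>\<close> and \<open>\<phi>\<close>. The exponent 5 n - 2 arises
  because each further factor 1 / (1 + 5 y) inside \<open>U0\<close> costs (1 + 5 y)^5 outside, and
  the denominator at n = 1 is a cube.\<close>

definition gen_series :: "'i set \<Rightarrow> ('i \<Rightarrow> nat) \<Rightarrow> ('i \<Rightarrow> complex) \<Rightarrow> complex fps" where
  "gen_series S e w = Abs_fps (\<lambda>N. \<Sum>i | i \<in> S \<and> e i = N. w i)"

text \<open>\<open>sum\<close> over an infinite set is 0, so an infinite fibre would silently
  contribute nothing; products and dissections are therefore stated for finite fibres.\<close>

definition finite_fibres :: "'i set \<Rightarrow> ('i \<Rightarrow> nat) \<Rightarrow> bool" where
  "finite_fibres S e \<longleftrightarrow> (\<forall>N. finite {i \<in> S. e i = N})"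

lemma gen_series_nth [simp]: "fps_nth (gen_series S e w) N = (\<Sum>i | i \<in> S \<and> e i = N. w i)"
  by (simp add: gen_series_def)

lemma gen_series_reindex:
  assumes f: "bij_betw f S' S" and "\<And>i. i \<in> S' \<Longrightarrow> e' i = e (f i)" "\<And>i. i \<in> S' \<Longrightarrow> w' i = w (f i)"
  shows "gen_series S' e' w' = gen_series S e w"
proof (rule fps_ext)
  fix N
  have "inj_on f {i \<in> S'. e' i = N}"
    using f by (auto simp: bij_betw_def inj_on_def)
  moreover have "f ` {i \<in> S'. e' i = N} = {i \<in> S. e i = N}"
  proof (rule equalityI; rule subsetI)
    fix i assume "i \<in> {i \<in> S. e i = N}"
    moreover from this obtain j where "j \<in> S'" "i = f j"
      using f by (auto simp: bij_betw_def)
    ultimately show "i \<in> f ` {i \<in> S'. e' i = N}"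
      using assms(2)[of j] by simp
  next
    fix i assume "i \<in> f ` {i \<in> S'. e' i = N}"
    then obtain j where j: "j \<in> S'" "i = f j" "e' j = N" by blast
    thus "i \<in> {i \<in> S. e i = N}"
      using f assms(2)[of j] by (simp add: bij_betwE)
  qed
  ultimately have "bij_betw f {i \<in> S'. e' i = N} {i \<in> S. e i = N}"
    by (simp add: bij_betw_def)
  from sum.reindex_bij_betw[OF this, of w]
  have "(\<Sum>i | i \<in> S \<and> e i = N. w i) = (\<Sum>i | i \<in> S' \<and> e' i = N. w (f i))" ..
  also have "\<dots> = (\<Sum>i | i \<in> S' \<and> e' i = N. w' i)"
    by (rule sum.cong) (simp_all add: assms(3))
  finally show "fps_nth (gen_series S' e' w') N = fps_nth (gen_series S e w) N"
    by (simp only: gen_series_nth)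
qed

lemma gen_series_mult:
  assumes "finite_fibres S e" "finite_fibres qderiv d"
  shows "gen_series S e w * gen_series qderiv d v = gen_series (S \<times> qderiv) (\<lambda>(i, j). e i + d j) (\<lambda>(i, j). w i * v j)"
proof (rule fps_ext)
  fix N
  have "fps_nth (gen_series S e w * gen_series qderiv d v) N =
          (\<Sum>k\<le>N. \<Sum>(i, j)\<in>{i \<in> S. e i = k} \<times> {j \<in> qderiv. d j = N - k}. w i * v j)"
    by (simp add: fps_mult_nth sum_product sum.cartesian_product atLeast0AtMost)
  also have "\<dots> = (\<Sum>p\<in>(\<Union>k\<in>{..N}. {i \<in> S. e i = k} \<times> {j \<in> qderiv. d j = N - k}). case p of (i, j) \<Rightarrow> w i * v j)"
    using assms by (intro sum.UNION_disjoint[symmetric]) (auto simp: finite_fibres_def)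
  also have "(\<Union>k\<in>{..N}. {i \<in> S. e i = k} \<times> {j \<in> qderiv. d j = N - k}) =
               {p. p \<in> S \<times> qderiv \<and> (case p of (i, j) \<Rightarrow> e i + d j) = N}"
    by auto
  finally show "fps_nth (gen_series S e w * gen_series qderiv d v) N =
      fps_nth (gen_series (S \<times> qderiv) (\<lambda>(i, j). e i + d j) (\<lambda>(i, j). w i * v j)) N"
    by simp
qed

lemma gen_series_uminus: "gen_series S e (\<lambda>i. - w i) = - gen_series S e w"
  by (rule fps_ext) (simp add: sum_negf)

lemma gen_series_shift: "gen_series S (\<lambda>i. e i + c) w = fps_X ^ c * gen_series S e w"
proof (rule fps_ext)
  fix N
  show "fps_nth (gen_series S (\<lambda>i. e i + c) w) N = fps_nth (fps_X ^ c * gen_series S e w) N"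
  proof (cases "N < c")
    case True
    hence "{i \<in> S. e i + c = N} = {}" by auto
    thus ?thesis using True by (simp add: fps_X_power_mult_nth)
  next
    case False
    hence "{i \<in> S. e i + c = N} = {i \<in> S. e i = N - c}" by auto
    thus ?thesis using False by (simp add: fps_X_power_mult_nth)
  qed
qed

lemma gen_series_compose:
  assumes "d > 0"
  shows "gen_series S (\<lambda>i. d * e i) w = gen_series S e w oo fps_X ^ d"
proof (rule fps_ext)
  fix N
  have "{i \<in> S. d * e i = N} = (if d dvd N then {i \<in> S. e i = N div d} else {})"
    using assms by auto
  thus "fps_nth (gen_series S (\<lambda>i. d * e i) w) N = fps_nth (gen_series S e w oo fps_X ^ d) N"
    using assms by (simp add: fps_nth_compose_X_power)
qed

definition alt_sign :: "int \<Rightarrow> complex" where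
  "alt_sign k = (if even k then 1 else -1)"

lemma alt_sign_add: "alt_sign (j + k) = alt_sign j * alt_sign k"
  by (auto simp: alt_sign_def)

definition theta_exp :: "nat \<Rightarrow> nat \<Rightarrow> int \<Rightarrow> nat" where
  "theta_exp a b k = nat ((int a * (k * (k + 1)) + int b * (k * (k - 1))) div 2)"

text \<open>
  Ramanujan's \<open>f(-q^a, -q^b)\<close>: the exponent \<open>a k(k+1)/2 + b k(k-1)/2\<close> is nonnegative for every integer \<open>k\<close>, so that truncating it to \<open>nat\<close> is harmless.
\<close>

definition theta :: "nat \<Rightarrow> nat \<Rightarrow> complex fps" where
  "theta a b = gen_series UNIV (theta_exp a b) alt_sign"

lemma int_te: "2 * int (theta_exp a b k) = int a * (k * (k + 1)) + int b * (k * (k - 1))"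
proof -
  have 1: "k * (k + 1) \<ge> 0" "k * (k - 1) \<ge> 0"
    by (auto simp: zero_le_mult_iff)
  have "even (int a * (k * (k + 1)) + int b * (k * (k - 1)))" by auto
  thus ?thesis using 1 by (simp add: theta_exp_def)
qed

text \<open>Growth in both directions serves twice: fibres are finite, and terms with |k| \<ge> m do
  not affect coefficients below m.\<close>

lemma theta_exp_ge:
  assumes "a > 0" "b > 0"
  shows "theta_exp a b k \<ge> nat \<bar>k\<bar>"
proof -
  have 1: "k * (k + 1) \<ge> 0" "k * (k - 1) \<ge> 0"
    by (auto simp: zero_le_mult_iff)
  have "int a * (k * (k + 1)) \<ge> 1 * (k * (k + 1))" "int b * (k * (k - 1)) \<ge> 1 * (k * (k - 1))"
    using assms by (intro mult_right_mono 1; simp)+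
  hence "2 * int (theta_exp a b k) \<ge> 2 * (k * k)"
    unfolding int_te by (simp add: algebra_simps)
  moreover have "k * k \<ge> \<bar>k\<bar>"
  proof (cases "k = 0")
    case False
    hence "\<bar>k\<bar> * \<bar>k\<bar> \<ge> 1 * \<bar>k\<bar>" by (intro mult_right_mono) auto
    thus ?thesis by simp
  qed auto
  ultimately show ?thesis by linarith
qed

lemma finite_fibres_te:
  assumes "a > 0" "b > 0"
  shows "finite_fibres S (theta_exp a b)"
proof -
  have "{k \<in> S. theta_exp a b k = N} \<subseteq> {- int N..int N}" for N
  proof
    fix k assume "k \<in> {k \<in> S. theta_exp a b k = N}"
    thus "k \<in> {- int N..int N}"
      using theta_exp_ge[OF assms, of k] by auto
  qed
  thus ?thesis unfolding finite_fibres_def by (blast intro: finite_subset finite_atLeastAtMost_int)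
qed

lemma theta_exp_add_one: "int (theta_exp a b (k + 1)) = int (theta_exp a b k) + int a * (k + 1) + int b * k"
proof -
  have "2 * int (theta_exp a b (k + 1)) = 2 * int (theta_exp a b k) + 2 * (int a * (k + 1) + int b * k)"
    unfolding int_te by (simp add: algebra_simps)
  thus ?thesis by simp
qed

section \<open>Infinite products of formal power series\<close>

text \<open>Reduces identities between infinite products to finite ones: the congruence respects
  products and powers, and congruence for all n is equality.\<close>

definition cong_X :: "nat \<Rightarrow> complex fps \<Rightarrow> complex fps \<Rightarrow> bool" where
  "cong_X n f g \<longleftrightarrow> fps_X ^ n dvd f - g"

lemma cong_X_refl: "cong_X n f f"
  by (simp add: cong_X_def)

lemma cong_X_sym: "cong_X n f g \<Longrightarrow> cong_X n g f"
  unfolding cong_X_def by (subst dvd_minus_iff[symmetric]) simp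

lemma cong_X_trans: "cong_X n f g \<Longrightarrow> cong_X n g h \<Longrightarrow> cong_X n f h"
  unfolding cong_X_def using dvd_add[of "fps_X ^ n" "f - g" "g - h"] by simp

lemma cong_X_mult:
  assumes "cong_X n f g" "cong_X n f' g'"
  shows "cong_X n (f * f') (g * g')"
proof -
  have "f * f' - g * g' = (f - g) * f' + g * (f' - g')" by (simp add: algebra_simps)
  thus ?thesis using assms unfolding cong_X_def by (metis dvd_add dvd_mult dvd_mult2)
qed

lemma cong_X_power: "cong_X n f g \<Longrightarrow> cong_X n (f ^ k) (g ^ k)"
  by (induction k) (auto intro: cong_X_mult cong_X_refl)

lemma cong_X_mono: "m \<le> n \<Longrightarrow> cong_X n f g \<Longrightarrow> cong_X m f g"
  unfolding cong_X_def by (meson dvd_trans le_imp_power_dvd)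

lemma cong_X_iff: "cong_X n f g \<longleftrightarrow> (\<forall>i<n. fps_nth f i = fps_nth g i)"
proof
  assume "cong_X n f g"
  then obtain h where h: "f - g = fps_X ^ n * h" unfolding cong_X_def ..
  have "fps_nth (f - g) i = 0" if "i < n" for i
    unfolding h using that by (simp add: fps_X_power_mult_nth)
  thus "\<forall>i<n. fps_nth f i = fps_nth g i" by simp
next
  assume *: "\<forall>i<n. fps_nth f i = fps_nth g i"
  have "f - g = fps_X ^ n * fps_shift n (f - g)"
    by (rule fps_ext) (use * in \<open>simp add: fps_X_power_mult_nth\<close>)
  thus "cong_X n f g" unfolding cong_X_def by (metis dvd_triv_left)
qed

lemma fps_eqI_cong_X:
  assumes "\<And>n. cong_X n f g"
  shows "f = g"
  by (rule fps_ext) (use assms in \<open>auto simp: cong_X_iff\<close>)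

text \<open>Factor k differs from 1 only from degree k + 1 on, so the first n factors already fix
  all coefficients up to degree n.\<close>

lemma prodinf_cong_X:
  fixes h :: "nat \<Rightarrow> complex fps"
  assumes h: "\<And>k. cong_X (Suc k) (h k) 1" and "n \<le> M"
  shows "cong_X (Suc n) (prodinf h) (\<Prod>k<M. h k)"
proof -
  have step: "cong_X (Suc n) (\<Prod>k<N. h k) (\<Prod>k<M. h k)" if "M \<le> N" "n \<le> M" for n M N
    using that(1)
  proof (induction N rule: dec_induct)
    case (step N)
    have "cong_X (Suc n) (h N) 1"
      using h[of N] by (rule cong_X_mono[rotated]) (use step that in auto)
    from cong_X_mult[OF step.IH this] show ?case by simp
  qed (rule cong_X_refl)
  define P where "P = Abs_fps (\<lambda>n. fps_nth (\<Prod>k<n. h k) n)"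
  have stable: "fps_nth (\<Prod>k<N. h k) n = fps_nth P n" if "n \<le> N" for n N
    using step[of n N n] that by (simp add: P_def cong_X_iff)
  have "(\<lambda>N. \<Prod>k\<le>N. h k) \<longlonglongrightarrow> P"
  proof (rule tendsto_fpsI)
    fix n
    show "\<forall>\<^sub>F N in sequentially. fps_nth (\<Prod>k\<le>N. h k) n = fps_nth P n"
      using eventually_ge_at_top[of n]
      by eventually_elim (use stable[of n "Suc _"] in \<open>simp add: lessThan_Suc_atMost del: prod.lessThan_Suc\<close>)
  qed
  \<comment> \<open>Convergence of an infinite product includes a nonzero limit; here the constant
    term is 1.\<close>
  moreover have "P \<noteq> 0"
    using stable[of 0 0] by auto
  ultimately have "h has_prod P"
    by (simp add: has_prod_def raw_has_prod_def)
  hence "prodinf h = P"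
    using has_prod_unique by metis
  thus ?thesis
    using stable assms(2) by (simp add: cong_X_iff)
qed

definition euler :: "nat \<Rightarrow> complex fps" where
  "euler k = prodinf (\<lambda>m. 1 - fps_X ^ (k * Suc m))"

lemma euler_cong_X:
  assumes "k > 0" "n \<le> M"
  shows "cong_X (Suc n) (euler k) (\<Prod>m<M. 1 - fps_X ^ (k * Suc m))"
  unfolding euler_def
  by (intro prodinf_cong_X[unfolded cong_X_def[of _ _ 1]] dvd_one_minus_X_power)
     (use assms in \<open>auto simp del: mult_Suc_right\<close>)

lemma euler_nth_0: "k > 0 \<Longrightarrow> fps_nth (euler k) 0 = 1"
  using euler_cong_X[of k 0 0] by (simp add: cong_X_iff)

text \<open>The substitution is carried out on finite products. It multiplies the order of the error
  term by d, so the congruences survive.\<close>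

lemma euler_compose:
  assumes "k > 0" "d > 0"
  shows "euler k oo fps_X ^ d = euler (k * d)"
proof (rule fps_eqI_cong_X)
  fix n
  obtain g where g: "euler k - (\<Prod>m<n. 1 - fps_X ^ (k * Suc m)) = fps_X ^ Suc n * g"
    using euler_cong_X[OF assms(1), of n n] unfolding cong_X_def by auto
  have d0: "fps_nth (fps_X ^ d :: complex fps) 0 = 0" using assms by simp
  have "(euler k oo fps_X ^ d) - (\<Prod>m<n. 1 - fps_X ^ (k * d * Suc m)) =
        (euler k - (\<Prod>m<n. 1 - fps_X ^ (k * Suc m))) oo fps_X ^ d"
    using d0 by (simp add: fps_compose_sub_distrib fps_compose_prod_distrib fps_X_power_compose
                    mult_ac flip: power_mult)
  also have "\<dots> = (fps_X ^ d) ^ Suc n * (g oo fps_X ^ d)"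
    unfolding g using d0 by (simp add: fps_compose_mult_distrib fps_X_power_compose del: power_Suc)
  finally have "cong_X (d * Suc n) (euler k oo fps_X ^ d) (\<Prod>m<n. 1 - fps_X ^ (k * d * Suc m))"
    by (simp only: cong_X_def power_mult dvd_triv_left)
  moreover have "n \<le> d * Suc n" using assms by (cases d) auto
  ultimately have "cong_X n (euler k oo fps_X ^ d) (\<Prod>m<n. 1 - fps_X ^ (k * d * Suc m))"
    using cong_X_mono by blast
  moreover have "cong_X n (euler (k * d)) (\<Prod>m<n. 1 - fps_X ^ (k * d * Suc m))"
    using euler_cong_X[of "k * d" n n] assms by (intro cong_X_mono[of n "Suc n"]) auto
  ultimately show "cong_X n (euler k oo fps_X ^ d) (euler (k * d))"
    using cong_X_sym cong_X_trans by blast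
qed

lemma fps_divide_mult_cancel: "fps_nth b 0 \<noteq> 0 \<Longrightarrow> a / b * b = (a :: complex fps)"
  by (simp add: fps_divide_unit inverse_mult_eq_1 mult.assoc)

lemma fps_eq_divideI: "b \<noteq> 0 \<Longrightarrow> a * b = c \<Longrightarrow> a = c / (b :: complex fps)"
  by auto

lemma Z_eul: "Z = fps_to_fls (fps_X ^ 2 * (euler 50 / euler 2))"
proof -
  have "prodinf (\<lambda>m. (1 - fps_X ^ (50 * Suc m)) / (1 - fps_X ^ (2 * Suc m)) :: complex fps) * euler 2 = euler 50"
    (is "prodinf ?h * _ = _")
  proof (rule fps_eqI_cong_X)
    fix n
    have h: "cong_X (Suc k) (?h k) 1" for k
      unfolding cong_X_def
      by (intro dvd_divide_minus_1 dvd_one_minus_X_power) auto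
    have "(\<Prod>m<n. ?h m) * (\<Prod>m<n. 1 - fps_X ^ (2 * Suc m)) = (\<Prod>m<n. 1 - fps_X ^ (50 * Suc m))"
      unfolding prod.distrib[symmetric]
      by (intro prod.cong refl) (simp add: fps_divide_unit inverse_mult_eq_1 mult.assoc)
    moreover have "cong_X (Suc n) (prodinf ?h * euler 2) ((\<Prod>m<n. ?h m) * (\<Prod>m<n. 1 - fps_X ^ (2 * Suc m)))"
      by (intro cong_X_mult prodinf_cong_X h euler_cong_X) auto
    ultimately have "cong_X (Suc n) (prodinf ?h * euler 2) (\<Prod>m<n. 1 - fps_X ^ (50 * Suc m))"
      by simp
    from cong_X_trans[OF this cong_X_sym[OF euler_cong_X]]
    have "cong_X (Suc n) (prodinf ?h * euler 2) (euler 50)"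
      by simp
    thus "cong_X n (prodinf ?h * euler 2) (euler 50)" by (rule cong_X_mono[rotated]) simp
  qed
  moreover have "euler 2 \<noteq> 0"
    using euler_nth_0[of 2] by auto
  ultimately have "prodinf ?h = euler 50 / euler 2"
    by (intro fps_eq_divideI)
  thus ?thesis unfolding Z_def by (simp only:)
qed

lemma y_eul: "y = fps_to_fls (fps_X * (euler 2 * euler 10 ^ 3 / (euler 1 ^ 3 * euler 5)))"
proof -
  have "prodinf (\<lambda>m. ((1 - fps_X ^ (2 * Suc m)) * (1 - fps_X ^ (10 * Suc m)) ^ 3) /
      ((1 - fps_X ^ Suc m) ^ 3 * (1 - fps_X ^ (5 * Suc m))) :: complex fps) * (euler 1 ^ 3 * euler 5) = euler 2 * euler 10 ^ 3"
    (is "prodinf ?h * _ = _")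
  proof (rule fps_eqI_cong_X)
    fix n
    let ?P = "\<lambda>k. \<Prod>m<n. 1 - fps_X ^ (k * Suc m) :: complex fps"
    have h: "cong_X (Suc k) (?h k) 1" for k
      unfolding cong_X_def
      by (intro dvd_divide_minus_1 dvd_mult_minus_1 dvd_power_minus_1 dvd_one_minus_X_power) auto
    have eq: "?h m * ((1 - fps_X ^ (1 * Suc m)) ^ 3 * (1 - fps_X ^ (5 * Suc m))) =
                (1 - fps_X ^ (2 * Suc m)) * (1 - fps_X ^ (10 * Suc m)) ^ 3" for m
      unfolding mult_1 by (rule fps_divide_mult_cancel) auto
    have "(\<Prod>m<n. ?h m) * (?P 1 ^ 3 * ?P 5) = ?P 2 * ?P 10 ^ 3"
      by (simp only: prod_power_distrib prod.distrib[symmetric] eq)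
    moreover have 1: "cong_X (Suc n) (prodinf ?h * (euler 1 ^ 3 * euler 5)) ((\<Prod>m<n. ?h m) * (?P 1 ^ 3 * ?P 5))"
      by (intro cong_X_mult cong_X_power prodinf_cong_X h euler_cong_X) auto
    moreover have 2: "cong_X (Suc n) (euler 2 * euler 10 ^ 3) (?P 2 * ?P 10 ^ 3)"
      by (intro cong_X_mult cong_X_power euler_cong_X) auto
    ultimately have "cong_X (Suc n) (prodinf ?h * (euler 1 ^ 3 * euler 5)) (euler 2 * euler 10 ^ 3)"
      using cong_X_trans[OF 1] cong_X_sym[OF 2] by simp
    thus "cong_X n (prodinf ?h * (euler 1 ^ 3 * euler 5)) (euler 2 * euler 10 ^ 3)" by (rule cong_X_mono[rotated]) simp
  qed
  moreover have "euler 1 ^ 3 * euler 5 \<noteq> 0"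
    using euler_nth_0[of 1] euler_nth_0[of 5] by auto
  ultimately have "prodinf ?h = euler 2 * euler 10 ^ 3 / (euler 1 ^ 3 * euler 5)"
    by (intro fps_eq_divideI)
  thus ?thesis unfolding y_def by (simp only:)
qed

section \<open>The Jacobi triple product\<close>

definition euler_fin :: "nat \<Rightarrow> nat \<Rightarrow> complex fps" where
  "euler_fin c n = (\<Prod>m<n. 1 - fps_X ^ (c * Suc m))"

text \<open>
  The value 0 at negative indices makes \<open>inv_euler_fin_pred\<close> and the recurrence below hold without boundary cases.
\<close>

definition inv_euler_fin :: "nat \<Rightarrow> int \<Rightarrow> complex fps" where
  "inv_euler_fin c j = (if j < 0 then 0 else inverse (euler_fin c (nat j)))"

lemma euler_fin_nth_0: "c > 0 \<Longrightarrow> fps_nth (euler_fin c n) 0 = 1"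
  by (induction n) (simp_all add: euler_fin_def)

lemma inv_euler_fin_pred:
  assumes "c > 0"
  shows "inv_euler_fin c (int j - 1) = (1 - fps_X ^ (c * j)) * inv_euler_fin c (int j)"
proof (cases j)
  case (Suc i)
  have "euler_fin c j = euler_fin c i * (1 - fps_X ^ (c * j))"
    using Suc by (simp add: euler_fin_def)
  hence "inv_euler_fin c (int j) = inv_euler_fin c (int j - 1) * inverse (1 - fps_X ^ (c * j))"
    using Suc assms unfolding inv_euler_fin_def by (simp add: fps_inverse_mult nat_add_distrib del: mult_Suc_right)
  moreover have "inverse (1 - fps_X ^ (c * j)) * (1 - fps_X ^ (c * j)) = (1 :: complex fps)"
    using Suc assms by (intro inverse_mult_eq_1) simp
  ultimately show ?thesis by (simp add: mult_ac)
qed (simp add: inv_euler_fin_def)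

text \<open>
  The recurrence in \<open>n\<close> of the coefficients in the finite triple product, with \<open>i = n + 1 - k\<close> and \<open>j = n + 1 + k\<close>.
\<close>

lemma jacobi_pointwise:
  assumes "c > 0" "i + j = 2 * n + 2"
  shows "(1 - fps_X ^ (c * (2 * n + 1))) * (1 - fps_X ^ (c * (2 * n + 2))) * (inv_euler_fin c (int i) * inv_euler_fin c (int j)) =
    (1 + fps_X ^ (c * (2 * n + 1))) * (inv_euler_fin c (int i - 1) * inv_euler_fin c (int j - 1)) +
    fps_X ^ (c * i) * (inv_euler_fin c (int i) * inv_euler_fin c (int j - 2)) +
    fps_X ^ (c * j) * (inv_euler_fin c (int i - 2) * inv_euler_fin c (int j))"
proof -
  define p :: "complex fps" where "p = fps_X ^ c"
  have pw: "fps_X ^ (c * m) = p ^ m" for m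
    by (simp add: p_def power_mult)
  have pred2: "inv_euler_fin c (int m - 2) = (1 - p ^ (m - 1)) * (1 - p ^ m) * inv_euler_fin c (int m)" for m
  proof (cases m)
    case (Suc l)
    have "inv_euler_fin c (int m - 2) = inv_euler_fin c (int l - 1)" using Suc by simp
    also have "\<dots> = (1 - p ^ l) * inv_euler_fin c (int l)" using inv_euler_fin_pred[OF assms(1), of l] by (simp add: pw)
    also have "inv_euler_fin c (int l) = (1 - p ^ m) * inv_euler_fin c (int m)"
      using inv_euler_fin_pred[OF assms(1), of m] Suc unfolding pw by simp
    finally show ?thesis using Suc by (simp add: mult_ac)
  qed (simp add: inv_euler_fin_def)
  have pred1: "inv_euler_fin c (int m - 1) = (1 - p ^ m) * inv_euler_fin c (int m)" for m
    using inv_euler_fin_pred[OF assms(1), of m] unfolding pw .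
  define g where "g = inv_euler_fin c (int i) * inv_euler_fin c (int j)"
  have "(1 - p ^ (2 * n + 1)) * (1 - p ^ (2 * n + 2)) =
    (1 + p ^ (2 * n + 1)) * ((1 - p ^ i) * (1 - p ^ j)) + p ^ i * ((1 - p ^ (j - 1)) * (1 - p ^ j)) +
    p ^ j * ((1 - p ^ (i - 1)) * (1 - p ^ i))"
  \<comment> \<open>The truncated exponents \<open>i - 1\<close> and \<open>j - 1\<close> are
    harmless at 0: they stand next to \<open>1 - p ^ i\<close> or \<open>1 - p ^ j\<close>, which
    vanishes there.\<close>
  proof (cases "i = 0 \<or> j = 0")
    case True
    thus ?thesis using assms(2) by (auto simp: algebra_simps)
  next
    case False
    then obtain i' j' where ij: "i = Suc i'" "j = Suc j'" by (metis not0_implies_Suc)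
    have 1: "p ^ (2 * n + 1) = p ^ i' * p ^ j' * p"
    proof -
      have "2 * n + 1 = i' + j' + 1" using assms(2) ij by simp
      thus ?thesis by (simp add: power_add)
    qed
    have 2: "p ^ (2 * n + 2) = p ^ i' * p ^ j' * p * p"
    proof -
      have "p ^ (2 * n + 2) = p ^ (2 * n + 1) * p" by simp
      thus ?thesis unfolding 1 .
    qed
    show ?thesis unfolding 1 2 ij diff_Suc_1 power_Suc by (simp add: algebra_simps)
  qed
  from arg_cong[OF this, of "\<lambda>t. t * g"] show ?thesis
    unfolding pw pred1 pred2 g_def by (simp add: algebra_simps)
qed

text \<open>Finite form of Jacobi's identity: together with \<open>euler_fin (a + b) (2 * n)\<close>
  the inverse products form the Gaussian binomial coefficients [2n over n + k] in q^(a+b), so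
  induction on n is available. The usual second variable is already specialised to a power of
  q.\<close>

lemma finite_triple_product:
  assumes "a > 0" "b > 0"
  shows "(\<Sum>k=-int n..int n. fps_const (alt_sign k) * fps_X ^ theta_exp a b k *
              (inv_euler_fin (a + b) (int n - k) * inv_euler_fin (a + b) (int n + k))) * euler_fin (a + b) (2 * n) =
         (\<Prod>i<n. (1 - fps_X ^ (a + (a + b) * i)) * (1 - fps_X ^ (b + (a + b) * i)))"
proof (induction n)
  case 0
  show ?case by (simp add: theta_exp_def alt_sign_def inv_euler_fin_def euler_fin_def)
next
  case (Suc n)
  define c where "c = a + b"
  have c: "c > 0" using assms by (simp add: c_def)
  define t where "t = (\<lambda>n k. fps_const (alt_sign k) * fps_X ^ theta_exp a b k * (inv_euler_fin c (int n - k) * inv_euler_fin c (int n + k)))"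
  have t0: "t n k = 0" if "\<bar>k\<bar> > int n" for k
    using that by (auto simp: t_def inv_euler_fin_def)
  define I where "I = {- int (Suc n)..int (Suc n)}"
  \<comment> \<open>All sums run over the range for n + 1. Terms of level n vanish outside their own
    range, so shifting the index by at most 1 loses nothing.\<close>
  have shift: "(\<Sum>k\<in>I. t n (k + d)) = (\<Sum>k=-int n..int n. t n k)" if "\<bar>d\<bar> \<le> 1" for d
  proof -
    have "(\<Sum>k\<in>I. t n (k + d)) = (\<Sum>k\<in>(\<lambda>k. k + d) ` I. t n k)"
      by (subst sum.reindex) (auto simp: inj_on_def)
    also have "\<dots> = (\<Sum>k=-int n..int n. t n k)"
    proof (intro sum.mono_neutral_right ballI)
      show "{- int n..int n} \<subseteq> (\<lambda>k. k + d) ` I"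
      proof
        fix k assume "k \<in> {- int n..int n}"
        hence "k = (k - d) + d" "k - d \<in> I" using that by (auto simp: I_def)
        thus "k \<in> (\<lambda>k. k + d) ` I" by blast
      qed
      fix k assume "k \<in> (\<lambda>k. k + d) ` I - {- int n..int n}"
      thus "t n k = 0" by (intro t0) auto
    qed (simp add: I_def)
    finally show ?thesis .
  qed
  have pointwise: "(1 - fps_X ^ (c * (2 * n + 1))) * (1 - fps_X ^ (c * (2 * n + 2))) * t (Suc n) k =
      (1 + fps_X ^ (c * (2 * n + 1))) * t n k - fps_X ^ (a + c * n) * t n (k + (-1))
        - fps_X ^ (b + c * n) * t n (k + 1)" if "k \<in> I" for k
  proof -
    define i where "i = nat (int n + 1 - k)"
    define j where "j = nat (int n + 1 + k)"
    have ij: "int i = int n + 1 - k" "int j = int n + 1 + k"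
      using that by (auto simp: i_def j_def I_def)
    have ij_sum: "i + j = 2 * n + 2" using ij by linarith
    have "int (theta_exp a b k + c * i) = int (theta_exp a b (k + (-1)) + (a + c * n))"
      using theta_exp_add_one[of a b "k - 1"] by (simp add: ij c_def algebra_simps)
    hence e1: "theta_exp a b k + c * i = theta_exp a b (k + (-1)) + (a + c * n)" by (simp only: of_nat_eq_iff)
    have "int (theta_exp a b k + c * j) = int (theta_exp a b (k + 1) + (b + c * n))"
      using theta_exp_add_one[of a b k] by (simp add: ij c_def algebra_simps)
    hence e2: "theta_exp a b k + c * j = theta_exp a b (k + 1) + (b + c * n)" by (simp only: of_nat_eq_iff)
    have s: "alt_sign (k + (-1)) = - alt_sign k" "alt_sign (k + 1) = - alt_sign k" by (auto simp: alt_sign_def)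
    have e1': "fps_X ^ (a + c * n) * fps_X ^ theta_exp a b (k + (-1)) = (fps_X ^ theta_exp a b k * fps_X ^ (c * i) :: complex fps)"
      by (simp only: power_add[symmetric] e1 add.commute[of "a + c * n"])
    have e2': "fps_X ^ (b + c * n) * fps_X ^ theta_exp a b (k + 1) = (fps_X ^ theta_exp a b k * fps_X ^ (c * j) :: complex fps)"
      by (simp only: power_add[symmetric] e2 add.commute[of "b + c * n"])
    define w where "w = fps_const (alt_sign k) * fps_X ^ theta_exp a b k"
    have A: "t (Suc n) k = w * (inv_euler_fin c (int i) * inv_euler_fin c (int j))"
      unfolding t_def w_def ij by (simp add: algebra_simps)
    have B: "t n k = w * (inv_euler_fin c (int i - 1) * inv_euler_fin c (int j - 1))"
      unfolding t_def w_def ij by (simp add: algebra_simps)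
    have "fps_X ^ (a + c * n) * t n (k + (-1)) = - (fps_const (alt_sign k) * (fps_X ^ (a + c * n) * fps_X ^ theta_exp a b (k + (-1))) *
            (inv_euler_fin c (int n - (k + (-1))) * inv_euler_fin c (int n + (k + (-1)))))"
      unfolding t_def s by (simp add: mult_ac flip: fps_const_neg)
    also have "\<dots> = - (w * (fps_X ^ (c * i) * (inv_euler_fin c (int i) * inv_euler_fin c (int j - 2))))"
      unfolding e1' w_def ij by (simp add: algebra_simps)
    finally have C: "fps_X ^ (a + c * n) * t n (k + (-1)) = \<dots>" .
    have "fps_X ^ (b + c * n) * t n (k + 1) = - (fps_const (alt_sign k) * (fps_X ^ (b + c * n) * fps_X ^ theta_exp a b (k + 1)) *
            (inv_euler_fin c (int n - (k + 1)) * inv_euler_fin c (int n + (k + 1))))"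
      unfolding t_def s by (simp add: mult_ac flip: fps_const_neg)
    also have "\<dots> = - (w * (fps_X ^ (c * j) * (inv_euler_fin c (int i - 2) * inv_euler_fin c (int j))))"
      unfolding e2' w_def ij by (simp add: algebra_simps)
    finally have D: "fps_X ^ (b + c * n) * t n (k + 1) = \<dots>" .
    have gen: "P * (w * g) = Q * (w * g1) - - (w * g2) - - (w * g3)"
      if "P * g = Q * g1 + g2 + g3" for P Q g g1 g2 g3 :: "complex fps"
      using arg_cong[OF that, of "\<lambda>x. w * x"] by (simp add: algebra_simps)
    show ?thesis unfolding A B C D by (rule gen) (rule jacobi_pointwise[OF c ij_sum])
  qed
  define S where "S = (\<Sum>k=-int n..int n. t n k)"
  have "(1 - fps_X ^ (c * (2 * n + 1))) * (1 - fps_X ^ (c * (2 * n + 2))) * (\<Sum>k\<in>I. t (Suc n) k) =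
          (\<Sum>k\<in>I. (1 + fps_X ^ (c * (2 * n + 1))) * t n k - fps_X ^ (a + c * n) * t n (k + (-1))
            - fps_X ^ (b + c * n) * t n (k + 1))"
    unfolding sum_distrib_left by (intro sum.cong refl pointwise)
  also have "\<dots> = (1 + fps_X ^ (c * (2 * n + 1))) * (\<Sum>k\<in>I. t n (k + 0)) - fps_X ^ (a + c * n) * (\<Sum>k\<in>I. t n (k + (-1)))
            - fps_X ^ (b + c * n) * (\<Sum>k\<in>I. t n (k + 1))"
    by (simp only: sum_distrib_left sum_subtractf add_0_right)
  also have "\<dots> = S * (1 + fps_X ^ (c * (2 * n + 1)) - fps_X ^ (a + c * n) - fps_X ^ (b + c * n))"
    unfolding S_def by (subst (1 2 3) shift) (simp_all add: algebra_simps)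
  also have "fps_X ^ (c * (2 * n + 1)) = (fps_X ^ (a + c * n) * fps_X ^ (b + c * n) :: complex fps)"
    by (simp add: c_def algebra_simps flip: power_add)
  also have "S * (1 + fps_X ^ (a + c * n) * fps_X ^ (b + c * n) - fps_X ^ (a + c * n) - fps_X ^ (b + c * n)) =
      S * ((1 - fps_X ^ (a + c * n)) * (1 - fps_X ^ (b + c * n)))"
    by (simp add: algebra_simps)
  finally have step: "(1 - fps_X ^ (a + c * n) * fps_X ^ (b + c * n)) * (1 - fps_X ^ (c * (2 * n + 2))) * (\<Sum>k\<in>I. t (Suc n) k) =
      S * ((1 - fps_X ^ (a + c * n)) * (1 - fps_X ^ (b + c * n)))" .
  have "euler_fin c (2 * Suc n) = euler_fin c (2 * n) * ((1 - fps_X ^ (c * (2 * n + 1))) * (1 - fps_X ^ (c * (2 * n + 2))))"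
    by (simp add: euler_fin_def algebra_simps)
  also have "fps_X ^ (c * (2 * n + 1)) = (fps_X ^ (a + c * n) * fps_X ^ (b + c * n) :: complex fps)"
    by (simp add: c_def algebra_simps flip: power_add)
  finally have "(\<Sum>k\<in>I. t (Suc n) k) * euler_fin c (2 * Suc n) = S * euler_fin c (2 * n) * ((1 - fps_X ^ (a + c * n)) * (1 - fps_X ^ (b + c * n)))"
    using arg_cong[OF step, of "\<lambda>x. euler_fin c (2 * n) * x"] by (simp only: mult_ac)
  thus ?case
    using Suc.IH unfolding S_def t_def I_def c_def by simp
qed

lemma cong_X_sum: "(\<And>i. i \<in> A \<Longrightarrow> cong_X n (f i) (g i)) \<Longrightarrow> cong_X n (sum f A) (sum g A)"
  unfolding cong_X_def sum_subtractf[symmetric] by (rule dvd_sum)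

theorem triple_product_cong_X:
  assumes "a > 0" "b > 0"
  shows "cong_X m (theta a b)
           (\<Prod>i<2*m. (1 - fps_X ^ ((a + b) * Suc i)) * ((1 - fps_X ^ (a + (a + b) * i)) * (1 - fps_X ^ (b + (a + b) * i))))"
proof -
  \<comment> \<open>Twice the precision: for |k| \<le> m both n - k and n + k are at least m, so all
    finite Euler products agree modulo X^m; for |k| > m the term itself vanishes modulo X^m.\<close>
  define n c where "n = 2 * m" and "c = a + b"
  have c: "c > 0" using assms by (simp add: c_def)
  define f where "f = (\<lambda>k. fps_const (alt_sign k) * fps_X ^ theta_exp a b k)"
  define g where "g = (\<lambda>k. inv_euler_fin c (int n - k) * inv_euler_fin c (int n + k))"
  let ?I = "{- int n..int n}"
  have A: "cong_X m (theta a b) (\<Sum>k\<in>?I. f k)"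
  proof (unfold cong_X_iff, intro allI impI)
    fix N assume "N < m"
    have "fps_nth (\<Sum>k\<in>?I. f k) N = (\<Sum>k\<in>?I. if theta_exp a b k = N then alt_sign k else 0)"
      unfolding f_def fps_sum_nth by (intro sum.cong) auto
    also have "\<dots> = (\<Sum>k | k \<in> ?I \<and> theta_exp a b k = N. alt_sign k)"
      by (subst sum.inter_filter[symmetric]) auto
    also have "{k. k \<in> ?I \<and> theta_exp a b k = N} = {k. k \<in> UNIV \<and> theta_exp a b k = N}"
    proof -
      have "k \<in> ?I" if "theta_exp a b k = N" for k
        using theta_exp_ge[OF assms, of k] that \<open>N < m\<close> by (auto simp: n_def)
      thus ?thesis by auto
    qed
    finally show "fps_nth (theta a b) N = fps_nth (\<Sum>k\<in>?I. f k) N"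
      by (simp add: theta_def)
  qed
  have euler: "cong_X m (euler c) (euler_fin c N)" if "m \<le> N" for N
    unfolding euler_fin_def by (rule cong_X_mono[OF _ euler_cong_X[OF c that]]) simp
  have inv: "inverse (euler_fin c N) * euler_fin c N = 1" for N
    using euler_fin_nth_0[OF c] by (intro inverse_mult_eq_1) auto
  have unit: "cong_X m (inverse (euler_fin c N) * euler_fin c N') 1" if "m \<le> N" "m \<le> N'" for N N'
    using cong_X_mult[OF cong_X_refl cong_X_trans[OF cong_X_sym[OF euler] euler], OF that(2,1), of "inverse (euler_fin c N)"]
    unfolding inv .
  have B: "cong_X m (f k) (f k * (g k * (euler_fin c (2 * n) * euler_fin c n)))" if "k \<in> ?I" for k
  proof (cases "\<bar>k\<bar> \<le> int m")
    case True
    have "g k = inverse (euler_fin c (nat (int n - k))) * inverse (euler_fin c (nat (int n + k)))"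
      using that by (auto simp: g_def inv_euler_fin_def)
    hence eq: "g k * (euler_fin c (2 * n) * euler_fin c n) =
      (inverse (euler_fin c (nat (int n - k))) * euler_fin c (2 * n)) * (inverse (euler_fin c (nat (int n + k))) * euler_fin c n)"
      by (simp add: mult_ac)
    have "cong_X m (g k * (euler_fin c (2 * n) * euler_fin c n)) (1 * 1)"
      unfolding eq by (intro cong_X_mult unit) (use True in \<open>auto simp: n_def\<close>)
    from cong_X_mult[OF cong_X_refl[of m "f k"] cong_X_sym[OF this]] show ?thesis by simp
  next
    case False
    hence "m \<le> theta_exp a b k" using theta_exp_ge[OF assms, of k] by linarith
    hence "fps_X ^ m dvd f k" unfolding f_def by (simp add: le_imp_power_dvd)
    thus ?thesis unfolding cong_X_def by auto
  qed
  have "cong_X m (\<Sum>k\<in>?I. f k) (\<Sum>k\<in>?I. f k * (g k * (euler_fin c (2 * n) * euler_fin c n)))"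
    by (intro cong_X_sum B)
  also have "(\<Sum>k\<in>?I. f k * (g k * (euler_fin c (2 * n) * euler_fin c n))) = (\<Sum>k\<in>?I. f k * g k) * euler_fin c (2 * n) * euler_fin c n"
    by (simp only: sum_distrib_right mult.assoc)
  also have "(\<Sum>k\<in>?I. f k * g k) * euler_fin c (2 * n) =
               (\<Prod>i<n. (1 - fps_X ^ (a + c * i)) * (1 - fps_X ^ (b + c * i)))"
    unfolding f_def g_def c_def by (rule finite_triple_product[OF assms])
  finally have "cong_X m (\<Sum>k\<in>?I. f k)
     ((\<Prod>i<n. (1 - fps_X ^ (a + c * i)) * (1 - fps_X ^ (b + c * i))) * euler_fin c n)" .
  from cong_X_trans[OF A this] show ?thesis
    by (simp only: euler_fin_def prod.distrib[symmetric] n_def c_def mult.commute)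
qed

section \<open>Eta quotients as theta series\<close>

lemma euler_fin_Suc: "euler_fin c (Suc n) = euler_fin c n * (1 - fps_X ^ (c * Suc n))"
  by (simp add: euler_fin_def)

lemma euler_fin_cong_X: "c > 0 \<Longrightarrow> m \<le> n \<Longrightarrow> cong_X m (euler_fin c n) (euler c)"
  unfolding euler_fin_def by (rule cong_X_sym[OF cong_X_mono[OF _ euler_cong_X[of c m n]]]) auto

text \<open>Euler's pentagonal number theorem: the residues 1, 2 and 0 modulo 3 in the triple
  product exhaust all factors.\<close>

lemma theta_1_2: "theta 1 2 = euler 1"
proof (rule fps_eqI_cong_X)
  fix m
  have "(\<Prod>i<n. (1 - fps_X ^ ((1 + 2) * Suc i)) * ((1 - fps_X ^ (1 + (1 + 2) * i)) * (1 - fps_X ^ (2 + (1 + 2) * i))))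
          = euler_fin 1 (3 * n)" for n
  proof (induction n)
    case (Suc n)
    have e: "3 * Suc n = Suc (Suc (Suc (3 * n)))" by simp
    define d where "d = (\<lambda>k. 1 - fps_X ^ (k + 3 * n) :: complex fps)"
    have E: "euler_fin 1 (3 * Suc n) = euler_fin 1 (3 * n) * d 1 * d 2 * d 3"
      unfolding e euler_fin_Suc d_def by (intro arg_cong2[of _ _ _ _ "(*)"] arg_cong2[of _ _ _ _ "(-)"] arg_cong2[of _ _ _ _ "(^)"] refl; simp)
    have "(1 - fps_X ^ ((1 + 2) * Suc n)) * ((1 - fps_X ^ (1 + (1 + 2) * n)) * (1 - fps_X ^ (2 + (1 + 2) * n))) = d 3 * (d 1 * d 2)"
      unfolding d_def by (intro arg_cong2[of _ _ _ _ "(*)"] arg_cong2[of _ _ _ _ "(-)"] arg_cong2[of _ _ _ _ "(^)"] refl; simp)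
    thus ?case unfolding prod.lessThan_Suc E Suc.IH by (simp only: mult_ac)
  qed (simp add: euler_fin_def)
  with triple_product_cong_X[of 1 2 m] have "cong_X m (theta 1 2) (euler_fin 1 (3 * (2 * m)))"
    by simp
  thus "cong_X m (theta 1 2) (euler 1)"
    by (rule cong_X_trans[OF _ euler_fin_cong_X]) auto
qed

text \<open>Gauss's product for the alternating series of squares: odd factors occur twice and even
  ones once, and \<open>euler 2\<close> supplies the missing even factors.\<close>

lemma theta_1_1: "theta 1 1 * euler 2 = euler 1 ^ 2"
proof (rule fps_eqI_cong_X)
  fix m
  have *: "(\<Prod>i<n. (1 - fps_X ^ ((1 + 1) * Suc i)) * ((1 - fps_X ^ (1 + (1 + 1) * i)) * (1 - fps_X ^ (1 + (1 + 1) * i))))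
          * euler_fin 2 n = euler_fin 1 (2 * n) ^ 2" for n
  proof (induction n)
    case (Suc n)
    have e: "2 * Suc n = Suc (Suc (2 * n))" by simp
    define d where "d = (\<lambda>k. 1 - fps_X ^ (k + 2 * n) :: complex fps)"
    have E: "euler_fin 1 (2 * Suc n) = euler_fin 1 (2 * n) * d 1 * d 2" "euler_fin 2 (Suc n) = euler_fin 2 n * d 2"
      unfolding e euler_fin_Suc d_def by (intro arg_cong2[of _ _ _ _ "(*)"] arg_cong2[of _ _ _ _ "(-)"] arg_cong2[of _ _ _ _ "(^)"] refl; simp)+
    have D: "(1 - fps_X ^ ((1 + 1) * Suc n)) * ((1 - fps_X ^ (1 + (1 + 1) * n)) * (1 - fps_X ^ (1 + (1 + 1) * n))) = d 2 * (d 1 * d 1)"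
      unfolding d_def by (intro arg_cong2[of _ _ _ _ "(*)"] arg_cong2[of _ _ _ _ "(-)"] arg_cong2[of _ _ _ _ "(^)"] refl; simp)
    have gen: "P * (d 2 * (d 1 * d 1)) * (Q * d 2) = (R * d 1 * d 2) ^ 2" if "P * Q = R ^ 2" for P Q R
      using arg_cong[OF that, of "\<lambda>x. x * (d 1 * d 2) ^ 2"] by (simp only: power2_eq_square mult_ac)
    show ?case unfolding prod.lessThan_Suc E D by (rule gen) (rule Suc.IH)
  qed (simp add: euler_fin_def)
  have "cong_X m (theta 1 1 * euler 2) (euler_fin 1 (2 * (2 * m)) ^ 2)"
    unfolding *[symmetric]
    by (intro cong_X_mult triple_product_cong_X cong_X_sym[OF euler_fin_cong_X]) auto
  moreover have "cong_X m (euler_fin 1 (2 * (2 * m)) ^ 2) (euler 1 ^ 2)"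
    by (intro cong_X_power euler_fin_cong_X) auto
  ultimately show "cong_X m (theta 1 1 * euler 2) (euler 1 ^ 2)"
    by (rule cong_X_trans)
qed

text \<open>The theta series contain the residues prime to 10, \<open>euler 2\<close> adds the even
  ones and \<open>euler 5\<close> the multiples of 5. So every residue occurs, and multiples of 10
  occur three extra times.\<close>

lemma theta_9_1_theta_3_7: "theta 9 1 * theta 3 7 * (euler 2 * euler 5) = euler 10 ^ 3 * euler 1"
proof (rule fps_eqI_cong_X)
  fix m
  have *: "(\<Prod>i<n. (1 - fps_X ^ ((9 + 1) * Suc i)) * ((1 - fps_X ^ (9 + (9 + 1) * i)) * (1 - fps_X ^ (1 + (9 + 1) * i))))
          * (\<Prod>i<n. (1 - fps_X ^ ((3 + 7) * Suc i)) * ((1 - fps_X ^ (3 + (3 + 7) * i)) * (1 - fps_X ^ (7 + (3 + 7) * i))))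
          * (euler_fin 2 (5 * n) * euler_fin 5 (2 * n)) = euler_fin 10 n ^ 3 * euler_fin 1 (10 * n)" for n
  proof (induction n)
    case (Suc n)
    have e: "5 * Suc n = Suc (Suc (Suc (Suc (Suc (5 * n)))))" "2 * Suc n = Suc (Suc (2 * n))"
      "10 * Suc n = Suc (Suc (Suc (Suc (Suc (Suc (Suc (Suc (Suc (Suc (10 * n))))))))))" by simp_all
    define d where "d = (\<lambda>k. 1 - fps_X ^ (k + 10 * n) :: complex fps)"
    have d: "1 - fps_X ^ (k + (9 + 1) * n) = d k" "1 - fps_X ^ (k + (3 + 7) * n) = d k" for k
      by (simp_all add: d_def)
    have E5: "euler_fin 2 (5 * Suc n) = euler_fin 2 (5 * n) * d 2 * d 4 * d 6 * d 8 * d 10"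
      unfolding e euler_fin_Suc d_def by (intro arg_cong2[of _ _ _ _ "(*)"] arg_cong2[of _ _ _ _ "(-)"] arg_cong2[of _ _ _ _ "(^)"] refl; simp)
    have E2: "euler_fin 5 (2 * Suc n) = euler_fin 5 (2 * n) * d 5 * d 10"
      unfolding e euler_fin_Suc d_def by (intro arg_cong2[of _ _ _ _ "(*)"] arg_cong2[of _ _ _ _ "(-)"] arg_cong2[of _ _ _ _ "(^)"] refl; simp)
    have E10: "euler_fin 1 (10 * Suc n) = euler_fin 1 (10 * n) * d 1 * d 2 * d 3 * d 4 * d 5 * d 6 * d 7 * d 8 * d 9 * d 10"
      unfolding e euler_fin_Suc d_def by (intro arg_cong2[of _ _ _ _ "(*)"] arg_cong2[of _ _ _ _ "(-)"] arg_cong2[of _ _ _ _ "(^)"] refl; simp)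
    have E1: "euler_fin 10 (Suc n) = euler_fin 10 n * d 10" "1 - fps_X ^ ((9 + 1) * Suc n) = d 10" "1 - fps_X ^ ((3 + 7) * Suc n) = d 10"
      unfolding euler_fin_Suc d_def by (intro arg_cong2[of _ _ _ _ "(*)"] arg_cong2[of _ _ _ _ "(-)"] arg_cong2[of _ _ _ _ "(^)"] refl; simp)+
    have gen: "P * (d 10 * (d 9 * d 1)) * (Q * (d 10 * (d 3 * d 7))) *
        (A * d 2 * d 4 * d 6 * d 8 * d 10 * (B * d 5 * d 10)) = (C * d 10) ^ 3 * (D * d 1 * d 2 * d 3 * d 4 * d 5 * d 6 * d 7 * d 8 * d 9 * d 10)"
      if "P * Q * (A * B) = C ^ 3 * D" for P Q A B C D
      using arg_cong[OF that, of "\<lambda>x. x * (d 10 ^ 4 * (d 1 * d 2 * d 3 * d 4 * d 5 * d 6 * d 7 * d 8 * d 9))"]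
      by (simp only: power_mult_distrib power4_eq_xxxx power3_eq_cube mult_ac)
    show ?case unfolding prod.lessThan_Suc d E5 E2 E10 E1 by (rule gen) (rule Suc.IH)
  qed (simp add: euler_fin_def)
  have "cong_X m (theta 9 1 * theta 3 7 * (euler 2 * euler 5)) (euler_fin 10 (2 * m) ^ 3 * euler_fin 1 (10 * (2 * m)))"
    unfolding *[symmetric]
    by (intro cong_X_mult triple_product_cong_X cong_X_sym[OF euler_fin_cong_X]) auto
  moreover have "cong_X m (euler_fin 10 (2 * m) ^ 3 * euler_fin 1 (10 * (2 * m))) (euler 10 ^ 3 * euler 1)"
    by (intro cong_X_mult cong_X_power euler_fin_cong_X) auto
  ultimately show "cong_X m (theta 9 1 * theta 3 7 * (euler 2 * euler 5)) (euler 10 ^ 3 * euler 1)"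
    by (rule cong_X_trans)
qed

section \<open>Dissection of theta series modulo 5\<close>

lemma gen_series_classes:
  assumes "finite_fibres S e" "finite qderiv" "cl ` S \<subseteq> qderiv"
  shows "gen_series S e w = (\<Sum>t\<in>qderiv. gen_series {i \<in> S. cl i = t} e w)"
proof (rule fps_ext)
  fix N
  have "(\<Sum>t\<in>qderiv. \<Sum>i | i \<in> {i \<in> S. e i = N} \<and> cl i = t. w i) = (\<Sum>i | i \<in> S \<and> e i = N. w i)"
    using assms by (intro sum.group) (auto simp: finite_fibres_def)
  thus "fps_nth (gen_series S e w) N = fps_nth (\<Sum>t\<in>qderiv. gen_series {i \<in> S. cl i = t} e w) N"
    by (simp add: fps_sum_nth conj_ac)
qed

lemma mod5_set: "{0..4::int} = {0, 1, 2, 3, 4}"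
  by auto

lemma gen_series_mod5:
  assumes "finite_fibres UNIV e"
  shows "gen_series (UNIV :: int set) e w = gen_series {k. k mod 5 = 0} e w + gen_series {k. k mod 5 = 1} e w + gen_series {k. k mod 5 = 2} e w
           + gen_series {k. k mod 5 = 3} e w + gen_series {k. k mod 5 = 4} e w"
proof -
  have "k mod 5 \<in> {0..4}" for k :: int by simp
  thus ?thesis
    by (subst gen_series_classes[OF assms, of "{0..4}" "\<lambda>k. k mod 5"]) (auto simp: mod5_set add_ac)
qed

text \<open>The sign \<open>s\<close> allows a class to be traversed backwards, which matches two
  opposite classes with the same theta series.\<close>

lemma bij_mod5:
  assumes "s = 1 \<or> s = - 1"
  shows "bij_betw (\<lambda>j. s * (5 * j) + r) UNIV {k :: int. k mod 5 = r mod 5}"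
proof (rule bij_betw_byWitness[where f' = "\<lambda>k. s * ((k - r) div 5)"])
  show "\<forall>k\<in>{k. k mod 5 = r mod 5}. s * (5 * (s * ((k - r) div 5))) + r = k"
  proof
    fix k assume "k \<in> {k. k mod 5 = r mod 5}"
    hence "5 dvd k - r" by (simp add: mod_eq_dvd_iff)
    thus "s * (5 * (s * ((k - r) div 5))) + r = k" using assms by auto
  qed
  have "(s * (5 * j) + r) mod 5 = r mod 5" for j
    using assms by (elim disjE) (simp_all, presburger)
  thus "range (\<lambda>j. s * (5 * j) + r) \<subseteq> {k. k mod 5 = r mod 5}"
    by auto
qed (use assms in auto)

lemma int_te_1_1: "int (theta_exp 1 1 k) = k * k"
  using int_te[of 1 1 k] by (simp add: algebra_simps)

lemma alt_sign_neg: "alt_sign (- k) = alt_sign k" and alt_sign_5: "alt_sign (5 * k) = alt_sign k" and alt_sign_2: "alt_sign (2 * k) = 1"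
  by (auto simp: alt_sign_def)

lemmas alt_sign_simps = alt_sign_add alt_sign_neg alt_sign_5 alt_sign_2

text \<open>The exponents are squares k^2. The classes 1 and -1 of k modulo 5 yield the same
  exponents 5 (5 j^2 - 2 j) + 1, the classes 2 and -2 the same exponents 5 (5 j^2 + 4 j) + 4; hence
  the factors 2.\<close>

lemma theta_1_1_split:
  "theta 1 1 = (theta 1 1 oo fps_X ^ 25) - 2 * fps_X * (theta 3 7 oo fps_X ^ 5) + 2 * fps_X ^ 4 * (theta 9 1 oo fps_X ^ 5)"
proof -
  let ?g = "\<lambda>r. gen_series {k. k mod 5 = r} (theta_exp 1 1) alt_sign"
  have eqI: "m = n" if "2 * int m = 2 * int n" for m n using that by simp
  have 0: "?g 0 = (theta 1 1 oo fps_X ^ 25)"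
  proof -
    have "theta_exp 1 1 (1 * (5 * j) + 0) = 25 * theta_exp 1 1 j" for j
      by (rule eqI) (simp only: int_te of_nat_mult of_nat_numeral mult.left_commute[of 2], simp add: algebra_simps)
    hence "gen_series UNIV (\<lambda>j. 25 * theta_exp 1 1 j) alt_sign = ?g 0"
      using bij_mod5[of 1 0] by (intro gen_series_reindex[where f = "\<lambda>j. 1 * (5 * j) + 0"]) (auto simp: alt_sign_simps)
    thus ?thesis by (simp add: gen_series_compose theta_def)
  qed
  have 1: "?g (r mod 5) = - (fps_X * (theta 3 7 oo fps_X ^ 5))" if "s = 1 \<or> s = - 1" "r = - s" for s r
  proof -
    have "theta_exp 1 1 (s * (5 * j) + r) = 5 * theta_exp 3 7 j + 1" for j
      using that by (intro eqI) (simp only: int_te of_nat_mult of_nat_add of_nat_numeral of_nat_1 distrib_left mult.left_commute[of 2], auto simp: algebra_simps)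
    hence "gen_series UNIV (\<lambda>j. 5 * theta_exp 3 7 j + 1) (\<lambda>j. - alt_sign j) = ?g (r mod 5)"
      using bij_mod5[of s r] that by (intro gen_series_reindex[where f = "\<lambda>j. s * (5 * j) + r"]) (auto simp: alt_sign_def)
    moreover have "gen_series UNIV (\<lambda>j. 5 * theta_exp 3 7 j + 1) (\<lambda>j. - alt_sign j) = - (fps_X * (theta 3 7 oo fps_X ^ 5))"
      by (subst gen_series_shift) (simp add: gen_series_compose theta_def gen_series_uminus)
    ultimately show ?thesis by simp
  qed
  have 2: "?g (r mod 5) = fps_X ^ 4 * (theta 9 1 oo fps_X ^ 5)" if "s = 1 \<or> s = - 1" "r = 2 * s" for s r
  proof -
    have "theta_exp 1 1 (s * (5 * j) + r) = 5 * theta_exp 9 1 j + 4" for j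
      using that by (intro eqI) (simp only: int_te of_nat_mult of_nat_add of_nat_numeral of_nat_1 distrib_left mult.left_commute[of 2], auto simp: algebra_simps)
    hence "gen_series UNIV (\<lambda>j. 5 * theta_exp 9 1 j + 4) alt_sign = ?g (r mod 5)"
      using bij_mod5[of s r] that by (intro gen_series_reindex[where f = "\<lambda>j. s * (5 * j) + r"]) (auto simp: alt_sign_def)
    moreover have "gen_series UNIV (\<lambda>j. 5 * theta_exp 9 1 j + 4) alt_sign = fps_X ^ 4 * (theta 9 1 oo fps_X ^ 5)"
      by (subst gen_series_shift) (simp add: gen_series_compose theta_def)
    ultimately show ?thesis by simp
  qed
  have "theta 1 1 = ?g 0 + ?g 1 + ?g 2 + ?g 3 + ?g 4"
    unfolding theta_def by (rule gen_series_mod5) (simp add: finite_fibres_te)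
  also have "\<dots> = (theta 1 1 oo fps_X ^ 25) - fps_X * (theta 3 7 oo fps_X ^ 5) + fps_X ^ 4 * (theta 9 1 oo fps_X ^ 5)
      + fps_X ^ 4 * (theta 9 1 oo fps_X ^ 5) - fps_X * (theta 3 7 oo fps_X ^ 5)"
    using 0 1[of 1 "-1"] 1[of "-1" 1] 2[of 1 2] 2[of "-1" "-2"] by (simp del: One_nat_def)
  finally show ?thesis by (simp add: algebra_simps)
qed

text \<open>The pentagonal exponents k (3 k - 1) / 2 are 0, 1 or 2 modulo 5, and 1 occurs only for k
  = 1 modulo 5, where the series reproduces itself at q^25. The other two parts stay bare series
  here; their product is found later through the grading.\<close>

lemma theta_1_2_split:
  obtains g0 g2 where "theta 1 2 = g0 - fps_X * (theta 1 2 oo fps_X ^ 25) + g2"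
    "\<And>n. fps_nth g0 n \<noteq> 0 \<Longrightarrow> n mod 5 = 0" "\<And>n. fps_nth g2 n \<noteq> 0 \<Longrightarrow> n mod 5 = 2"
proof -
  let ?g = "\<lambda>r. gen_series {k. k mod 5 = r} (theta_exp 1 2) alt_sign"
  have te5: "int (theta_exp 1 2 k) mod 5 = (if k mod 5 \<in> {0, 2} then 0 else 2)" if "k mod 5 \<noteq> 1" for k
  proof -
    define q where "q = k div 5"
    have k: "k = 5 * q + k mod 5" by (simp add: q_def)
    have "2 * int (theta_exp 1 2 k) = 3 * k * k - k" unfolding int_te by (simp add: algebra_simps)
    also have "\<dots> = 5 * (15 * q * q + 6 * q * (k mod 5) - q) + (3 * (k mod 5) * (k mod 5) - k mod 5)"
      by (subst (1 2 3) k) (simp add: algebra_simps)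
    finally obtain c where c: "2 * int (theta_exp 1 2 k) = 5 * c + (3 * (k mod 5) * (k mod 5) - k mod 5)" ..
    have "k mod 5 = 0 \<or> k mod 5 = 2 \<or> k mod 5 = 3 \<or> k mod 5 = 4" using that by presburger
    thus ?thesis
    proof (elim disjE)
      assume "k mod 5 = 0"
      thus ?thesis using c by (simp, presburger)
    next
      assume "k mod 5 = 2"
      thus ?thesis using c by (simp, presburger)
    next
      assume "k mod 5 = 3"
      thus ?thesis using c by (simp, presburger)
    next
      assume "k mod 5 = 4"
      thus ?thesis using c by (simp, presburger)
    qed
  qed
  have 1: "?g 1 = - (fps_X * (theta 1 2 oo fps_X ^ 25))"
  proof -
    have "theta_exp 1 2 ((- 1) * (5 * j) + 1) = 25 * theta_exp 1 2 j + 1" for j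
    proof -
      have "2 * int (theta_exp 1 2 ((- 1) * (5 * j) + 1)) = 2 * int (25 * theta_exp 1 2 j + 1)"
        by (simp only: int_te of_nat_mult of_nat_add of_nat_numeral of_nat_1 distrib_left mult.left_commute[of 2], simp add: algebra_simps)
      thus ?thesis by simp
    qed
    hence "gen_series UNIV (\<lambda>j. 25 * theta_exp 1 2 j + 1) (\<lambda>j. - alt_sign j) = ?g 1"
      using bij_mod5[of "-1" 1] by (intro gen_series_reindex[where f = "\<lambda>j. (- 1) * (5 * j) + 1"]) (auto simp: alt_sign_def)
    moreover have "gen_series UNIV (\<lambda>j. 25 * theta_exp 1 2 j + 1) (\<lambda>j. - alt_sign j) = - (fps_X * (theta 1 2 oo fps_X ^ 25))"
      by (subst gen_series_shift) (simp add: gen_series_compose theta_def gen_series_uminus)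
    ultimately show ?thesis by simp
  qed
  have grade: "n mod 5 = d" if "fps_nth (?g r) n \<noteq> 0" "r \<noteq> 1" "d = (if r \<in> {0, 2} then 0 else 2)" for n d r
  proof -
    have "\<exists>k. k mod 5 = r \<and> theta_exp 1 2 k = n"
    proof (rule ccontr)
      assume "\<not> ?thesis"
      hence "{i. i \<in> {k. k mod 5 = r} \<and> theta_exp 1 2 i = n} = {}" by blast
      thus False using that(1) by (simp only: gen_series_nth sum.empty)
    qed
    then obtain k where "k mod 5 = r" "theta_exp 1 2 k = n" by blast
    with te5[of k] that have "int (n mod 5) = int d" by (auto simp: zmod_int)
    thus ?thesis by (simp only: of_nat_eq_iff)
  qed
  show thesis
  proof
    show "theta 1 2 = (?g 0 + ?g 2) - fps_X * (theta 1 2 oo fps_X ^ 25) + (?g 3 + ?g 4)"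
      using 1 gen_series_mod5[OF finite_fibres_te[of 1 2, simplified], of alt_sign] by (simp add: theta_def)
    show "n mod 5 = 0" if "fps_nth (?g 0 + ?g 2) n \<noteq> 0" for n
    proof -
      have "fps_nth (?g 0) n \<noteq> 0 \<or> fps_nth (?g 2) n \<noteq> 0" using that by (auto simp del: gen_series_nth)
      thus ?thesis using grade[of 0 n 0] grade[of 2 n 0] by (auto simp del: gen_series_nth)
    qed
    show "n mod 5 = 2" if "fps_nth (?g 3 + ?g 4) n \<noteq> 0" for n
    proof -
      have "fps_nth (?g 3) n \<noteq> 0 \<or> fps_nth (?g 4) n \<noteq> 0" using that by (auto simp del: gen_series_nth)
      thus ?thesis using grade[of 3 n 2] grade[of 4 n 2] by (auto simp del: gen_series_nth)
    qed
  qed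
qed

lemma finite_fibres_pair:
  assumes "finite_fibres UNIV e" "finite_fibres UNIV d"
  shows "finite_fibres UNIV (\<lambda>(i, j). e i + d j)"
  unfolding finite_fibres_def
proof
  fix N
  have "{p. (case p of (i, j) \<Rightarrow> e i + d j) = N} \<subseteq> (\<Union>k\<in>{..N}. {i \<in> UNIV. e i = k} \<times> {j \<in> UNIV. d j = N - k})"
    by auto
  moreover have "finite (\<Union>k\<in>{..N}. {i \<in> UNIV. e i = k} \<times> {j \<in> UNIV. d j = N - k})"
    using assms by (auto simp: finite_fibres_def)
  ultimately show "finite {p \<in> UNIV. (case p of (i, j) \<Rightarrow> e i + d j) = N}"
    by (simp add: finite_subset)
qed

text \<open>In the Gaussian integers this is a + b i -> c + (2 + i) (a + b i). Since i = -2 modulo 2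
  + i, the class of m + n i is m - 2 n modulo 5.\<close>

lemma bij_gauss:
  fixes c :: int
  assumes "c mod 5 = c"
  shows "bij_betw (\<lambda>(a, b). (c + 2 * a - b, a + 2 * b)) UNIV {(m, n). (m - 2 * n) mod 5 = c}"
proof (rule bij_betw_imageI)
  show "inj (\<lambda>(a, b). (c + 2 * a - b, a + 2 * b))"
    by (rule injI) auto
  show "range (\<lambda>(a, b). (c + 2 * a - b, a + 2 * b)) = {(m, n). (m - 2 * n) mod 5 = c}"
  proof (rule equalityI; rule subsetI)
    fix p assume "p \<in> range (\<lambda>(a, b). (c + 2 * a - b, a + 2 * b))"
    then obtain a b where p: "p = (c + 2 * a - b, a + 2 * b)" by auto
    have "c + 2 * a - b - 2 * (a + 2 * b) = c + 5 * (- b)" by simp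
    hence "(c + 2 * a - b - 2 * (a + 2 * b)) mod 5 = c mod 5" by (simp only: mod_mult_self2)
    thus "p \<in> {(m, n). (m - 2 * n) mod 5 = c}" using assms p by simp
  next
    fix p :: "int \<times> int" assume p: "p \<in> {(m, n). (m - 2 * n) mod 5 = c}"
    obtain m n where mn: "p = (m, n)" by (cases p)
    define q where "q = (m - 2 * n) div 5"
    have "m - 2 * n = 5 * q + c" using p mn by (auto simp: q_def)
    hence "p = (case (n + 2 * q, - q) of (a, b) \<Rightarrow> (c + 2 * a - b, a + 2 * b))" using mn by simp
    thus "p \<in> range (\<lambda>(a, b). (c + 2 * a - b, a + 2 * b))" by blast
  qed
qed

text \<open>
  Sort the Gaussian integers by their class modulo \<open>2 + i\<close>: the multiples of \<open>2 + i\<close> give \<open>theta 1 1\<close> at \<open>q^5\<close>, and multiplication by the unit \<open>i\<close> permutes the four other classes.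
\<close>

lemma theta_1_1_square:
  "theta 1 1 ^ 2 = (theta 1 1 oo fps_X ^ 5) ^ 2 - 4 * fps_X * theta 9 1 * theta 3 7"
proof -
  define e where "e = (\<lambda>(m, n). theta_exp 1 1 m + theta_exp 1 1 n)"
  define w where "w = (\<lambda>(m, n). alt_sign m * alt_sign n)"
  define cl where "cl = (\<lambda>(m :: int, n :: int). (m - 2 * n) mod 5)"
  let ?g = "\<lambda>t. gen_series {p. cl p = t} e w"
  have eqI: "m = n" if "int m = int n" for m n using that by simp
  have finite_fibres: "finite_fibres UNIV (theta_exp a b)" if "a > 0" "b > 0" for a b using finite_fibres_te that .
  have "theta 1 1 ^ 2 = gen_series UNIV e w"
    unfolding power2_eq_square theta_def by (subst gen_series_mult) (simp_all add: finite_fibres e_def w_def)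
  also have "\<dots> = (\<Sum>t\<in>{0..4}. ?g t)"
    by (subst gen_series_classes[of _ _ "{0..4}" cl]) (auto simp: e_def cl_def intro!: finite_fibres_pair finite_fibres)
  also have "\<dots> = ?g 0 + (?g 1 + ?g 2 + ?g 3 + ?g 4)"
    by (simp add: mod5_set add_ac)
  also have "?g 0 = (theta 1 1 oo fps_X ^ 5) ^ 2"
  proof -
    have "bij_betw (\<lambda>(a, b). (2 * a - b, a + 2 * b)) UNIV {p. cl p = 0}"
      using bij_gauss[of 0] by (simp add: cl_def case_prod_unfold)
    hence "gen_series UNIV (\<lambda>(a, b). 5 * theta_exp 1 1 a + 5 * theta_exp 1 1 b) w = ?g 0"
      by (rule gen_series_reindex)
         (auto simp: e_def w_def alt_sign_def int_te_1_1 algebra_simps simp del: One_nat_def intro!: eqI)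
    moreover have "(theta 1 1 oo fps_X ^ 5) = gen_series UNIV (\<lambda>k. 5 * theta_exp 1 1 k) alt_sign"
      by (simp add: theta_def gen_series_compose)
    moreover have "finite_fibres UNIV (\<lambda>k. 5 * theta_exp 1 1 k)"
      unfolding finite_fibres_def
    proof
      fix N
      have "{k \<in> UNIV. 5 * theta_exp 1 1 k = N} \<subseteq> {k \<in> UNIV. theta_exp 1 1 k = N div 5}" by auto
      thus "finite {k \<in> UNIV. 5 * theta_exp 1 1 k = N}"
        using finite_fibres[of 1 1] unfolding finite_fibres_def by (meson finite_subset zero_less_one)
    qed
    ultimately show ?thesis
      by (simp add: power2_eq_square gen_series_mult w_def)
  qed
  also have one: "?g 1 = - (fps_X * (theta 9 1 * theta 3 7))"
  proof -
    have "bij_betw (\<lambda>(a, b). (1 + 2 * a - b, a + 2 * b)) UNIV {p. cl p = 1}"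
      using bij_gauss[of 1] by (simp add: cl_def case_prod_unfold)
    moreover have "int (theta_exp 9 1 a) = 5 * a * a + 4 * a" "int (theta_exp 3 7 a) = 5 * a * a - 2 * a" for a
      using int_te[of 9 1 a] int_te[of 3 7 a] by (simp_all add: algebra_simps)
    ultimately have "gen_series UNIV (\<lambda>p. (case p of (a, b) \<Rightarrow> theta_exp 9 1 a + theta_exp 3 7 b) + 1) (\<lambda>p. - (case p of (a, b) \<Rightarrow> alt_sign a * alt_sign b)) = ?g 1"
      by (intro gen_series_reindex[where f = "\<lambda>(a, b). (1 + 2 * a - b, a + 2 * b)"])
         (auto simp: e_def w_def alt_sign_def int_te_1_1 algebra_simps simp del: One_nat_def intro!: eqI)
    moreover have "theta 9 1 * theta 3 7 = gen_series UNIV (\<lambda>(a, b). theta_exp 9 1 a + theta_exp 3 7 b) (\<lambda>(a, b). alt_sign a * alt_sign b)"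
      unfolding theta_def by (subst gen_series_mult) (simp_all add: finite_fibres)
    ultimately show ?thesis
      by (simp add: gen_series_shift[of _ _ 1, simplified] gen_series_uminus)
  qed
  also have "?g 2 = ?g 1"
  proof (rule gen_series_reindex)
    show "bij_betw (\<lambda>(m, n). (- n, m)) {p. cl p = 2} {p. cl p = 1}"
      by (rule bij_betw_byWitness[where f' = "\<lambda>(m, n). (n, - m)"]) (auto simp: cl_def, presburger+)
  qed (auto simp: e_def w_def alt_sign_neg int_te_1_1 simp del: One_nat_def intro!: eqI)
  also have "?g 3 = ?g 1"
  proof (rule gen_series_reindex)
    show "bij_betw (\<lambda>(m, n). (n, - m)) {p. cl p = 3} {p. cl p = 1}"
      by (rule bij_betw_byWitness[where f' = "\<lambda>(m, n). (- n, m)"]) (auto simp: cl_def, presburger+)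
  qed (auto simp: e_def w_def alt_sign_neg int_te_1_1 simp del: One_nat_def intro!: eqI)
  also have "?g 4 = ?g 1"
  proof (rule gen_series_reindex)
    show "bij_betw (\<lambda>(m, n). (- m, - n)) {p. cl p = 4} {p. cl p = 1}"
      by (rule bij_betw_byWitness[where f' = "\<lambda>(m, n). (- m, - n)"]) (auto simp: cl_def, presburger+)
  qed (auto simp: e_def w_def alt_sign_neg int_te_1_1 simp del: One_nat_def intro!: eqI)
  also note one
  finally show ?thesis by (simp add: algebra_simps)
qed

section \<open>Eta quotients and the grading modulo 5\<close>

lemma compose_power_eq_0_iff:
  fixes f :: "complex fls"
  assumes "d > 0"
  shows "fls_compose_power f d = 0 \<longleftrightarrow> f = 0"
proof
  assume *: "fls_compose_power f d = 0"
  show "f = 0"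
  proof (rule fls_eqI)
    fix n
    have "fls_nth (fls_compose_power f d) (int d * n) = fls_nth f n"
      using assms by (simp add: fls_nth_compose_power)
    thus "fls_nth f n = fls_nth 0 n" using * by simp
  qed
qed simp

text \<open>Used with d = 5: an identity may be proved after q is replaced by q^5, where the
  dissection operates.\<close>

lemma compose_power_inj:
  fixes f g :: "complex fls"
  assumes "d > 0" "fls_compose_power f d = fls_compose_power g d"
  shows "f = g"
  using compose_power_eq_0_iff[of d "f - g"] assms by simp

lemma compose_power_divide:
  fixes f g :: "complex fls"
  assumes "d > 0"
  shows "fls_compose_power (f / g) d = fls_compose_power f d / fls_compose_power g d"
proof (cases "g = 0")
  case False
  hence "fls_compose_power (f / g) d * fls_compose_power g d = fls_compose_power f d"
    by (simp flip: fls_compose_power_mult)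
  thus ?thesis using False assms by (simp add: compose_power_eq_0_iff eq_divide_eq)
qed simp

lemma compose_power_numeral: "d > 0 \<Longrightarrow> fls_compose_power (numeral n :: complex fls) d = numeral n"
  using fls_compose_power_const_left[of d "numeral n :: complex"] by simp

lemma compose_power_X: "d > 0 \<Longrightarrow> fls_compose_power (fls_X :: complex fls) d = fls_X ^ d"
  using fls_compose_power_fps_to_fls[of d "fps_X :: complex fps"]
  by (simp add: fps_to_fls_power)

declare fls_compose_power_X [simp del]

lemmas compose_power_simps = compose_power_X compose_power_divide compose_power_numeral fls_compose_power_power

definition E :: "nat \<Rightarrow> complex fls" where
  "E k = fps_to_fls (euler k)"

lemma E_nonzero [simp]: "k > 0 \<Longrightarrow> E k \<noteq> 0"
  unfolding E_def using euler_nth_0[of k] by (metis fps_zero_nth fps_to_fls_eq_0_iff zero_neq_one)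

lemma E_compose: "k > 0 \<Longrightarrow> d > 0 \<Longrightarrow> fls_compose_power (E k) d = E (k * d)"
  by (simp add: E_def fls_compose_power_fps_to_fls euler_compose)

lemma fps_to_fls_divide_unit:
  fixes f g :: "complex fps"
  assumes "fps_nth g 0 \<noteq> 0"
  shows "fps_to_fls (f / g) = fps_to_fls f / fps_to_fls g"
proof -
  have "fps_to_fls (f / g) * fps_to_fls g = fps_to_fls f"
    using fps_divide_mult_cancel[OF assms, of f] by (simp flip: fls_times_fps_to_fls)
  moreover have "fps_to_fls g \<noteq> 0" using assms by auto
  ultimately show ?thesis by (simp add: eq_divide_eq)
qed

lemma Z_E: "Z = fls_X ^ 2 * E 50 / E 2"
  unfolding Z_eul E_def
  by (simp add: fls_times_fps_to_fls fps_to_fls_divide_unit euler_nth_0 fps_to_fls_power)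

lemma y_E: "y = fls_X * E 2 * E 10 ^ 3 / (E 1 ^ 3 * E 5)"
proof -
  have "fps_nth (euler 1 ^ 3 * euler 5) 0 \<noteq> 0"
    using euler_nth_0[of 1] euler_nth_0[of 5] by simp
  thus ?thesis
    unfolding y_eul E_def
    by (simp add: fls_times_fps_to_fls fps_to_fls_divide_unit fps_to_fls_power)
qed

definition hq :: "complex fls" where
  "hq = fls_X * E 10 ^ 5 * E 1 / (E 2 * E 5 ^ 5)"

definition theta_fls :: "nat \<Rightarrow> nat \<Rightarrow> complex fls" where
  "theta_fls a b = fps_to_fls (theta a b)"

lemma theta_fls_1_1: "theta_fls 1 1 = E 1 ^ 2 / E 2"
proof -
  have "theta_fls 1 1 * E 2 = E 1 ^ 2"
    unfolding theta_fls_def E_def by (simp only: theta_1_1 fls_times_fps_to_fls[symmetric] fps_to_fls_power[symmetric])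
  thus ?thesis by (simp add: eq_divide_eq)
qed

lemma theta_fls_9_1: "theta_fls 9 1 * theta_fls 3 7 = E 10 ^ 3 * E 1 / (E 2 * E 5)"
proof -
  have "theta_fls 9 1 * theta_fls 3 7 * (E 2 * E 5) = E 10 ^ 3 * E 1"
    unfolding theta_fls_def E_def
    by (simp only: theta_9_1_theta_3_7 fls_times_fps_to_fls[symmetric] fps_to_fls_power[symmetric])
  thus ?thesis by (simp add: eq_divide_eq)
qed

text \<open>This is \<open>theta_1_1_square\<close> divided by the square of theta at q^5, with all
  theta series written as eta quotients.\<close>

lemma one_minus_4_hq: "1 - 4 * hq = (E 1 ^ 2 * E 10 / (E 2 * E 5 ^ 2)) ^ 2"
proof -
  have "theta_fls 1 1 ^ 2 = fls_compose_power (theta_fls 1 1) 5 ^ 2 - 4 * fls_X * (theta_fls 9 1 * theta_fls 3 7)"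
  proof -
    have "theta_fls 1 1 ^ 2 = fps_to_fls (theta 1 1 ^ 2)"
      unfolding theta_fls_def by (simp add: fps_to_fls_power)
    thus ?thesis
      unfolding theta_1_1_square theta_fls_def
      by (simp add: fls_compose_power_fps_to_fls fps_to_fls_power fls_times_fps_to_fls mult_ac)
  qed
  hence "(E 1 ^ 2 / E 2) ^ 2 = (E 5 ^ 2 / E 10) ^ 2 - 4 * fls_X * (E 10 ^ 3 * E 1 / (E 2 * E 5))"
    unfolding theta_fls_1_1 theta_fls_9_1 by (simp add: compose_power_simps E_compose)
  hence "(E 1 ^ 2 / E 2) ^ 2 * (E 10 / E 5 ^ 2) ^ 2 = 1 - 4 * hq"
    unfolding hq_def by (simp add: field_simps eval_nat_numeral)
  thus ?thesis by (simp add: field_simps)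
qed

lemma y_hq: "y * (1 - 4 * hq) = hq"
  unfolding one_minus_4_hq by (simp add: y_E hq_def field_simps eval_nat_numeral)

section \<open>The grading by exponents modulo 5\<close>

definition graded :: "int \<Rightarrow> complex fls \<Rightarrow> bool" where
  "graded j f \<longleftrightarrow> (\<forall>n. fls_nth f n \<noteq> 0 \<longrightarrow> n mod 5 = j mod 5)"

lemma graded_mult:
  assumes "graded i f" "graded j g" "(i + j) mod 5 = k mod 5"
  shows "graded k (f * g)"
  unfolding graded_def
proof (intro allI impI)
  fix n assume "fls_nth (f * g) n \<noteq> 0"
  have "\<exists>l. fls_nth f l * fls_nth g (n - l) \<noteq> 0"
  proof (rule ccontr)
    assume "\<not> ?thesis"
    hence "fls_nth (f * g) n = 0"
      unfolding fls_times_nth(2) by (intro sum.neutral) blast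
    thus False using \<open>fls_nth (f * g) n \<noteq> 0\<close> by contradiction
  qed
  then obtain l where l: "fls_nth f l * fls_nth g (n - l) \<noteq> 0" ..
  hence "l mod 5 = i mod 5" "(n - l) mod 5 = j mod 5"
    using assms by (auto simp: graded_def)
  hence "(l + (n - l)) mod 5 = (i + j) mod 5" by (rule mod_add_cong)
  thus "n mod 5 = k mod 5" using assms(3) by simp
qed

lemma graded_add: "graded j f \<Longrightarrow> graded j g \<Longrightarrow> graded j (f + g)"
  unfolding graded_def by (metis add.right_neutral fls_plus_nth)

lemma graded_uminus: "graded j f \<Longrightarrow> graded j (- f)"
  unfolding graded_def by simp

lemma graded_diff: "graded j f \<Longrightarrow> graded j g \<Longrightarrow> graded j (f - g)"
  using graded_add[OF _ graded_uminus] by fastforce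

lemma graded_compose: "graded 0 (fls_compose_power f 5)"
  unfolding graded_def by (auto simp: fls_nth_compose_power)

lemma graded_numeral: "graded 0 (numeral n)" and graded_1: "graded 0 1"
  using graded_compose[of "numeral n"] graded_compose[of 1] by (simp_all add: compose_power_numeral)

lemma graded_compose_2: "graded j f \<Longrightarrow> (2 * j) mod 5 = k mod 5 \<Longrightarrow> graded k (fls_compose_power f 2)"
  unfolding graded_def
proof (intro allI impI)
  fix n assume *: "\<forall>n. fls_nth f n \<noteq> 0 \<longrightarrow> n mod 5 = j mod 5" "(2 * j) mod 5 = k mod 5"
    "fls_nth (fls_compose_power f 2) n \<noteq> 0"
  then obtain m where m: "n = 2 * m" "fls_nth f m \<noteq> 0"
    by (auto simp: fls_nth_compose_power split: if_splits)
  with * have "m mod 5 = j mod 5" by blast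
  thus "n mod 5 = k mod 5" using m(1) *(2) by (metis mod_mult_right_eq)
qed

lemma graded_sum_eq_0:
  assumes "graded 0 f0" "graded 1 f1" "graded 2 f2" "graded 3 f3" "graded 4 f4" "f0 + f1 + f2 + f3 + f4 = 0"
  shows "f0 = 0" "f1 = 0" "f2 = 0" "f3 = 0" "f4 = 0"
proof -
  have nth: "fls_nth f0 n + fls_nth f1 n + fls_nth f2 n + fls_nth f3 n + fls_nth f4 n = 0" for n
    using arg_cong[OF assms(6), of "\<lambda>f. fls_nth f n"] by simp
  have z: "fls_nth f0 n = 0 \<or> n mod 5 = 0" "fls_nth f1 n = 0 \<or> n mod 5 = 1" "fls_nth f2 n = 0 \<or> n mod 5 = 2"
    "fls_nth f3 n = 0 \<or> n mod 5 = 3" "fls_nth f4 n = 0 \<or> n mod 5 = 4" for n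
    using assms(1-5) by (auto simp: graded_def)
  have "fls_nth f0 n = 0 \<and> fls_nth f1 n = 0 \<and> fls_nth f2 n = 0 \<and> fls_nth f3 n = 0 \<and> fls_nth f4 n = 0" for n
    using nth[of n] z[of n] by auto
  thus "f0 = 0" "f1 = 0" "f2 = 0" "f3 = 0" "f4 = 0"
    by (auto intro: fls_eqI)
qed

lemma graded_fps: "(\<And>n. fps_nth f n \<noteq> 0 \<Longrightarrow> n mod 5 = nat j) \<Longrightarrow> 0 \<le> j \<Longrightarrow> j < 5 \<Longrightarrow> graded j (fps_to_fls f)"
  unfolding graded_def
proof (intro allI impI)
  fix n assume *: "\<And>n. fps_nth f n \<noteq> 0 \<Longrightarrow> n mod 5 = nat j" "0 \<le> j" "j < 5" "fls_nth (fps_to_fls f) n \<noteq> 0"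
  hence "n \<ge> 0" "nat n mod 5 = nat j" by (auto split: if_splits)
  hence "int (nat n mod 5) = j" using * by simp
  thus "n mod 5 = j mod 5" using \<open>n \<ge> 0\<close> * by (simp add: zmod_int)
qed

section \<open>The dissected eta quotients\<close>

definition qa :: "complex fls" where
  "qa = E 1 / (fls_X * E 25)"

definition qb :: "complex fls" where
  "qb = E 2 / (fls_X ^ 2 * E 50)"

text \<open>A series in q^5, later identified with 1 + 5 \<sigma> y.\<close>

definition qV :: "complex fls" where
  "qV = E 10 ^ 5 * E 25 / (E 5 ^ 5 * E 50)"

lemma qb_qa: "qb = fls_compose_power qa 2"
  unfolding qa_def qb_def by (simp add: compose_power_simps E_compose)

lemma hq_qV: "hq = qa / qb * qV"
  unfolding hq_def qa_def qb_def qV_def by (simp add: field_simps eval_nat_numeral)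

lemma qa_split:
  obtains u v where "qa = u - 1 - v" "graded 4 u" "graded 1 v"
proof -
  obtain g0 g2 where g: "theta 1 2 = g0 - fps_X * (theta 1 2 oo fps_X ^ 25) + g2"
    "\<And>n. fps_nth g0 n \<noteq> 0 \<Longrightarrow> n mod 5 = 0" "\<And>n. fps_nth g2 n \<noteq> 0 \<Longrightarrow> n mod 5 = 2"
    by (rule theta_1_2_split) blast
  define d where "d = inverse (fls_X * E 25)"
  have "d = fls_compose_power (inverse (fls_X * E 5)) 5 * fls_X ^ 4"
    by (simp add: d_def inverse_eq_divide compose_power_simps E_compose field_simps eval_nat_numeral)
  moreover have X4: "graded 4 (fls_X ^ 4)"
    unfolding graded_def by (simp add: fls_X_power_conv_shift_1)
  ultimately have d: "graded 4 d"
    by (simp only:) (rule graded_mult[OF graded_compose X4], simp)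
  have "E 1 = fps_to_fls g0 - fls_X * E 25 + fps_to_fls g2"
  proof -
    have "fps_to_fls (euler 1) = fps_to_fls (g0 - fps_X * (euler 1 oo fps_X ^ 25) + g2)"
      using g(1) unfolding theta_1_2 by simp
    thus ?thesis by (simp add: E_def fls_times_fps_to_fls euler_compose)
  qed
  moreover have "E 25 \<noteq> 0" "fls_X \<noteq> (0 :: complex fls)" by simp_all
  ultimately have "qa = fps_to_fls g0 * d - 1 - (- (fps_to_fls g2 * d))"
    unfolding qa_def d_def by (simp add: field_simps)
  moreover have "graded 4 (fps_to_fls g0 * d)"
    by (rule graded_mult[OF graded_fps[of _ 0] d]) (use g(2) in auto)
  moreover have "graded 1 (- (fps_to_fls g2 * d))"
    by (rule graded_uminus, rule graded_mult[OF graded_fps[of _ 2] d]) (use g(3) in auto)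
  ultimately show thesis by (rule that)
qed

text \<open>1 + x1 + x4 is the alternating theta series divided by itself at q^25. As an eta
  quotient this is qa^2 / qb, which links the dissections of qa and qb. The last clause holds
  because the products for 1 - 4 hq at q and at q^5 telescope.\<close>

lemma phi_split:
  obtains x1 x4 where "qa ^ 2 = qb * (1 + x1 + x4)" "graded 1 x1" "graded 4 x4"
    "x1 * x4 = - 4 * fls_compose_power hq 5"
    "(1 - 4 * hq) * (1 - 4 * fls_compose_power hq 5) = (1 + x1 + x4) ^ 2"
proof -
  define d where "d = fls_compose_power (E 10 / E 5 ^ 2) 5"
  have d: "d = E 50 / E 25 ^ 2" by (simp add: d_def compose_power_simps E_compose)
  define x1 where "x1 = - 2 * (fls_X * (d * fls_compose_power (theta_fls 3 7) 5))"
  define x4 where "x4 = 2 * (fls_X ^ 4 * (d * fls_compose_power (theta_fls 9 1) 5))"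
  have "theta_fls 1 1 = fls_compose_power (theta_fls 1 1) 25 - 2 * fls_X * fls_compose_power (theta_fls 3 7) 5
          + 2 * fls_X ^ 4 * fls_compose_power (theta_fls 9 1) 5"
  proof -
    have "theta_fls 1 1 = fps_to_fls ((theta 1 1 oo fps_X ^ 25) - 2 * fps_X * (theta 3 7 oo fps_X ^ 5) + 2 * fps_X ^ 4 * (theta 9 1 oo fps_X ^ 5))"
      unfolding theta_fls_def by (rule arg_cong[OF theta_1_1_split])
    also have "\<dots> = fls_compose_power (theta_fls 1 1) 25 - 2 * fls_X * fls_compose_power (theta_fls 3 7) 5
          + 2 * fls_X ^ 4 * fls_compose_power (theta_fls 9 1) 5"
      by (simp add: theta_fls_def fls_compose_power_fps_to_fls fls_times_fps_to_fls fps_to_fls_power)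
    finally show ?thesis .
  qed
  hence "E 1 ^ 2 / E 2 = E 25 ^ 2 / E 50 - 2 * fls_X * fls_compose_power (theta_fls 3 7) 5
          + 2 * fls_X ^ 4 * fls_compose_power (theta_fls 9 1) 5"
    by (simp only: theta_fls_1_1 compose_power_simps E_compose) (simp add: compose_power_simps E_compose)
  hence "E 1 ^ 2 / E 2 * d = (E 25 ^ 2 / E 50 - 2 * fls_X * fls_compose_power (theta_fls 3 7) 5
          + 2 * fls_X ^ 4 * fls_compose_power (theta_fls 9 1) 5) * d" by simp
  also have "\<dots> = E 25 ^ 2 / E 50 * d + x1 + x4"
    by (simp add: x1_def x4_def algebra_simps)
  also have "E 25 ^ 2 / E 50 * d = 1" by (simp add: d)
  finally have phi: "E 1 ^ 2 / E 2 * d = 1 + x1 + x4" .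
  show thesis
  proof (rule that)
    show "qa ^ 2 = qb * (1 + x1 + x4)"
      unfolding phi[symmetric] qa_def qb_def d by (simp add: field_simps eval_nat_numeral)
    have d0: "graded 0 (d * fls_compose_power f 5)" for f
      unfolding d_def by (rule graded_mult[OF graded_compose graded_compose]) simp
    have X: "graded 1 fls_X" "graded 4 (fls_X ^ 4)"
      unfolding graded_def by (simp_all add: fls_X_power_conv_shift_1)
    have "graded 1 (fls_X * (d * fls_compose_power (theta_fls 3 7) 5))"
      by (rule graded_mult[OF X(1) d0]) simp
    thus "graded 1 x1"
      unfolding x1_def by (rule graded_mult[OF graded_uminus[OF graded_numeral]]) simp
    have "graded 4 (fls_X ^ 4 * (d * fls_compose_power (theta_fls 9 1) 5))"
      by (rule graded_mult[OF X(2) d0]) simp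
    thus "graded 4 x4"
      unfolding x4_def by (rule graded_mult[OF graded_numeral]) simp
    have "fls_compose_power (theta_fls 9 1) 5 * fls_compose_power (theta_fls 3 7) 5 = E 50 ^ 3 * E 5 / (E 10 * E 25)"
      unfolding fls_compose_power_mult[symmetric] theta_fls_9_1 by (simp add: compose_power_simps E_compose)
    moreover have "x1 * x4 = - 4 * fls_X ^ 5 * d ^ 2 * (fls_compose_power (theta_fls 9 1) 5 * fls_compose_power (theta_fls 3 7) 5)"
      by (simp add: x1_def x4_def eval_nat_numeral)
    ultimately have "x1 * x4 = - 4 * fls_X ^ 5 * d ^ 2 * (E 50 ^ 3 * E 5 / (E 10 * E 25))" by simp
    also have "\<dots> = - 4 * fls_compose_power hq 5"
      unfolding hq_def d by (simp add: compose_power_simps E_compose field_simps eval_nat_numeral)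
    finally show "x1 * x4 = - 4 * fls_compose_power hq 5" .
    have "1 - 4 * fls_compose_power hq 5 = fls_compose_power (1 - 4 * hq) 5"
      by (simp add: compose_power_simps)
    also have "\<dots> = (E 5 ^ 2 * E 50 / (E 10 * E 25 ^ 2)) ^ 2"
      unfolding one_minus_4_hq by (simp add: compose_power_simps E_compose)
    finally have compose_power: "1 - 4 * fls_compose_power hq 5 = (E 5 ^ 2 * E 50 / (E 10 * E 25 ^ 2)) ^ 2" .
    show "(1 - 4 * hq) * (1 - 4 * fls_compose_power hq 5) = (1 + x1 + x4) ^ 2"
      unfolding compose_power one_minus_4_hq phi[symmetric] d power_mult_distrib[symmetric]
      by (rule arg_cong[where f = "\<lambda>x. x ^ 2"]) (simp add: field_simps)
  qed
qed

section \<open>The algebraic relation between the dissections\<close>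

abbreviation \<sigma> :: "complex fls \<Rightarrow> complex fls" where
  "\<sigma> f \<equiv> fls_compose_power f 5"

text \<open>
  Comparing the five graded components of \<open>qa^2 = qb (1 + x1 + x4)\<close> determines everything; in particular \<open>u v = 1\<close> comes from degree 0.
\<close>

lemma rogers_ramanujan_dissection:
  obtains r s where "r \<noteq> 0" "s \<noteq> 0" "graded 1 r" "graded 2 s"
    "qa = 1 / r - 1 - r" "qb = 1 / s - 1 - s"
    "s * (1 - r * s ^ 2) = r ^ 2 * (1 + r * s ^ 2)"
    "1 - r * s ^ 2 \<noteq> 0" "1 + r * s ^ 2 \<noteq> 0"
    "\<sigma> hq * (1 - (r * s ^ 2) ^ 2) = r * s ^ 2"
    "qV * (1 - 4 * \<sigma> hq) = 1 + \<sigma> hq"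
proof -
  obtain u v where uv: "qa = u - 1 - v" "graded 4 u" "graded 1 v" by (rule qa_split)
  obtain x1 x4 where x: "qa ^ 2 = qb * (1 + x1 + x4)" "graded 1 x1" "graded 4 x4"
    "x1 * x4 = - 4 * \<sigma> hq"
    "(1 - 4 * hq) * (1 - 4 * \<sigma> hq) = (1 + x1 + x4) ^ 2" by (rule phi_split)
  define u' v' where "u' = fls_compose_power u 2" and "v' = fls_compose_power v 2"
  have qb: "qb = u' - 1 - v'"
    unfolding qb_qa uv(1) u'_def v'_def by simp
  have u': "graded 3 u'" and v': "graded 2 v'"
    unfolding u'_def v'_def using uv(2,3) by (auto intro: graded_compose_2)
  note m = graded_mult[rotated 2]
  have c: "graded 0 (numeral n)" for n by (rule graded_numeral)
  have prods: "graded 0 (u * v)" "graded 1 (v' * x4)" "graded 2 (u' * x4)" "graded 3 (v' * x1)" "graded 4 (u' * x1)"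
    using m[OF _ uv(2,3), of 0] m[OF _ v' x(3), of 1] m[OF _ u' x(3), of 2] m[OF _ v' x(2), of 3] m[OF _ u' x(2), of 4]
    by simp_all
  have eqs: "2 - 2 * (u * v) = 0" "2 * v + x1 + v' * x4 = 0" "v ^ 2 + v' - u' * x4 = 0"
    "u ^ 2 - u' + v' * x1 = 0" "x4 - 2 * u - u' * x1 = 0"
  proof -
    have sum: "(2 - 2 * (u * v)) + (2 * v + x1 + v' * x4) + (v ^ 2 + v' - u' * x4)
        + (u ^ 2 - u' + v' * x1) + (x4 - 2 * u - u' * x1) = 0"
      using x(1) unfolding uv(1) qb by (simp add: algebra_simps power2_eq_square)
    have g0: "graded 0 (2 - 2 * (u * v))"
      by (rule graded_diff[OF c m[OF _ c prods(1)]]) simp_all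
    have g1: "graded 1 (2 * v + x1 + v' * x4)"
      by (intro graded_add m[OF _ c uv(3)] x(2) m[OF _ v' x(3)]) simp_all
    have g2: "graded 2 (v ^ 2 + v' - u' * x4)"
      unfolding power2_eq_square by (intro graded_diff graded_add m[OF _ uv(3) uv(3)] v' m[OF _ u' x(3)]) simp_all
    have g3: "graded 3 (u ^ 2 - u' + v' * x1)"
      unfolding power2_eq_square by (intro graded_diff graded_add m[OF _ uv(2) uv(2)] u' m[OF _ v' x(2)]) simp_all
    have g4: "graded 4 (x4 - 2 * u - u' * x1)"
      by (intro graded_diff x(3) m[OF _ c uv(2)] m[OF _ u' x(2)]) simp_all
    show "2 - 2 * (u * v) = 0" "2 * v + x1 + v' * x4 = 0" "v ^ 2 + v' - u' * x4 = 0"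
      "u ^ 2 - u' + v' * x1 = 0" "x4 - 2 * u - u' * x1 = 0"
      using graded_sum_eq_0[OF g0 g1 g2 g3 g4 sum] .
  qed
  have "u * v = 1" using eqs(1) by simp
  hence v0: "v \<noteq> 0" by auto
  with \<open>u * v = 1\<close> have u: "u = 1 / v" by (simp add: eq_divide_eq)
  have "u' * v' = 1"
    using arg_cong[OF \<open>u * v = 1\<close>, of "\<lambda>f. fls_compose_power f 2"] by (simp add: u'_def v'_def)
  hence v'0: "v' \<noteq> 0" by auto
  with \<open>u' * v' = 1\<close> have u'_eq: "u' = 1 / v'" by (simp add: eq_divide_eq)
  \<comment> \<open>With x4 = v' Q, the components of degree 1 and 4 become two linear equations in
    v x1 and K Q. Their sum gives v x1 = - Q, and each of them then expresses v^2 or v' through Q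
    and K.\<close>
  define K Q where "K = v * v' ^ 2" and "Q = v ^ 2 + v'"
  have x4_eq: "x4 = v' * Q"
    using eqs(3) v'0 unfolding u'_eq Q_def by (simp add: field_simps)
  have "2 * v ^ 2 + v * x1 + K * Q = 0"
    using arg_cong[OF eqs(2), of "\<lambda>t. v * t"] unfolding x4_eq K_def by (simp add: algebra_simps power2_eq_square)
  moreover have "2 * v' + v * x1 - K * Q = 0"
    using arg_cong[OF eqs(5), of "\<lambda>t. - v * v' * t"] v0 v'0 unfolding x4_eq K_def u u'_eq
    by (simp add: algebra_simps power2_eq_square)
  ultimately have x1: "v * x1 = - Q" and vQ: "2 * v ^ 2 = Q * (1 - K)" "2 * v' = Q * (1 + K)"
  proof -
    assume *: "2 * v ^ 2 + v * x1 + K * Q = 0" "2 * v' + v * x1 - K * Q = 0"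
    have "2 * (v * x1 + Q) = 0" using * unfolding Q_def by algebra
    hence "v * x1 + Q = 0" by (metis mult_eq_0_iff zero_neq_numeral)
    thus "v * x1 = - Q" by (simp add: eq_neg_iff_add_eq_0)
    thus "2 * v ^ 2 = Q * (1 - K)" "2 * v' = Q * (1 + K)" using * by (algebra, algebra)
  qed
  have K: "1 - K \<noteq> 0" "1 + K \<noteq> 0" and Q0: "Q \<noteq> 0" using v0 v'0 vQ by auto
  have H: "4 * v * \<sigma> hq = v' * Q ^ 2"
    using x(4) x1 unfolding x4_eq by algebra
  have HK: "\<sigma> hq * (1 - K ^ 2) = K"
  proof -
    have "4 * v * (\<sigma> hq * (1 - K ^ 2)) = v' * (Q * (1 - K)) * (Q * (1 + K))"
      using H by algebra
    also have "\<dots> = v' * (2 * v ^ 2) * (2 * v')" by (simp only: vQ)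
    also have "\<dots> = 4 * v * K" unfolding K_def by algebra
    finally show ?thesis using v0 by simp
  qed
  \<comment> \<open>After hq = (qa / qb) qV is inserted, the last identity of
    \<open>phi_split\<close> becomes linear in W with coefficient qa. As W is a series in q^5 and
    the degree 0 part of qa is -1, the degree 0 component alone determines W.\<close>
  define W where "W = 4 * (qV * (1 - 4 * \<sigma> hq))"
  have W0: "graded 0 W"
  proof -
    have "qV = \<sigma> (E 2 ^ 5 * E 5 / (E 1 ^ 5 * E 10))"
      by (simp add: qV_def compose_power_simps E_compose)
    then obtain w where "qV = \<sigma> w" by blast
    hence "W = \<sigma> (4 * (w * (1 - 4 * hq)))"
      unfolding W_def by (simp add: compose_power_numeral)
    thus ?thesis by (simp only: graded_compose)
  qed
  have H0: "graded 0 (4 * \<sigma> hq)" by (rule m[OF _ c graded_compose]) simp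
  have "W + v' * x4 ^ 2 - u' * x1 ^ 2 - 4 * \<sigma> hq = 0"
  proof -
    have "qb \<noteq> 0" unfolding qb_def by simp
    have "4 * qa * (qV * (1 - 4 * \<sigma> hq)) = qb * (4 * hq * (1 - 4 * \<sigma> hq))"
      using \<open>qb \<noteq> 0\<close> unfolding hq_qV by simp
    also have "4 * hq * (1 - 4 * \<sigma> hq) = 1 - 4 * \<sigma> hq - (1 + x1 + x4) ^ 2"
      using x(5) by algebra
    finally have *: "W * qa = qb * (1 - 4 * \<sigma> hq - (1 + x1 + x4) ^ 2)"
      by (simp add: W_def mult_ac)
    have sum: "(W + v' * x4 ^ 2 - u' * x1 ^ 2 - 4 * \<sigma> hq) + (W * v + 2 * x1 + 2 * (v' * x4) - u' * x4 ^ 2)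
        + (x1 ^ 2 - 4 * \<sigma> hq * v' - 2 * (u' * x4)) + (4 * \<sigma> hq * u' + 2 * (v' * x1) + x4 ^ 2)
        + (2 * x4 + v' * x1 ^ 2 - 2 * (u' * x1) - W * u) = 0"
      using * x(4) unfolding uv(1) qb by algebra
    have p: "graded 2 (x1 ^ 2)" "graded 3 (x4 ^ 2)"
      unfolding power2_eq_square by (rule m[OF _ x(2) x(2)], simp, rule m[OF _ x(3) x(3)], simp)
    have g0: "graded 0 (W + v' * x4 ^ 2 - u' * x1 ^ 2 - 4 * \<sigma> hq)"
      by (intro graded_diff graded_add W0 H0 m[OF _ v' p(2)] m[OF _ u' p(1)]) simp_all
    have g1: "graded 1 (W * v + 2 * x1 + 2 * (v' * x4) - u' * x4 ^ 2)"
      by (intro graded_diff graded_add m[OF _ W0 uv(3)] m[OF _ c x(2)] m[OF _ c prods(2)] m[OF _ u' p(2)]) simp_all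
    have g2: "graded 2 (x1 ^ 2 - 4 * \<sigma> hq * v' - 2 * (u' * x4))"
      by (intro graded_diff p(1) m[OF _ H0 v'] m[OF _ c prods(3)]) simp_all
    have g3: "graded 3 (4 * \<sigma> hq * u' + 2 * (v' * x1) + x4 ^ 2)"
      by (intro graded_add p(2) m[OF _ H0 u'] m[OF _ c prods(4)]) simp_all
    have g4: "graded 4 (2 * x4 + v' * x1 ^ 2 - 2 * (u' * x1) - W * u)"
      by (intro graded_diff graded_add m[OF _ c x(3)] m[OF _ v' p(1)] m[OF _ c prods(5)] m[OF _ W0 uv(2)]) simp_all
    show ?thesis using graded_sum_eq_0(1)[OF g0 g1 g2 g3 g4 sum] .
  qed
  moreover have "u' * x1 ^ 2 - v' * x4 ^ 2 = 4"
  proof -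
    have "v ^ 2 * v' * (u' * x1 ^ 2 - v' * x4 ^ 2) = Q ^ 2 * (1 - K ^ 2)"
      using x1 \<open>u' * v' = 1\<close> unfolding x4_eq K_def by algebra
    also have "\<dots> = (Q * (1 - K)) * (Q * (1 + K))" by algebra
    also have "\<dots> = (2 * v ^ 2) * (2 * v')" by (simp only: vQ)
    also have "\<dots> = v ^ 2 * v' * 4" by simp
    finally show ?thesis using v0 v'0 by simp
  qed
  ultimately have "W = 4 * (1 + \<sigma> hq)" by algebra
  hence V: "qV * (1 - 4 * \<sigma> hq) = 1 + \<sigma> hq"
    unfolding W_def by (metis mult_cancel_left zero_neq_numeral)
  have "Q * (v' * (1 - K)) = Q * (v ^ 2 * (1 + K))"
    using vQ by algebra
  hence "v' * (1 - K) = v ^ 2 * (1 + K)" using Q0 by simp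
  with K HK V show thesis
    using that[OF v0 v'0 uv(3) v'] uv(1) qb unfolding u u'_eq K_def by blast
qed

section \<open>The derivation q d/dq\<close>

definition qderiv :: "complex fls \<Rightarrow> complex fls" where
  "qderiv f = fls_X * fls_deriv f"

lemma qderiv_add: "qderiv (f + g) = qderiv f + qderiv g" and qderiv_diff: "qderiv (f - g) = qderiv f - qderiv g"
  and qderiv_mult: "qderiv (f * g) = qderiv f * g + f * qderiv g"
  by (simp_all add: qderiv_def algebra_simps)

lemma qderiv_1 [simp]: "qderiv 1 = 0" and qderiv_numeral [simp]: "qderiv (numeral n) = 0"
  by (simp_all add: qderiv_def)

lemma qderiv_power: "qderiv (f ^ n) = of_nat n * f ^ (n - 1) * qderiv f"
  by (simp add: qderiv_def fls_deriv_power mult_ac)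

lemma qderiv_divide:
  assumes "g \<noteq> 0"
  shows "qderiv (f / g) = (qderiv f * g - f * qderiv g) / g ^ 2"
proof -
  have "qderiv f = qderiv (f / g * g)" using assms by simp
  also have "\<dots> = qderiv (f / g) * g + f / g * qderiv g" by (rule qderiv_mult)
  finally show ?thesis using assms by (simp add: field_simps power2_eq_square)
qed

lemma qderiv_nth: "fls_nth (qderiv f) n = of_int n * fls_nth f n"
  by (simp add: qderiv_def fls_X_times_conv_shift)

lemma qderiv_compose: "d > 0 \<Longrightarrow> qderiv (fls_compose_power f d) = of_nat d * fls_compose_power (qderiv f) d"
proof (rule fls_eqI)
  fix n assume "d > 0"
  thus "fls_nth (qderiv (fls_compose_power f d)) n = fls_nth (of_nat d * fls_compose_power (qderiv f) d) n"
    by (auto simp: qderiv_nth fls_nth_compose_power)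
qed

section \<open>\<open>F\<close> as a logarithmic derivative\<close>

definition lambert :: "complex fps" where
  "lambert = (\<Sum>n. of_nat (Suc n) * fps_X ^ Suc n / (1 - fps_X ^ Suc n))"

lemma lambert_cong_X:
  "cong_X n lambert (\<Sum>k<n. of_nat (Suc k) * fps_X ^ Suc k / (1 - fps_X ^ Suc k))"
proof (unfold cong_X_iff, intro allI impI)
  fix i assume "i < n"
  let ?f = "\<lambda>k. of_nat (Suc k) * fps_X ^ Suc k / (1 - fps_X ^ Suc k) :: complex fps"
  have "lambert = Abs_fps (\<lambda>n. \<Sum>k<n. fps_nth (?f k) n)"
    unfolding lambert_def using sums_unique[OF fps_sums[OF Lambert_nth_eq_0], symmetric] .
  from arg_cong[OF this, of "\<lambda>f. fps_nth f i"] have "fps_nth lambert i = (\<Sum>k<i. fps_nth (?f k) i)"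
    by (simp only: fps_nth_Abs_fps)
  also have "\<dots> = (\<Sum>k<n. fps_nth (?f k) i)"
    using \<open>i < n\<close> Lambert_nth_eq_0[of i] by (intro sum.mono_neutral_left) auto
  finally show "fps_nth lambert i = fps_nth (sum ?f {..<n}) i"
    by (simp only: fps_sum_nth)
qed

lemma cong_X_deriv:
  assumes "cong_X n f g"
  shows "cong_X n (fps_X * fps_deriv f) (fps_X * fps_deriv g)"
proof -
  have nth: "fps_nth (fps_X * fps_deriv f) i = of_nat i * fps_nth f i" for i and f :: "complex fps"
    by (cases i) simp_all
  show ?thesis using assms unfolding cong_X_iff nth by simp
qed

text \<open>Each factor 1 - X^k contributes - k X^k / (1 - X^k) to the logarithmic derivative. The
  product with \<open>euler 1\<close> is kept on the right so that truncations can be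
  compared.\<close>

lemma euler_1_deriv: "fps_X * fps_deriv (euler 1) = - euler 1 * lambert"
proof (rule fps_eqI_cong_X)
  fix n
  let ?f = "\<lambda>k. of_nat (Suc k) * fps_X ^ Suc k / (1 - fps_X ^ Suc k) :: complex fps"
  have "fps_X * fps_deriv (euler_fin 1 n) = - euler_fin 1 n * sum ?f {..<n}"
  proof (induction n)
    case (Suc n)
    define d where "d = (1 - fps_X ^ Suc n :: complex fps)"
    have 1: "fps_X * fps_deriv (1 - fps_X ^ Suc n) = - (of_nat (Suc n) * fps_X ^ Suc n :: complex fps)"
      by (simp only: fps_deriv_sub fps_deriv_1 fps_deriv_power' fps_deriv_fps_X diff_Suc_1) (simp add: mult_ac)
    have 2: "?f n * d = of_nat (Suc n) * fps_X ^ Suc n"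
      unfolding d_def by (rule fps_divide_mult_cancel) simp
    have "fps_X * fps_deriv (euler_fin 1 (Suc n)) = fps_X * fps_deriv (euler_fin 1 n * d)"
      by (simp add: euler_fin_Suc d_def)
    also have "\<dots> = fps_X * fps_deriv (euler_fin 1 n) * d + euler_fin 1 n * (fps_X * fps_deriv d)"
      by (simp add: algebra_simps)
    also have "fps_X * fps_deriv d = - (?f n * d)"
      unfolding d_def 1 using 2 unfolding d_def by simp
    also have "fps_X * fps_deriv (euler_fin 1 n) * d + euler_fin 1 n * - (?f n * d) = - (euler_fin 1 n * d) * (sum ?f {..<n} + ?f n)"
      unfolding Suc.IH by algebra
    also have "euler_fin 1 n * d = euler_fin 1 (Suc n)" by (simp add: euler_fin_Suc d_def)
    finally show ?case by (simp only: sum.lessThan_Suc)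
  qed (simp add: euler_fin_def)
  moreover have "cong_X n (fps_X * fps_deriv (euler 1)) (fps_X * fps_deriv (euler_fin 1 n))"
    by (intro cong_X_deriv cong_X_sym[OF euler_fin_cong_X]) auto
  moreover have "cong_X n (- euler_fin 1 n * sum ?f {..<n}) (- euler 1 * lambert)"
  proof -
    have "cong_X n (euler_fin 1 n * sum ?f {..<n}) (euler 1 * lambert)"
      by (intro cong_X_mult euler_fin_cong_X cong_X_sym[OF lambert_cong_X]) auto
    from cong_X_mult[OF cong_X_refl[of n "- 1"] this] show ?thesis by simp
  qed
  ultimately show "cong_X n (fps_X * fps_deriv (euler 1)) (- euler 1 * lambert)"
    using cong_X_trans by simp
qed

definition log_deriv :: "complex fls \<Rightarrow> complex fls" where
  "log_deriv f = qderiv f / f"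

lemma qderiv_dl: "f \<noteq> 0 \<Longrightarrow> qderiv f = f * log_deriv f"
  by (simp add: log_deriv_def)

lemma log_deriv_mult: "f \<noteq> 0 \<Longrightarrow> g \<noteq> 0 \<Longrightarrow> log_deriv (f * g) = log_deriv f + log_deriv g"
  by (simp add: log_deriv_def qderiv_mult field_simps)

lemma log_deriv_divide:
  assumes "f \<noteq> 0" "g \<noteq> 0"
  shows "log_deriv (f / g) = log_deriv f - log_deriv g"
  using log_deriv_mult[of "f / g" g] assms by simp

lemma log_deriv_power: "f \<noteq> 0 \<Longrightarrow> log_deriv (f ^ n) = of_nat n * log_deriv f"
proof (induction n)
  case (Suc n)
  thus ?case using log_deriv_mult[of f "f ^ n"] by (simp add: algebra_simps)
qed (simp add: log_deriv_def)

lemma log_deriv_E: "k > 0 \<Longrightarrow> log_deriv (E k) = - of_nat k * fps_to_fls (lambert oo fps_X ^ k)"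
proof -
  assume k: "k > 0"
  have "qderiv (E 1) = fps_to_fls (fps_X * fps_deriv (euler 1))"
    by (simp add: qderiv_def E_def fls_deriv_fps_to_fls fls_times_fps_to_fls)
  also have "\<dots> = - E 1 * fps_to_fls lambert"
    unfolding euler_1_deriv E_def by (simp add: fls_times_fps_to_fls)
  finally have T1: "qderiv (E 1) = - E 1 * fps_to_fls lambert" .
  have "qderiv (E k) = qderiv (fls_compose_power (E 1) k)"
    using k by (simp add: E_compose)
  also have "\<dots> = - of_nat k * E k * fps_to_fls (lambert oo fps_X ^ k)"
    unfolding qderiv_compose[OF k] T1 using k by (simp add: E_compose fls_compose_power_fps_to_fls)
  finally show ?thesis using k by (simp add: log_deriv_def)
qed

text \<open>The coefficients 50, -25, -2 and 1 in \<open>F\<close> are k times the exponent of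
  \<open>E k\<close> in hq. Their sum is 24, and the resulting constant term 1 is the contribution
  of the factor q.\<close>

lemma F_dl: "F = log_deriv hq"
proof -
  let ?l = "\<lambda>k. fps_to_fls (lambert oo fps_X ^ k)"
  have lambert: "lambert = lambert oo fps_X ^ 1" by simp
  have comp: "(1 - 24 * lambert) oo fps_X ^ k = 1 - 24 * (lambert oo fps_X ^ k)" if "k > 0" for k
    using that by (simp add: fps_compose_sub_distrib fps_compose_mult_distrib)
  have const: "fps_to_fls (numeral n) = numeral n" for n by simp
  have "F = 1 / 24 * fps_to_fls (50 * (1 - 24 * (lambert oo fps_X ^ 10)) - 25 * (1 - 24 * (lambert oo fps_X ^ 5))
      - 2 * (1 - 24 * (lambert oo fps_X ^ 2)) + (1 - 24 * (lambert oo fps_X ^ 1)))"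
    unfolding F_def E2_def lambert_def[symmetric] using comp[of 10] comp[of 5] comp[of 2] by simp
  also have "\<dots> = 1 - 50 * ?l 10 + 25 * ?l 5 + 2 * ?l 2 - ?l 1"
    by (simp add: fls_times_fps_to_fls field_simps)
  also have "\<dots> = log_deriv hq"
  proof -
    have "log_deriv hq = log_deriv fls_X + 5 * log_deriv (E 10) + log_deriv (E 1) - (log_deriv (E 2) + 5 * log_deriv (E 5))"
      unfolding hq_def by (simp add: log_deriv_mult log_deriv_divide log_deriv_power)
    moreover have "log_deriv fls_X = 1" by (simp add: log_deriv_def qderiv_def)
    ultimately show ?thesis by (simp add: log_deriv_E)
  qed
  finally show ?thesis .
qed

section \<open>Projection to exponents divisible by 5\<close>

definition grade0_free :: "complex fls \<Rightarrow> bool" where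
  "grade0_free f \<longleftrightarrow> (\<forall>n. n mod 5 = 0 \<longrightarrow> fls_nth f n = 0)"

text \<open>Unlike \<open>U5\<close> this keeps the variable, so it is linear over the series in q^5
  and can be computed inside one field.\<close>

definition grade0 :: "complex fls \<Rightarrow> complex fls" where
  "grade0 f = \<sigma> (U5 f)"

lemma grade0_nth: "fls_nth (grade0 f) n = (if n mod 5 = 0 then fls_nth f n else 0)"
  by (auto simp: grade0_def fls_nth_compose_power fls_nth_U5)

lemma grade0_add: "grade0 (f + g) = grade0 f + grade0 g"
  by (rule fls_eqI) (simp add: grade0_nth)

lemma grade0_gr0: "graded 0 f \<Longrightarrow> grade0 f = f"
  by (rule fls_eqI) (auto simp: grade0_nth graded_def)

lemma grade0_ngr: "grade0_free f \<Longrightarrow> grade0 f = 0"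
  by (rule fls_eqI) (auto simp: grade0_nth grade0_free_def)

lemma graded_imp_ngr: "graded j f \<Longrightarrow> j mod 5 \<noteq> 0 \<Longrightarrow> grade0_free f"
  by (auto simp: graded_def grade0_free_def)

lemma graded_0_ngr_mult:
  assumes "graded 0 f" "grade0_free g"
  shows "grade0_free (f * g)"
  unfolding grade0_free_def
proof (intro allI impI)
  fix n :: int assume n: "n mod 5 = 0"
  have "fls_nth f l * fls_nth g (n - l) = 0" for l
  proof (cases "l mod 5 = 0")
    case True
    hence "(n - l) mod 5 = 0" using n by presburger
    thus ?thesis using assms(2) by (simp add: grade0_free_def)
  next
    case False
    hence "fls_nth f l = 0" using assms(1) by (auto simp: graded_def)
    thus ?thesis by simp
  qed
  thus "fls_nth (f * g) n = 0"
    unfolding fls_times_nth(2) by (intro sum.neutral) blast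
qed

lemma grade0_mult:
  assumes "graded 0 c"
  shows "grade0 (c * f) = c * grade0 f"
proof -
  have "grade0_free (f - grade0 f)" by (simp add: grade0_free_def grade0_nth)
  from graded_0_ngr_mult[OF assms this] have "grade0 (c * (f - grade0 f)) = 0" by (rule grade0_ngr)
  moreover have "grade0 (c * grade0 f) = c * grade0 f"
    unfolding grade0_def[of f] by (intro grade0_gr0 graded_mult[OF assms graded_compose]) simp
  moreover have "c * f = c * (f - grade0 f) + c * grade0 f" by (simp add: algebra_simps)
  ultimately show ?thesis using grade0_add[of "c * (f - grade0 f)" "c * grade0 f"] by simp
qed

lemma sigma_L: "\<sigma> (U0 g) = grade0 (F * Z * g) / \<sigma> F"
  by (simp add: U0_def grade0_def compose_power_divide)

lemma U0_add: "U0 (f + g) = U0 f + U0 g"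
  by (rule compose_power_inj[of 5]) (simp_all add: sigma_L distrib_left grade0_add add_divide_distrib)

text \<open>Coefficients in \<sigma> y leave the operator as coefficients in y; all recurrences rest
  on this.\<close>

lemma U0_mult: "U0 (\<sigma> c * g) = c * U0 g"
proof (rule compose_power_inj[of 5])
  have "grade0 (F * Z * (\<sigma> c * g)) = \<sigma> c * grade0 (F * Z * g)"
    using grade0_mult[OF graded_compose, of c "F * Z * g"] by (simp add: mult_ac)
  thus "\<sigma> (U0 (\<sigma> c * g)) = \<sigma> (c * U0 g)"
    by (simp add: sigma_L)
qed simp

lemma U0_0 [simp]: "U0 0 = 0"
  using U0_add[of 0 0] by simp

lemma U0_sum: "U0 (\<Sum>i\<in>A. f i) = (\<Sum>i\<in>A. U0 (f i))"
  by (induction A rule: infinite_finite_induct) (simp_all add: U0_add)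

section \<open>Computing the part of degree 0\<close>

lemma graded_0_iff: "graded 0 f \<longleftrightarrow> (\<exists>g. f = \<sigma> g)"
  using grade0_gr0[of f] graded_compose unfolding grade0_def by metis

lemma graded_0_divide: "graded 0 f \<Longrightarrow> graded 0 g \<Longrightarrow> graded 0 (f / g)"
  unfolding graded_0_iff by (metis compose_power_divide zero_less_numeral)

lemma graded_0_mult: "graded 0 f \<Longrightarrow> graded 0 g \<Longrightarrow> graded 0 (f * g)"
  using graded_mult[of 0 f 0 g 0] by simp

lemma graded_0_power: "graded 0 f \<Longrightarrow> graded 0 (f ^ n)"
  by (induction n) (auto intro: graded_0_mult graded_1)

lemma graded_0: "graded 0 0"
  by (simp add: graded_def)

lemmas graded_0_intros = graded_0 graded_1 graded_numeral graded_add graded_diff graded_uminus graded_0_mult graded_0_divide graded_0_power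

text \<open>Coordinates with respect to 1, r, ..., r^4 over the series in q^5. When r has degree 1,
  \<open>c0\<close> is the part of degree 0.\<close>

definition rep :: "complex fls \<Rightarrow> complex fls \<Rightarrow> complex fls \<Rightarrow> complex fls \<Rightarrow> complex fls \<Rightarrow>
    complex fls \<Rightarrow> complex fls \<Rightarrow> bool" where
  "rep r f c0 c1 c2 c3 c4 \<longleftrightarrow> graded 0 c0 \<and> graded 0 c1 \<and> graded 0 c2 \<and> graded 0 c3 \<and> graded 0 c4 \<and>
     f = c0 + c1 * r + c2 * r ^ 2 + c3 * r ^ 3 + c4 * r ^ 4"

locale dissection =
  fixes r s :: "complex fls"
  assumes nz: "r \<noteq> 0" "s \<noteq> 0" and graded_r: "graded 1 r" and graded_s: "graded 2 s"
    and qa_r: "qa = 1 / r - 1 - r" and qb_s: "qb = 1 / s - 1 - s"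
    and s_r: "s * (1 - r * s ^ 2) = r ^ 2 * (1 + r * s ^ 2)"
    and nz': "1 - r * s ^ 2 \<noteq> 0" "1 + r * s ^ 2 \<noteq> 0"
    and H_K: "\<sigma> hq * (1 - (r * s ^ 2) ^ 2) = r * s ^ 2"
    and qV_H: "qV * (1 - 4 * \<sigma> hq) = 1 + \<sigma> hq"
begin

definition K where "K = r * s ^ 2"
text \<open>\<open>m\<close> is s / r^2. Both \<open>m\<close> and \<open>p\<close> are series in
  q^5, and the coordinates below are Laurent polynomials in them.\<close>

definition m where "m = (1 + K) / (1 - K)"
definition p where "p = r ^ 5"

lemma K_nz [simp]: "K \<noteq> 0" "1 - K \<noteq> 0" "1 + K \<noteq> 0"
proof -
  show "K \<noteq> 0" using nz by (simp add: K_def)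
  show "1 - K \<noteq> 0" "1 + K \<noteq> 0" unfolding K_def by (rule nz')+
qed

lemma K_neq_1 [simp]: "K \<noteq> 1" "1 \<noteq> K"
  using K_nz(2) by auto

lemma mp_nz [simp]: "m \<noteq> 0" "p \<noteq> 0"
  using nz by (auto simp: m_def p_def)

lemma s_eq: "s = m * r ^ 2"
  using s_r K_nz unfolding m_def K_def[symmetric] by (simp add: field_simps)

lemma K_mp: "K = m ^ 2 * p"
proof -
  have "K = r * (m * r ^ 2) ^ 2" using K_def s_eq by simp
  thus ?thesis unfolding p_def by algebra
qed

text \<open>Names for 1 - K and 1 + K as atoms: denominators are cleared in monomials in
  \<open>K\<close>, \<open>d\<close> and \<open>e\<close>, and only the result is expanded.\<close>

definition d where "d = 1 - K"
definition e where "e = 1 + K"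

lemma de_nz [simp]: "d \<noteq> 0" "e \<noteq> 0"
  by (simp_all add: d_def e_def)

lemma m_de: "m = e / d"
  by (simp add: m_def d_def e_def)

lemma p_K: "p = K / m ^ 2"
  unfolding K_mp by simp

lemma graded_r_powers: "graded 2 (r ^ 2)" "graded 3 (r ^ 3)" "graded 4 (r ^ 4)" "graded 0 p"
proof -
  show 2: "graded 2 (r ^ 2)" unfolding power2_eq_square by (rule graded_mult[OF graded_r graded_r]) simp
  show 3: "graded 3 (r ^ 3)" using graded_mult[OF graded_r 2, of 3] by (simp add: eval_nat_numeral)
  show 4: "graded 4 (r ^ 4)" using graded_mult[OF graded_r 3, of 4] by (simp add: eval_nat_numeral)
  show "graded 0 p" using graded_mult[OF graded_r 4, of 0] unfolding p_def by (simp add: eval_nat_numeral)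
qed

lemma graded_0_K: "graded 0 K"
proof -
  have "graded 4 (s ^ 2)" unfolding power2_eq_square by (rule graded_mult[OF graded_s graded_s]) simp
  from graded_mult[OF graded_r this, of 0] show ?thesis by (simp add: K_def)
qed

lemma graded_0_m: "graded 0 m"
  unfolding m_def by (intro graded_0_intros graded_0_K)

text \<open>Multiplication of coordinates modulo r^5 = p. The new coordinates enter as hypotheses so
  that each application can state them in simplified form.\<close>

lemma rep_mult:
  assumes f: "rep r f a0 a1 a2 a3 a4" and g: "rep r g b0 b1 b2 b3 b4"
    and "c0 = a0 * b0 + p * (a1 * b4 + a2 * b3 + a3 * b2 + a4 * b1)"
    and "c1 = a0 * b1 + a1 * b0 + p * (a2 * b4 + a3 * b3 + a4 * b2)"
    and "c2 = a0 * b2 + a1 * b1 + a2 * b0 + p * (a3 * b4 + a4 * b3)"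
    and "c3 = a0 * b3 + a1 * b2 + a2 * b1 + a3 * b0 + p * (a4 * b4)"
    and "c4 = a0 * b4 + a1 * b3 + a2 * b2 + a3 * b1 + a4 * b0"
  shows "rep r (f * g) c0 c1 c2 c3 c4"
proof -
  have "f * g = c0 + c1 * r + c2 * r ^ 2 + c3 * r ^ 3 + c4 * r ^ 4"
    using f g unfolding rep_def assms(3-7) p_def by algebra
  moreover have "graded 0 c0" "graded 0 c1" "graded 0 c2" "graded 0 c3" "graded 0 c4"
    unfolding assms(3-7) using f g graded_r_powers(4)
    by (auto simp: rep_def intro!: graded_add graded_0_mult)
  ultimately show ?thesis by (simp add: rep_def)
qed

lemma grade0_rep:
  assumes "rep r f c0 c1 c2 c3 c4"
  shows "grade0 f = c0"
proof -
  have f: "f = c0 + c1 * r + c2 * r ^ 2 + c3 * r ^ 3 + c4 * r ^ 4"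
    and c: "graded 0 c0" "graded 0 c1" "graded 0 c2" "graded 0 c3" "graded 0 c4" using assms by (auto simp: rep_def)
  have "grade0 r = 0" "grade0 (r ^ 2) = 0" "grade0 (r ^ 3) = 0" "grade0 (r ^ 4) = 0"
    using graded_r graded_r_powers by (auto intro!: grade0_ngr graded_imp_ngr)
  thus ?thesis unfolding f using c by (simp add: grade0_add grade0_mult grade0_gr0)
qed

lemma grade0_rep_mult:
  assumes "rep r f a0 a1 a2 a3 a4" "rep r g b0 b1 b2 b3 b4"
  shows "grade0 (f * g) = a0 * b0 + p * (a1 * b4 + a2 * b3 + a3 * b2 + a4 * b1)"
  by (rule grade0_rep[OF rep_mult[OF assms refl refl refl refl refl]])

lemma inverse_r: "1 / r = 1 / p * r ^ 4"
  using nz unfolding p_def by (simp add: field_simps eval_nat_numeral)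

lemma inverse_s: "1 / s = 1 / (m * p) * r ^ 3"
proof -
  have "s * r ^ 3 = m * p" using s_eq unfolding p_def by algebra
  thus ?thesis using nz by (simp add: field_simps)
qed

lemma rep_qa: "rep r qa (- 1) (- 1) 0 0 (1 / p)"
  unfolding rep_def qa_r inverse_r by (auto intro!: graded_0_intros graded_r_powers)

lemma rep_qb: "rep r qb (- 1) 0 (- m) (1 / (m * p)) 0"
proof -
  have "qb = - 1 + 0 * r + - m * r ^ 2 + 1 / (m * p) * r ^ 3 + 0 * r ^ 4"
    using qb_s inverse_s s_eq by algebra
  thus ?thesis unfolding rep_def by (auto intro!: graded_0_intros graded_r_powers graded_0_m)
qed

lemma rep_rp: "rep r (r + 1 / r) 0 1 0 0 (1 / p)"
  unfolding rep_def inverse_r by (auto intro!: graded_0_intros graded_r_powers)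

lemma rep_sp: "rep r (s + 1 / s) 0 0 m (1 / (m * p)) 0"
proof -
  have "s + 1 / s = 0 + 0 * r + m * r ^ 2 + 1 / (m * p) * r ^ 3 + 0 * r ^ 4"
    using inverse_s s_eq by algebra
  thus ?thesis unfolding rep_def by (auto intro!: graded_0_intros graded_r_powers graded_0_m)
qed

lemma rep_N1: "rep r ((s + 1 / s) * qa) 0 (m) (1 / (m * p) - m) (- (1 / (m * p)) - m) (- (1 / (m * p)))"
  by (rule rep_mult[OF rep_sp rep_qa]) (simp_all add: field_simps eval_nat_numeral)

lemma rep_N2: "rep r ((r + 1 / r) * qb) 0 (- 1 - m) (1 / (m * p)) (- m) (1 / (m * p) - 1 / p)"
  by (rule rep_mult[OF rep_rp rep_qb]) (simp_all add: field_simps eval_nat_numeral)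

lemma rep_a2: "rep r (qa * qa) (- 1) (2) (1) (1 / p) (- (2 / p))"
  by (rule rep_mult[OF rep_qa rep_qa]) (simp_all add: field_simps eval_nat_numeral)

lemma rep_b2: "rep r (qb * qb) (- 1) (1 / (m ^ 2 * p)) (2 * m) (- (2 / (m * p))) (m ^ 2)"
  by (rule rep_mult[OF rep_qb rep_qb]) (simp_all add: field_simps eval_nat_numeral)

lemma rep_a3: "rep r (qa * (qa * qa)) (5) 0 (1 / p - 3) (- (3 / p) - 1) 0"
  by (rule rep_mult[OF rep_qa rep_a2]) (simp_all add: field_simps eval_nat_numeral)

lemma rep_b3: "rep r (qb * (qb * qb)) (5) (- (3 / (m ^ 2 * p)) - m ^ 3 * p) 0 0 (1 / (m ^ 3 * p ^ 2) - 3 * m ^ 2)"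
  by (rule rep_mult[OF rep_qb rep_b2]) (simp_all add: field_simps eval_nat_numeral)

lemma rep_a2b: "rep r (qa * qa * qb) (1 / m + 1 - m) (1 / (m * p) - 2 + 2 * m) (- (2 / (m * p)) - 1 + m) (- (1 / (m * p)) - 1 / p - 2 * m) (2 / (m * p) + 2 / p - m)"
  by (rule rep_mult[OF rep_a2 rep_qb]) (simp_all add: field_simps eval_nat_numeral)

lemma rep_ab2: "rep r (qa * (qb * qb)) (1 / (m ^ 2 * p) + 1 - m ^ 2 * p) (- (1 / (m ^ 2 * p)) + 1 + 2 * m) (- (1 / (m ^ 2 * p)) - 2 / (m * p) - 2 * m) (2 / (m * p) - 2 * m + m ^ 2) (2 / (m * p) - 1 / p - m ^ 2)"
  by (rule rep_mult[OF rep_qa rep_b2]) (simp_all add: field_simps eval_nat_numeral)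

text \<open>The indices i, j in these names refer to \<open>U0\<close> on a multiple of qa^i qb^j.
  The three parts belong to the summands of \<open>F\<close>: the first comes from qV, the second
  from the derivative of qb, the third from that of qa. The factor K (1 - K^2) clears
  denominators.\<close>

lemma grade0_1_3:
  "grade0 (qa * (qb * qb)) * (K * (1 - K ^ 2)) = 1 + K - 2 * K ^ 2 - K ^ 3 + K ^ 4"
  "grade0 ((s + 1 / s) * qa * qb) * (K * (1 - K ^ 2)) = 1 - K ^ 4"
  "grade0 ((r + 1 / r) * qb * qb) * (K * (1 - K ^ 2)) = 1 - K ^ 4"
proof -
  have "grade0 (qa * (qb * qb)) = 1 / (m ^ 2 * p) + 1 - m ^ 2 * p"
    unfolding grade0_rep_mult[OF rep_qa rep_b2] by (simp add: field_simps eval_nat_numeral)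
  hence "grade0 (qa * (qb * qb)) * (K * (d * e)) = 1 * (K ^ 0 * (d * e)) + 1 * (K ^ 1 * (d * e)) + (- 1) * (K ^ 2 * (d * e))"
    by (simp only: p_K m_de) (simp add: field_simps eval_nat_numeral)
  thus "grade0 (qa * (qb * qb)) * (K * (1 - K ^ 2)) = 1 + K - 2 * K ^ 2 - K ^ 3 + K ^ 4"
    unfolding d_def e_def by algebra
  have "grade0 ((s + 1 / s) * qa * qb) = 1 / (m ^ 2 * p) + m ^ 2 * p"
    unfolding grade0_rep_mult[OF rep_N1 rep_qb] by (simp add: field_simps eval_nat_numeral)
  hence "grade0 ((s + 1 / s) * qa * qb) * (K * (d * e)) = 1 * (K ^ 0 * (d * e)) + 1 * (K ^ 2 * (d * e))"
    by (simp only: p_K m_de) (simp add: field_simps eval_nat_numeral)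
  thus "grade0 ((s + 1 / s) * qa * qb) * (K * (1 - K ^ 2)) = 1 - K ^ 4"
    unfolding d_def e_def by algebra
  have "grade0 ((r + 1 / r) * qb * qb) = 1 / (m ^ 2 * p) + m ^ 2 * p"
    unfolding grade0_rep_mult[OF rep_N2 rep_qb] by (simp add: field_simps eval_nat_numeral)
  hence "grade0 ((r + 1 / r) * qb * qb) * (K * (d * e)) = 1 * (K ^ 0 * (d * e)) + 1 * (K ^ 2 * (d * e))"
    by (simp only: p_K m_de) (simp add: field_simps eval_nat_numeral)
  thus "grade0 ((r + 1 / r) * qb * qb) * (K * (1 - K ^ 2)) = 1 - K ^ 4"
    unfolding d_def e_def by algebra
qed

lemma grade0_4_2:
  "grade0 ((qa * qa) * (qa * qa * qb)) * (K * (1 - K ^ 2)) = -4 - 3 * K - 16 * K ^ 2 + 3 * K ^ 3 - 4 * K ^ 4"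
  "grade0 ((s + 1 / s) * qa * (qa * (qa * qa))) * (K * (1 - K ^ 2)) = -4 - 4 * K - 4 * K ^ 3 + 4 * K ^ 4"
  "grade0 ((r + 1 / r) * qb * (qa * (qa * qa))) * (K * (1 - K ^ 2)) = -3 - 8 * K - 8 * K ^ 3 + 3 * K ^ 4"
proof -
  have "grade0 ((qa * qa) * (qa * qa * qb)) = - (4 / (m * p)) + 2 / m + 5 - 2 * m - 4 * m * p"
    unfolding grade0_rep_mult[OF rep_a2 rep_a2b] by (simp add: field_simps eval_nat_numeral)
  hence "grade0 ((qa * qa) * (qa * qa * qb)) * (K * (d * e)) = (- 4) * (K ^ 0 * (e * e)) + 2 * (K ^ 1 * (d * d)) + 5 * (K ^ 1 * (d * e)) + (- 2) * (K ^ 1 * (e * e)) + (- 4) * (K ^ 2 * (d * d))"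
    by (simp only: p_K m_de) (simp add: field_simps eval_nat_numeral)
  thus "grade0 ((qa * qa) * (qa * qa * qb)) * (K * (1 - K ^ 2)) = -4 - 3 * K - 16 * K ^ 2 + 3 * K ^ 3 - 4 * K ^ 4"
    unfolding d_def e_def by algebra
  have "grade0 ((s + 1 / s) * qa * (qa * (qa * qa))) = - (4 / (m * p)) + 2 / m + 2 * m + 4 * m * p"
    unfolding grade0_rep_mult[OF rep_N1 rep_a3] by (simp add: field_simps eval_nat_numeral)
  hence "grade0 ((s + 1 / s) * qa * (qa * (qa * qa))) * (K * (d * e)) = (- 4) * (K ^ 0 * (e * e)) + 2 * (K ^ 1 * (d * d)) + 2 * (K ^ 1 * (e * e)) + 4 * (K ^ 2 * (d * d))"
    by (simp only: p_K m_de) (simp add: field_simps eval_nat_numeral)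
  thus "grade0 ((s + 1 / s) * qa * (qa * (qa * qa))) * (K * (1 - K ^ 2)) = -4 - 4 * K - 4 * K ^ 3 + 4 * K ^ 4"
    unfolding d_def e_def by algebra
  have "grade0 ((r + 1 / r) * qb * (qa * (qa * qa))) = - (3 / (m * p)) - 1 / m - m + 3 * m * p"
    unfolding grade0_rep_mult[OF rep_N2 rep_a3] by (simp add: field_simps eval_nat_numeral)
  hence "grade0 ((r + 1 / r) * qb * (qa * (qa * qa))) * (K * (d * e)) = (- 3) * (K ^ 0 * (e * e)) + (- 1) * (K ^ 1 * (d * d)) + (- 1) * (K ^ 1 * (e * e)) + 3 * (K ^ 2 * (d * d))"
    by (simp only: p_K m_de) (simp add: field_simps eval_nat_numeral)
  thus "grade0 ((r + 1 / r) * qb * (qa * (qa * qa))) * (K * (1 - K ^ 2)) = -3 - 8 * K - 8 * K ^ 3 + 3 * K ^ 4"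
    unfolding d_def e_def by algebra
qed

lemma grade0_3_3:
  "grade0 ((qa * (qa * qa)) * (qb * qb)) * (K * (1 - K ^ 2)) = -2 - 9 * K - 28 * K ^ 2 + 9 * K ^ 3 - 2 * K ^ 4"
  "grade0 ((s + 1 / s) * qa * (qa * qa * qb)) * (K * (1 - K ^ 2)) = -1 + 4 * K + 4 * K ^ 3 + K ^ 4"
  "grade0 ((r + 1 / r) * qb * (qa * qa * qb)) * (K * (1 - K ^ 2)) = -2 - 12 * K - 12 * K ^ 3 + 2 * K ^ 4"
proof -
  have "grade0 ((qa * (qa * qa)) * (qb * qb)) = - (2 / (m * p)) + 6 / m - 5 - 6 * m - 2 * m * p"
    unfolding grade0_rep_mult[OF rep_a3 rep_b2] by (simp add: field_simps eval_nat_numeral)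
  hence "grade0 ((qa * (qa * qa)) * (qb * qb)) * (K * (d * e)) = (- 2) * (K ^ 0 * (e * e)) + 6 * (K ^ 1 * (d * d)) + (- 5) * (K ^ 1 * (d * e)) + (- 6) * (K ^ 1 * (e * e)) + (- 2) * (K ^ 2 * (d * d))"
    by (simp only: p_K m_de) (simp add: field_simps eval_nat_numeral)
  thus "grade0 ((qa * (qa * qa)) * (qb * qb)) * (K * (1 - K ^ 2)) = -2 - 9 * K - 28 * K ^ 2 + 9 * K ^ 3 - 2 * K ^ 4"
    unfolding d_def e_def by algebra
  have "grade0 ((s + 1 / s) * qa * (qa * qa * qb)) = - (1 / (m * p)) + 3 / m + 3 * m + m * p"
    unfolding grade0_rep_mult[OF rep_N1 rep_a2b] by (simp add: field_simps eval_nat_numeral)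
  hence "grade0 ((s + 1 / s) * qa * (qa * qa * qb)) * (K * (d * e)) = (- 1) * (K ^ 0 * (e * e)) + 3 * (K ^ 1 * (d * d)) + 3 * (K ^ 1 * (e * e)) + 1 * (K ^ 2 * (d * d))"
    by (simp only: p_K m_de) (simp add: field_simps eval_nat_numeral)
  thus "grade0 ((s + 1 / s) * qa * (qa * qa * qb)) * (K * (1 - K ^ 2)) = -1 + 4 * K + 4 * K ^ 3 + K ^ 4"
    unfolding d_def e_def by algebra
  have "grade0 ((r + 1 / r) * qb * (qa * qa * qb)) = - (2 / (m * p)) - 4 / m - 4 * m + 2 * m * p"
    unfolding grade0_rep_mult[OF rep_N2 rep_a2b] by (simp add: field_simps eval_nat_numeral)
  hence "grade0 ((r + 1 / r) * qb * (qa * qa * qb)) * (K * (d * e)) = (- 2) * (K ^ 0 * (e * e)) + (- 4) * (K ^ 1 * (d * d)) + (- 4) * (K ^ 1 * (e * e)) + 2 * (K ^ 2 * (d * d))"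
    by (simp only: p_K m_de) (simp add: field_simps eval_nat_numeral)
  thus "grade0 ((r + 1 / r) * qb * (qa * qa * qb)) * (K * (1 - K ^ 2)) = -2 - 12 * K - 12 * K ^ 3 + 2 * K ^ 4"
    unfolding d_def e_def by algebra
qed

lemma grade0_2_4:
  "grade0 ((qa * qa) * (qb * (qb * qb))) * (K * (1 - K ^ 2)) = 8 - 9 * K - 8 * K ^ 2 + 9 * K ^ 3 + 8 * K ^ 4"
  "grade0 ((s + 1 / s) * qa * (qa * (qb * qb))) * (K * (1 - K ^ 2)) = 6 - 4 * K - 4 * K ^ 3 - 6 * K ^ 4"
  "grade0 ((r + 1 / r) * qb * (qa * (qb * qb))) * (K * (1 - K ^ 2)) = 2 + 2 * K + 2 * K ^ 3 - 2 * K ^ 4"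
proof -
  have "grade0 ((qa * qa) * (qb * (qb * qb))) = 2 / (m ^ 3 * p) + 6 / (m ^ 2 * p) - 5 - 6 * m ^ 2 * p + 2 * m ^ 3 * p"
    unfolding grade0_rep_mult[OF rep_a2 rep_b3] by (simp add: field_simps eval_nat_numeral)
  hence "grade0 ((qa * qa) * (qb * (qb * qb))) * (K * (d * e)) = 2 * (K ^ 0 * (d * d)) + 6 * (K ^ 0 * (d * e)) + (- 5) * (K ^ 1 * (d * e)) + (- 6) * (K ^ 2 * (d * e)) + 2 * (K ^ 2 * (e * e))"
    by (simp only: p_K m_de) (simp add: field_simps eval_nat_numeral)
  thus "grade0 ((qa * qa) * (qb * (qb * qb))) * (K * (1 - K ^ 2)) = 8 - 9 * K - 8 * K ^ 2 + 9 * K ^ 3 + 8 * K ^ 4"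
    unfolding d_def e_def by algebra
  have "grade0 ((s + 1 / s) * qa * (qa * (qb * qb))) = 2 / (m ^ 3 * p) + 4 / (m ^ 2 * p) + 4 * m ^ 2 * p - 2 * m ^ 3 * p"
    unfolding grade0_rep_mult[OF rep_N1 rep_ab2] by (simp add: field_simps eval_nat_numeral)
  hence "grade0 ((s + 1 / s) * qa * (qa * (qb * qb))) * (K * (d * e)) = 2 * (K ^ 0 * (d * d)) + 4 * (K ^ 0 * (d * e)) + 4 * (K ^ 2 * (d * e)) + (- 2) * (K ^ 2 * (e * e))"
    by (simp only: p_K m_de) (simp add: field_simps eval_nat_numeral)
  thus "grade0 ((s + 1 / s) * qa * (qa * (qb * qb))) * (K * (1 - K ^ 2)) = 6 - 4 * K - 4 * K ^ 3 - 6 * K ^ 4"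
    unfolding d_def e_def by algebra
  have "grade0 ((r + 1 / r) * qb * (qa * (qb * qb))) = - (1 / (m ^ 3 * p)) + 3 / (m ^ 2 * p) + 3 * m ^ 2 * p + m ^ 3 * p"
    unfolding grade0_rep_mult[OF rep_N2 rep_ab2] by (simp add: field_simps eval_nat_numeral)
  hence "grade0 ((r + 1 / r) * qb * (qa * (qb * qb))) * (K * (d * e)) = (- 1) * (K ^ 0 * (d * d)) + 3 * (K ^ 0 * (d * e)) + 3 * (K ^ 2 * (d * e)) + 1 * (K ^ 2 * (e * e))"
    by (simp only: p_K m_de) (simp add: field_simps eval_nat_numeral)
  thus "grade0 ((r + 1 / r) * qb * (qa * (qb * qb))) * (K * (1 - K ^ 2)) = 2 + 2 * K + 2 * K ^ 3 - 2 * K ^ 4"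
    unfolding d_def e_def by algebra
qed

lemma grade0_1_5:
  "grade0 ((qb * qb) * (qa * (qb * qb))) * (K * (1 - K ^ 2)) = 6 - 3 * K + 4 * K ^ 2 + 3 * K ^ 3 + 6 * K ^ 4"
  "grade0 ((s + 1 / s) * qa * (qb * (qb * qb))) * (K * (1 - K ^ 2)) = 4 - 6 * K - 6 * K ^ 3 - 4 * K ^ 4"
  "grade0 ((r + 1 / r) * qb * (qb * (qb * qb))) * (K * (1 - K ^ 2)) = -2 + 8 * K + 8 * K ^ 3 + 2 * K ^ 4"
proof -
  have "grade0 ((qb * qb) * (qa * (qb * qb))) = 4 / (m ^ 3 * p) + 2 / (m ^ 2 * p) + 5 - 2 * m ^ 2 * p + 4 * m ^ 3 * p"
    unfolding grade0_rep_mult[OF rep_b2 rep_ab2] by (simp add: field_simps eval_nat_numeral)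
  hence "grade0 ((qb * qb) * (qa * (qb * qb))) * (K * (d * e)) = 4 * (K ^ 0 * (d * d)) + 2 * (K ^ 0 * (d * e)) + 5 * (K ^ 1 * (d * e)) + (- 2) * (K ^ 2 * (d * e)) + 4 * (K ^ 2 * (e * e))"
    by (simp only: p_K m_de) (simp add: field_simps eval_nat_numeral)
  thus "grade0 ((qb * qb) * (qa * (qb * qb))) * (K * (1 - K ^ 2)) = 6 - 3 * K + 4 * K ^ 2 + 3 * K ^ 3 + 6 * K ^ 4"
    unfolding d_def e_def by algebra
  have "grade0 ((s + 1 / s) * qa * (qb * (qb * qb))) = 3 / (m ^ 3 * p) + 1 / (m ^ 2 * p) + m ^ 2 * p - 3 * m ^ 3 * p"
    unfolding grade0_rep_mult[OF rep_N1 rep_b3] by (simp add: field_simps eval_nat_numeral)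
  hence "grade0 ((s + 1 / s) * qa * (qb * (qb * qb))) * (K * (d * e)) = 3 * (K ^ 0 * (d * d)) + 1 * (K ^ 0 * (d * e)) + 1 * (K ^ 2 * (d * e)) + (- 3) * (K ^ 2 * (e * e))"
    by (simp only: p_K m_de) (simp add: field_simps eval_nat_numeral)
  thus "grade0 ((s + 1 / s) * qa * (qb * (qb * qb))) * (K * (1 - K ^ 2)) = 4 - 6 * K - 6 * K ^ 3 - 4 * K ^ 4"
    unfolding d_def e_def by algebra
  have "grade0 ((r + 1 / r) * qb * (qb * (qb * qb))) = - (4 / (m ^ 3 * p)) + 2 / (m ^ 2 * p) + 2 * m ^ 2 * p + 4 * m ^ 3 * p"
    unfolding grade0_rep_mult[OF rep_N2 rep_b3] by (simp add: field_simps eval_nat_numeral)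
  hence "grade0 ((r + 1 / r) * qb * (qb * (qb * qb))) * (K * (d * e)) = (- 4) * (K ^ 0 * (d * d)) + 2 * (K ^ 0 * (d * e)) + 2 * (K ^ 2 * (d * e)) + 4 * (K ^ 2 * (e * e))"
    by (simp only: p_K m_de) (simp add: field_simps eval_nat_numeral)
  thus "grade0 ((r + 1 / r) * qb * (qb * (qb * qb))) * (K * (1 - K ^ 2)) = -2 + 8 * K + 8 * K ^ 3 + 2 * K ^ 4"
    unfolding d_def e_def by algebra
qed

end

section \<open>Eta quotients as rational functions of K and r\<close>

context dissection
begin

text \<open>\<open>A\<close> and \<open>B\<close> are 1 + \<sigma> hq and 1 - 4 \<sigma> hq times
  the common denominator \<open>C\<close>, and \<open>D\<close> comes from the logarithmic
  derivative of K / C. Consequently \<sigma> y = K / B and 1 + 5 \<sigma> y = A / B.\<close>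

definition A where "A = 1 + K - K ^ 2"
definition B where "B = 1 - 4 * K - K ^ 2"
definition C where "C = 1 - K ^ 2"
definition D where "D = 1 + K ^ 2"

lemma C_de: "C = d * e"
  by (simp add: C_def d_def e_def algebra_simps power2_eq_square)

lemma C_nz [simp]: "C \<noteq> 0"
  by (simp add: C_de)

lemma H_C: "\<sigma> hq * C = K"
  using H_K unfolding C_def K_def .

lemma one_minus_4_hq_nz: "1 - 4 * hq \<noteq> 0"
  unfolding one_minus_4_hq by simp

lemma qq_nz [simp]: "hq \<noteq> 0" "qa \<noteq> 0" "qb \<noteq> 0" "qV \<noteq> 0"
  by (simp_all add: hq_def qa_def qb_def qV_def)

lemma B_C: "(1 - 4 * \<sigma> hq) * C = B"
proof -
  have "(1 - 4 * \<sigma> hq) * C = C - 4 * (\<sigma> hq * C)" by (simp add: algebra_simps)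
  thus ?thesis unfolding H_C by (simp add: B_def C_def)
qed

lemma A_C: "(1 + \<sigma> hq) * C = A"
proof -
  have "(1 + \<sigma> hq) * C = C + \<sigma> hq * C" by (simp add: algebra_simps)
  thus ?thesis unfolding H_C by (simp add: A_def C_def)
qed

lemma B_nz [simp]: "B \<noteq> 0"
proof -
  have "1 - 4 * \<sigma> hq = \<sigma> (1 - 4 * hq)" by (simp add: compose_power_numeral)
  also have "\<dots> \<noteq> 0" using one_minus_4_hq_nz by (simp only: compose_power_eq_0_iff[of 5] zero_less_numeral) simp
  finally show ?thesis unfolding B_C[symmetric] by simp
qed

lemma qV_AB: "qV * B = A"
  using qV_H unfolding B_C[symmetric] A_C[symmetric] by algebra

lemma A_nz [simp]: "A \<noteq> 0"
  unfolding qV_AB[symmetric] by simp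

lemma y_hq': "y = hq * (1 + 4 * y)"
  using y_hq by (simp add: algebra_simps)

lemma y_nz [simp]: "y \<noteq> 0"
  using y_hq by auto

lemma sigma_y_B: "\<sigma> y * B = K"
proof -
  have "\<sigma> y * (1 - 4 * \<sigma> hq) = \<sigma> hq"
    using arg_cong[OF y_hq, of \<sigma>] by (simp add: compose_power_numeral)
  hence "\<sigma> y * ((1 - 4 * \<sigma> hq) * C) = \<sigma> hq * C"
    by (simp only: mult.assoc[symmetric])
  thus ?thesis unfolding H_C B_C .
qed

lemma sigma_v: "1 + 5 * \<sigma> y = qV"
proof -
  have "(1 + 5 * \<sigma> y) * B = qV * B"
  proof -
    have "(1 + 5 * \<sigma> y) * B = B + 5 * (\<sigma> y * B)" by (simp add: algebra_simps)
    thus ?thesis unfolding qV_AB sigma_y_B by (simp add: A_def B_def)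
  qed
  thus ?thesis by simp
qed

text \<open>Known at q^5, where both sides are qV, and pulled back by injectivity of
  \<sigma>.\<close>

lemma v_E: "1 + 5 * y = E 2 ^ 5 * E 5 / (E 1 ^ 5 * E 10)"
proof (rule compose_power_inj[of 5])
  show "\<sigma> (1 + 5 * y) = \<sigma> (E 2 ^ 5 * E 5 / (E 1 ^ 5 * E 10))"
    using sigma_v by (simp add: compose_power_simps E_compose qV_def)
qed simp

lemma v_nz [simp]: "1 + 5 * y \<noteq> 0"
  unfolding v_E by simp

lemma v_qq: "1 + 5 * y = (qb / qa) ^ 5 * \<sigma> hq"
  unfolding v_E qa_def qb_def hq_def by (simp add: compose_power_simps E_compose field_simps)

text \<open>The product of 1 - 4 hq at q and at q^5 is (qa^2 / qb)^2; together with the formulas for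
  y and qV this eliminates both factors.\<close>

lemma y_qq: "y = qb / qa ^ 3 * (1 + \<sigma> hq)"
proof -
  have "(1 - 4 * hq) * (1 - 4 * \<sigma> hq) = (qa ^ 2 / qb) ^ 2"
  proof -
    have "1 - 4 * \<sigma> hq = \<sigma> (1 - 4 * hq)" by (simp add: compose_power_numeral)
    also have "\<dots> = (E 5 ^ 2 * E 50 / (E 10 * E 25 ^ 2)) ^ 2"
      unfolding one_minus_4_hq by (simp add: compose_power_simps E_compose)
    finally have *: "1 - 4 * \<sigma> hq = (E 5 ^ 2 * E 50 / (E 10 * E 25 ^ 2)) ^ 2" .
    show ?thesis
      unfolding * one_minus_4_hq qa_def qb_def power_mult_distrib[symmetric]
      by (intro arg_cong[where f = "\<lambda>x. x ^ 2"]) (simp add: field_simps power2_eq_square)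
  qed
  hence "(1 - 4 * hq) * (1 - 4 * \<sigma> hq) * qb ^ 2 = qa ^ 4"
    by (simp add: power_divide)
  moreover have "hq * qb = qa * qV" unfolding hq_qV by simp
  ultimately have "(1 - 4 * hq) * (1 - 4 * \<sigma> hq) * qb ^ 2 * (y * qa ^ 3) = (1 - 4 * hq) * (1 - 4 * \<sigma> hq) * qb ^ 2 * (qb * (1 + \<sigma> hq))"
    using y_hq qV_H by algebra
  moreover have "(1 - 4 * hq) * (1 - 4 * \<sigma> hq) * qb ^ 2 \<noteq> 0"
    using \<open>_ = qa ^ 4\<close> by simp
  ultimately have "y * qa ^ 3 = qb * (1 + \<sigma> hq)" by (metis mult_left_cancel)
  thus ?thesis by (simp add: field_simps)
qed

lemma quot_y: "qb / qa = \<sigma> (1 + 5 * y) * (1 + 4 * y) / y"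
proof -
  have "hq * qb = qa * qV" unfolding hq_qV by simp
  moreover have "\<sigma> (1 + 5 * y) = qV" using sigma_v by (simp add: compose_power_numeral)
  ultimately have "qb * y = \<sigma> (1 + 5 * y) * (1 + 4 * y) * qa"
    using y_hq' by algebra
  thus ?thesis by (simp add: field_simps)
qed

text \<open>The fifth power of qb / qa is known from \<open>v_qq\<close>, and qb / qa itself from
  \<open>quot_y\<close>; comparing them eliminates qa and qb.\<close>

lemma modular_equation: "(1 + 4 * \<sigma> y) * y ^ 5 * (1 + 5 * y) = \<sigma> y * \<sigma> (1 + 5 * y) ^ 5 * (1 + 4 * y) ^ 5"
proof -
  have H: "\<sigma> hq * (1 + 4 * \<sigma> y) = \<sigma> y"
    using arg_cong[OF y_hq', of \<sigma>] by (simp add: compose_power_numeral)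
  have "(1 + 5 * y) * y ^ 5 = ((qb / qa) ^ 5 * \<sigma> hq) * y ^ 5"
    by (rule arg_cong[OF v_qq])
  also have "\<dots> = ((qb / qa) * y) ^ 5 * \<sigma> hq"
    by (simp only: power_mult_distrib mult_ac)
  also have "(qb / qa) * y = \<sigma> (1 + 5 * y) * (1 + 4 * y)"
    unfolding quot_y by simp
  finally have v: "(1 + 5 * y) * y ^ 5 = (\<sigma> (1 + 5 * y) * (1 + 4 * y)) ^ 5 * \<sigma> hq" .
  have "(1 + 4 * \<sigma> y) * y ^ 5 * (1 + 5 * y) = (1 + 4 * \<sigma> y) * ((1 + 5 * y) * y ^ 5)"
    by (simp only: mult_ac)
  also have "\<dots> = (\<sigma> hq * (1 + 4 * \<sigma> y)) * (\<sigma> (1 + 5 * y) * (1 + 4 * y)) ^ 5"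
    unfolding v by (simp only: mult_ac)
  also have "\<dots> = \<sigma> y * \<sigma> (1 + 5 * y) ^ 5 * (1 + 4 * y) ^ 5"
    unfolding H by (simp only: power_mult_distrib mult.assoc)
  finally show ?thesis .
qed

text \<open>Once denominators are cleared, the term from qb has constant coefficient 1, while the
  term from qa starts at q.\<close>

lemma quot_neq: "qb / qa + 1 \<noteq> 0"
proof
  assume "qb / qa + 1 = 0"
  hence "qa + qb = 0" by (simp add: field_simps)
  hence "E 1 * E 50 * fls_X + E 2 * E 25 = 0"
    unfolding qa_def qb_def by (simp add: field_simps power2_eq_square)
  moreover have "fls_nth (E 1 * E 50 * fls_X + E 2 * E 25) 0 = 1"
  proof -
    have "E 1 * E 50 * fls_X + E 2 * E 25 = fps_to_fls (euler 1 * euler 50 * fps_X + euler 2 * euler 25)"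
      by (simp add: E_def fls_times_fps_to_fls)
    moreover have "fps_nth (euler 1 * euler 50 * fps_X + euler 2 * euler 25) 0 = 1"
      by (simp add: euler_nth_0)
    ultimately show ?thesis by simp
  qed
  ultimately show False by simp
qed

lemma qderiv_K: "qderiv K = K * log_deriv K"
  by (simp add: qderiv_dl)

lemma log_deriv_m: "log_deriv m * C = 2 * K * log_deriv K"
proof -
  have "log_deriv m = log_deriv e - log_deriv d" unfolding m_de by (simp add: log_deriv_divide)
  moreover have "e * log_deriv e = K * log_deriv K" "d * log_deriv d = - (K * log_deriv K)"
    using qderiv_dl[of e] qderiv_dl[of d] qderiv_K by (simp_all add: e_def d_def qderiv_add qderiv_diff)
  moreover have "e + d = 2" by (simp add: e_def d_def)
  ultimately show ?thesis unfolding C_de by algebra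
qed

text \<open>K = m^2 r^5 and s = m r^2 are differentiated logarithmically; since m is a rational
  function of K, both results are multiples of the logarithmic derivative of K.\<close>

lemma log_deriv_r: "5 * C * log_deriv r = B * log_deriv K" and log_deriv_s: "5 * C * log_deriv s = 2 * A * log_deriv K"
proof -
  have "log_deriv K = log_deriv (m ^ 2 * p)" by (rule arg_cong[OF K_mp])
  also have "\<dots> = 2 * log_deriv m + log_deriv p" by (simp add: log_deriv_mult log_deriv_power)
  also have "log_deriv p = 5 * log_deriv r" unfolding p_def using nz by (simp add: log_deriv_power)
  finally have "log_deriv K = 2 * log_deriv m + 5 * log_deriv r" .
  with log_deriv_m show r: "5 * C * log_deriv r = B * log_deriv K" unfolding B_def C_def by algebra
  have "log_deriv s = log_deriv (m * r ^ 2)" by (rule arg_cong[OF s_eq])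
  also have "\<dots> = log_deriv m + 2 * log_deriv r" using nz by (simp add: log_deriv_mult log_deriv_power)
  finally have "log_deriv s = log_deriv m + 2 * log_deriv r" .
  with log_deriv_m r show "5 * C * log_deriv s = 2 * A * log_deriv K" unfolding A_def B_def C_def by algebra
qed

lemma log_deriv_sigma: "log_deriv (\<sigma> f) = 5 * \<sigma> (log_deriv f)"
  by (simp add: log_deriv_def qderiv_compose compose_power_divide)

lemma sigma_F: "5 * C * \<sigma> F = D * log_deriv K"
proof -
  have "5 * \<sigma> F = log_deriv (\<sigma> hq)" by (simp add: log_deriv_sigma F_dl)
  moreover have "\<sigma> hq = K / C" using H_C by (simp add: field_simps)
  hence "log_deriv (\<sigma> hq) = log_deriv K - log_deriv C" by (simp add: log_deriv_divide)
  moreover have "C * log_deriv C = - 2 * K * (K * log_deriv K)"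
  proof -
    have "C * log_deriv C = qderiv C" by (rule qderiv_dl[symmetric]) simp
    also have "\<dots> = - 2 * K * qderiv K" by (simp add: C_def qderiv_diff qderiv_power)
    finally show ?thesis unfolding qderiv_K .
  qed
  ultimately show ?thesis unfolding C_def D_def by algebra
qed

lemma sigma_F_nz [simp]: "\<sigma> F \<noteq> 0"
  using F_nonzero by (simp add: compose_power_eq_0_iff)

lemma D_nz [simp]: "D \<noteq> 0"
proof
  assume "D = 0"
  hence "5 * C * \<sigma> F = 0" using sigma_F by simp
  thus False by simp
qed

lemma log_deriv_qV: "A * B * log_deriv qV = 5 * K * D * log_deriv K"
proof -
  have "qV = A / B" using qV_AB by (simp add: eq_divide_eq)
  hence "log_deriv qV = log_deriv (A / B)" by (rule arg_cong)
  also have "\<dots> = log_deriv A - log_deriv B" by (rule log_deriv_divide) simp_all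
  finally have "log_deriv qV = log_deriv A - log_deriv B" .
  moreover have "A * log_deriv A = (1 - 2 * K) * (K * log_deriv K)" "B * log_deriv B = - (4 + 2 * K) * (K * log_deriv K)"
  proof -
    have "A * log_deriv A = qderiv A" "B * log_deriv B = qderiv B" by (rule qderiv_dl[symmetric], simp)+
    moreover have "qderiv A = (1 - 2 * K) * qderiv K" "qderiv B = - (4 + 2 * K) * qderiv K"
      by (simp_all add: A_def B_def qderiv_add qderiv_diff qderiv_power qderiv_mult algebra_simps)
    ultimately show "A * log_deriv A = (1 - 2 * K) * (K * log_deriv K)" "B * log_deriv B = - (4 + 2 * K) * (K * log_deriv K)"
      unfolding qderiv_K by simp_all
  qed
  ultimately show ?thesis unfolding A_def B_def D_def by algebra
qed

lemma log_deriv_aux: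
  assumes "f \<noteq> 0"
  shows "qderiv (1 / f - 1 - f) = - log_deriv f * (f + 1 / f)"
proof -
  have "qderiv (1 / f) = - qderiv f / f ^ 2" using qderiv_divide[OF assms, of 1] by simp
  thus ?thesis using assms by (simp only: qderiv_diff qderiv_1 log_deriv_def) (simp add: field_simps power2_eq_square)
qed

text \<open>\<open>F\<close> is the logarithmic derivative of (qa / qb) qV, and that of 1/f - 1 - f
  involves f + 1/f. All remaining logarithmic derivatives are multiples of that of K, which
  \<open>sigma_F\<close> trades for \<sigma> F.\<close>

lemma F_qq: "A * B * D * (F * qa * qb) =
  \<sigma> F * (A * B * (2 * A * ((s + 1 / s) * qa) - B * ((r + 1 / r) * qb)) + 25 * C * K * D * (qa * qb))"
proof -
  have F: "F = log_deriv qa - log_deriv qb + log_deriv qV"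
    unfolding F_dl hq_qV by (simp add: log_deriv_mult log_deriv_divide)
  have "qa * log_deriv qa = - log_deriv r * (r + 1 / r)"
    using qderiv_dl[of qa] log_deriv_aux[OF nz(1)] qa_r by simp
  moreover have "qb * log_deriv qb = - log_deriv s * (s + 1 / s)"
    using qderiv_dl[of qb] log_deriv_aux[OF nz(2)] qb_s by simp
  ultimately have "5 * C * (A * B * D * (F * qa * qb)) =
    5 * C * (\<sigma> F * (A * B * (2 * A * ((s + 1 / s) * qa) - B * ((r + 1 / r) * qb)) + 25 * C * K * D * (qa * qb)))"
    using F log_deriv_r log_deriv_s log_deriv_qV sigma_F by algebra
  thus ?thesis by simp
qed

lemma Z_qb: "Z * qb = 1"
  unfolding Z_E qb_def by (simp add: field_simps)

text \<open>\<open>Z\<close> cancels one factor qb and \<open>F_qq\<close> uses up a factor qa qb.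
  The coefficients are functions of K, hence series in q^5, and pass through
  \<open>grade0\<close>.\<close>

lemma U0_qq:
  assumes "grade0 (qa * qb * g) * (K * (1 - K ^ 2)) = g1"
    "grade0 ((s + 1 / s) * qa * g) * (K * (1 - K ^ 2)) = g2"
    "grade0 ((r + 1 / r) * qb * g) * (K * (1 - K ^ 2)) = g3"
  shows "A * B * D * (K * C) * \<sigma> (U0 (qa * qb ^ 2 * g)) = 25 * K * C * D * g1 + 2 * A ^ 2 * B * g2 - A * B ^ 2 * g3"
proof -
  have 0: "graded 0 A" "graded 0 B" "graded 0 D" "graded 0 C"
    unfolding A_def B_def C_def D_def by (auto intro!: graded_0_intros graded_0_K)
  have "A * B * D * (F * Z * (qa * qb ^ 2 * g)) = A * B * D * (F * qa * qb) * g"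
    using Z_qb by algebra
  also have "\<dots> = \<sigma> F * (2 * A ^ 2 * B) * ((s + 1 / s) * qa * g) + (- (\<sigma> F * (A * B ^ 2))) * ((r + 1 / r) * qb * g)
      + \<sigma> F * (25 * C * K * D) * (qa * qb * g)"
    unfolding F_qq by algebra
  finally have *: "A * B * D * (F * Z * (qa * qb ^ 2 * g)) = \<dots>" .
  have "A * B * D * grade0 (F * Z * (qa * qb ^ 2 * g)) = grade0 (A * B * D * (F * Z * (qa * qb ^ 2 * g)))"
    by (rule grade0_mult[symmetric]) (intro graded_0_intros 0)
  also have "\<dots> = \<sigma> F * (2 * A ^ 2 * B) * grade0 ((s + 1 / s) * qa * g) + (- (\<sigma> F * (A * B ^ 2))) * grade0 ((r + 1 / r) * qb * g)
      + \<sigma> F * (25 * C * K * D) * grade0 (qa * qb * g)"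
    unfolding * grade0_add
    by (intro arg_cong2[where f = "(+)"] grade0_mult graded_0_intros graded_compose 0 graded_0_K)
  finally have "A * B * D * (K * C) * grade0 (F * Z * (qa * qb ^ 2 * g)) =
      \<sigma> F * (25 * K * C * D * g1 + 2 * A ^ 2 * B * g2 - A * B ^ 2 * g3)"
    unfolding assms[symmetric] C_def by algebra
  thus ?thesis unfolding sigma_L by (simp add: field_simps)
qed

end

section \<open>Five explicit values of \<open>U0\<close>\<close>

context dissection
begin

lemma sigma_coeff: "\<sigma> (hq / (1 + hq) ^ n) = K * C ^ n / (C * A ^ n)"
proof -
  have "\<sigma> hq = K / C" using H_C by (simp add: eq_divide_eq)
  moreover have "1 + \<sigma> hq = A / C" using A_C by (simp add: eq_divide_eq)
  ultimately show ?thesis by (cases n) (simp_all add: compose_power_simps power_divide)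
qed

lemma sigma_v_AB: "\<sigma> (1 + 5 * y) = A / B"
  using sigma_v qV_AB by (simp add: compose_power_numeral eq_divide_eq)

text \<open>
  Both \<open>F\<close> and \<open>Z\<close> have denominators \<open>qa\<close> and \<open>qb\<close>; the products \<open>qa^i qb^j\<close> with \<open>i \<ge> 1\<close> and \<open>j \<ge> 2\<close> clear them, and five of these determine \<open>U0\<close> on all \<open>y^m (1 + 5 y)^(-n)\<close>.
\<close>

lemma U0_value_2:
  assumes "D * u * A = 1 * (A * B * D * (K * C) * \<sigma> (U0 g))" "B ^ 3 * \<sigma> f = u"
  shows "U0 (\<sigma> (hq / (1 + hq) ^ 2) * g) = f / (1 + 5 * y) ^ 2"
proof (rule compose_power_inj[of 5])
  have "(D * A) * u = (D * A) * (B * (K * C) * \<sigma> (U0 g))" using assms(1) by (simp add: mult_ac)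
  hence "B ^ 3 * \<sigma> f = B * (K * C) * \<sigma> (U0 g)" unfolding assms(2) by simp
  hence "\<sigma> (U0 g) = B ^ 3 * \<sigma> f / (B * (K * C))" by (simp add: eq_divide_eq mult_ac)
  moreover have "\<sigma> (U0 (\<sigma> (hq / (1 + hq) ^ 2) * g)) = K * C ^ 2 / (C * A ^ 2) * \<sigma> (U0 g)"
    by (subst U0_mult) (simp only: fls_compose_power_mult sigma_coeff)
  moreover have "\<sigma> (f / (1 + 5 * y) ^ 2) = \<sigma> f / (A / B) ^ 2"
    unfolding sigma_v_AB[symmetric] by (simp only: compose_power_divide[OF zero_less_numeral] fls_compose_power_power zero_less_numeral simp_thms)
  moreover have "K * C ^ 2 / (C * A ^ 2) * x = z / (A / B) ^ 2" if "x = B ^ 3 * z / (B * (K * C))" for x z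
    unfolding that by (simp add: field_simps eval_nat_numeral)
  ultimately show "\<sigma> (U0 (\<sigma> (hq / (1 + hq) ^ 2) * g)) = \<sigma> (f / (1 + 5 * y) ^ 2)"
    by simp
qed simp

lemma U0_value_3:
  assumes "D * u * 1 = C * (A * B * D * (K * C) * \<sigma> (U0 g))" "B ^ 5 * \<sigma> f = u"
  shows "U0 (\<sigma> (hq / (1 + hq) ^ 3) * g) = f / (1 + 5 * y) ^ 4"
proof (rule compose_power_inj[of 5])
  have "D * u = D * (A * B * (K * C ^ 2) * \<sigma> (U0 g))" using assms(1) by (simp add: mult_ac power2_eq_square)
  hence "B ^ 5 * \<sigma> f = A * B * (K * C ^ 2) * \<sigma> (U0 g)" unfolding assms(2) by simp
  hence "\<sigma> (U0 g) = B ^ 5 * \<sigma> f / (A * B * (K * C ^ 2))" by (simp add: eq_divide_eq mult_ac)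
  moreover have "\<sigma> (U0 (\<sigma> (hq / (1 + hq) ^ 3) * g)) = K * C ^ 3 / (C * A ^ 3) * \<sigma> (U0 g)"
    by (subst U0_mult) (simp only: fls_compose_power_mult sigma_coeff)
  moreover have "\<sigma> (f / (1 + 5 * y) ^ 4) = \<sigma> f / (A / B) ^ 4"
    unfolding sigma_v_AB[symmetric] by (simp only: compose_power_divide[OF zero_less_numeral] fls_compose_power_power zero_less_numeral simp_thms)
  moreover have "K * C ^ 3 / (C * A ^ 3) * x = z / (A / B) ^ 4" if "x = B ^ 5 * z / (A * B * (K * C ^ 2))" for x z
    unfolding that by (simp add: field_simps eval_nat_numeral)
  ultimately show "\<sigma> (U0 (\<sigma> (hq / (1 + hq) ^ 3) * g)) = \<sigma> (f / (1 + 5 * y) ^ 4)"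
    by simp
qed simp

text \<open>Replacing K by - 1 / K multiplies K, A, B and C by - 1 / K^2 and D by 1 / K^2. By this
  symmetry the combination in \<open>U0_qq\<close> is divisible by D, and a form in B and K remains.
  Since K = B \<sigma> y, its coefficients are those of the numerator in y. The same holds for the
  four values below.\<close>

lemma U0_1_3: "U0 (\<sigma> (hq / (1 + hq) ^ 2) * (qa * qb ^ 2 * qb)) = (1 + 39 * y + 240 * y ^ 2 + 400 * y ^ 3) / (1 + 5 * y) ^ 2"
proof (rule U0_value_2)
  have "grade0 (qa * qb * qb) * (K * (1 - K ^ 2)) = 1 + K - 2 * K ^ 2 - K ^ 3 + K ^ 4"
    using grade0_1_3(1) by (simp only: mult_ac)
  from U0_qq[OF this grade0_1_3(2,3)]
  show "D * (B ^ 3 + 39 * K * B ^ 2 + 240 * K ^ 2 * B + 400 * K ^ 3) * A = 1 * (A * B * D * (K * C) * \<sigma> (U0 (qa * qb ^ 2 * qb)))"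
    unfolding A_def B_def C_def D_def by algebra
  show "B ^ 3 * \<sigma> (1 + 39 * y + 240 * y ^ 2 + 400 * y ^ 3) = B ^ 3 + 39 * K * B ^ 2 + 240 * K ^ 2 * B + 400 * K ^ 3"
    unfolding sigma_y_B[symmetric] by (simp add: compose_power_simps) algebra
qed

lemma U0_4_2: "U0 (\<sigma> (hq / (1 + hq) ^ 3) * (qa * qb ^ 2 * (qa * (qa * qa)))) = (- 5 - 205 * y - 2515 * y ^ 2 - 14100 * y ^ 3 - 38000 * y ^ 4 - 40000 * y ^ 5) / (1 + 5 * y) ^ 4"
proof (rule U0_value_3)
  have "grade0 (qa * qb * (qa * (qa * qa))) * (K * (1 - K ^ 2)) = -4 - 3 * K - 16 * K ^ 2 + 3 * K ^ 3 - 4 * K ^ 4"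
    using grade0_4_2(1) by (simp only: mult_ac)
  from U0_qq[OF this grade0_4_2(2,3)]
  show "D * (- 5 * B ^ 5 - 205 * K * B ^ 4 - 2515 * K ^ 2 * B ^ 3 - 14100 * K ^ 3 * B ^ 2 - 38000 * K ^ 4 * B - 40000 * K ^ 5) * 1 = C * (A * B * D * (K * C) * \<sigma> (U0 (qa * qb ^ 2 * (qa * (qa * qa)))))"
    unfolding A_def B_def C_def D_def by algebra
  show "B ^ 5 * \<sigma> (- 5 - 205 * y - 2515 * y ^ 2 - 14100 * y ^ 3 - 38000 * y ^ 4 - 40000 * y ^ 5) = - 5 * B ^ 5 - 205 * K * B ^ 4 - 2515 * K ^ 2 * B ^ 3 - 14100 * K ^ 3 * B ^ 2 - 38000 * K ^ 4 * B - 40000 * K ^ 5"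
    unfolding sigma_y_B[symmetric] by (simp add: compose_power_simps) algebra
qed

lemma U0_3_3: "U0 (\<sigma> (hq / (1 + hq) ^ 3) * (qa * qb ^ 2 * (qa * qa * qb))) = (- 40 * y - 935 * y ^ 2 - 8100 * y ^ 3 - 30000 * y ^ 4 - 40000 * y ^ 5) / (1 + 5 * y) ^ 4"
proof (rule U0_value_3)
  have "grade0 (qa * qb * (qa * qa * qb)) * (K * (1 - K ^ 2)) = -2 - 9 * K - 28 * K ^ 2 + 9 * K ^ 3 - 2 * K ^ 4"
    using grade0_3_3(1) by (simp only: mult_ac)
  from U0_qq[OF this grade0_3_3(2,3)]
  show "D * (- 40 * K * B ^ 4 - 935 * K ^ 2 * B ^ 3 - 8100 * K ^ 3 * B ^ 2 - 30000 * K ^ 4 * B - 40000 * K ^ 5) * 1 = C * (A * B * D * (K * C) * \<sigma> (U0 (qa * qb ^ 2 * (qa * qa * qb))))"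
    unfolding A_def B_def C_def D_def by algebra
  show "B ^ 5 * \<sigma> (- 40 * y - 935 * y ^ 2 - 8100 * y ^ 3 - 30000 * y ^ 4 - 40000 * y ^ 5) = - 40 * K * B ^ 4 - 935 * K ^ 2 * B ^ 3 - 8100 * K ^ 3 * B ^ 2 - 30000 * K ^ 4 * B - 40000 * K ^ 5"
    unfolding sigma_y_B[symmetric] by (simp add: compose_power_simps) algebra
qed

lemma U0_2_4: "U0 (\<sigma> (hq / (1 + hq) ^ 3) * (qa * qb ^ 2 * (qa * (qb * qb)))) = (10 + 380 * y + 4185 * y ^ 2 + 20300 * y ^ 3 + 46000 * y ^ 4 + 40000 * y ^ 5) / (1 + 5 * y) ^ 4"
proof (rule U0_value_3)
  have "grade0 (qa * qb * (qa * (qb * qb))) * (K * (1 - K ^ 2)) = 8 - 9 * K - 8 * K ^ 2 + 9 * K ^ 3 + 8 * K ^ 4"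
    using grade0_2_4(1) by (simp only: mult_ac)
  from U0_qq[OF this grade0_2_4(2,3)]
  show "D * (10 * B ^ 5 + 380 * K * B ^ 4 + 4185 * K ^ 2 * B ^ 3 + 20300 * K ^ 3 * B ^ 2 + 46000 * K ^ 4 * B + 40000 * K ^ 5) * 1 = C * (A * B * D * (K * C) * \<sigma> (U0 (qa * qb ^ 2 * (qa * (qb * qb)))))"
    unfolding A_def B_def C_def D_def by algebra
  show "B ^ 5 * \<sigma> (10 + 380 * y + 4185 * y ^ 2 + 20300 * y ^ 3 + 46000 * y ^ 4 + 40000 * y ^ 5) = 10 * B ^ 5 + 380 * K * B ^ 4 + 4185 * K ^ 2 * B ^ 3 + 20300 * K ^ 3 * B ^ 2 + 46000 * K ^ 4 * B + 40000 * K ^ 5"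
    unfolding sigma_y_B[symmetric] by (simp add: compose_power_simps) algebra
qed

lemma U0_1_5: "U0 (\<sigma> (hq / (1 + hq) ^ 3) * (qa * qb ^ 2 * (qb * (qb * qb)))) = (10 + 300 * y + 3165 * y ^ 2 + 16000 * y ^ 3 + 40000 * y ^ 4 + 40000 * y ^ 5) / (1 + 5 * y) ^ 4"
proof (rule U0_value_3)
  have "grade0 (qa * qb * (qb * (qb * qb))) * (K * (1 - K ^ 2)) = 6 - 3 * K + 4 * K ^ 2 + 3 * K ^ 3 + 6 * K ^ 4"
    using grade0_1_5(1) by (simp only: mult_ac)
  from U0_qq[OF this grade0_1_5(2,3)]
  show "D * (10 * B ^ 5 + 300 * K * B ^ 4 + 3165 * K ^ 2 * B ^ 3 + 16000 * K ^ 3 * B ^ 2 + 40000 * K ^ 4 * B + 40000 * K ^ 5) * 1 = C * (A * B * D * (K * C) * \<sigma> (U0 (qa * qb ^ 2 * (qb * (qb * qb)))))"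
    unfolding A_def B_def C_def D_def by algebra
  show "B ^ 5 * \<sigma> (10 + 300 * y + 3165 * y ^ 2 + 16000 * y ^ 3 + 40000 * y ^ 4 + 40000 * y ^ 5) = 10 * B ^ 5 + 300 * K * B ^ 4 + 3165 * K ^ 2 * B ^ 3 + 16000 * K ^ 3 * B ^ 2 + 40000 * K ^ 4 * B + 40000 * K ^ 5"
    unfolding sigma_y_B[symmetric] by (simp add: compose_power_simps) algebra
qed

text \<open>By \<open>v_qq\<close> and \<open>y_qq\<close>, (1 + 5 y) / y^k contains qa^(3k-5)
  qb^(5-k). Exactly for k = 2 and k = 3 the exponents are at least 1 and 2, as the denominators of
  \<open>F\<close> and \<open>Z\<close> require.\<close>

lemma v_y2: "\<sigma> (hq / (1 + hq) ^ 2) * (qa * qb ^ 2 * qb) = (1 + 5 * y) / y ^ 2"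
  and v_y3: "\<sigma> (hq / (1 + hq) ^ 3) * (qa * qb ^ 2 * (qa * (qa * qa))) = (1 + 5 * y) / y ^ 3"
proof -
  have nz: "1 + \<sigma> hq \<noteq> 0" using A_C by auto
  have *: "h / w ^ 2 * (qa * qb ^ 2 * qb) = f / g ^ 2 \<and> h / w ^ 3 * (qa * qb ^ 2 * (qa * (qa * qa))) = f / g ^ 3"
    if "f = (qb / qa) ^ 5 * h" "g = qb / qa ^ 3 * w" "w \<noteq> 0" for f g h w
    using that(3) unfolding that(1,2) by (simp add: field_simps eval_nat_numeral)
  have "\<sigma> (hq / (1 + hq) ^ n) = \<sigma> hq / (1 + \<sigma> hq) ^ n" for n
    by (simp add: compose_power_simps)
  with *[OF v_qq y_qq nz] show
    "\<sigma> (hq / (1 + hq) ^ 2) * (qa * qb ^ 2 * qb) = (1 + 5 * y) / y ^ 2"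
    "\<sigma> (hq / (1 + hq) ^ 3) * (qa * qb ^ 2 * (qa * (qa * qa))) = (1 + 5 * y) / y ^ 3"
    by (simp_all only:)
qed

text \<open>Trading a factor qa for qb multiplies by qb / qa = \<sigma> (1 + 5 y) (1 + 4 y) / y. The
  \<sigma> part leaves \<open>U0\<close> as a factor 1 + 5 y, which raises the exponent of the
  denominator.\<close>

lemma U0_quot_power:
  assumes "U0 (\<sigma> (hq / (1 + hq) ^ 3) * (qa * qb ^ 2 * g)) = f / (1 + 5 * y) ^ 4"
    "qa ^ k * g = qb ^ k * (qa * (qa * qa))"
  shows "U0 ((1 + 4 * y) ^ k * (1 + 5 * y) / y ^ (3 + k)) = f / (1 + 5 * y) ^ (4 + k)"
proof -
  have g: "g = (qb / qa) ^ k * (qa * (qa * qa))"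
    using assms(2) by (simp add: power_divide field_simps)
  have "(qb / qa) ^ k = \<sigma> ((1 + 5 * y) ^ k) * ((1 + 4 * y) / y) ^ k"
    by (subst quot_y) (simp add: power_divide power_mult_distrib fls_compose_power_power)
  hence "\<sigma> (hq / (1 + hq) ^ 3) * (qa * qb ^ 2 * g) =
      \<sigma> (hq / (1 + hq) ^ 3) * (qa * qb ^ 2 * (qa * (qa * qa))) * (\<sigma> ((1 + 5 * y) ^ k) * ((1 + 4 * y) / y) ^ k)"
    unfolding g by (simp add: mult_ac)
  also have "\<dots> = \<sigma> ((1 + 5 * y) ^ k) * ((1 + 4 * y) ^ k * (1 + 5 * y) / y ^ (3 + k))"
    unfolding v_y3 by (simp add: power_divide power_add field_simps)
  finally have "(1 + 5 * y) ^ k * U0 ((1 + 4 * y) ^ k * (1 + 5 * y) / y ^ (3 + k)) = f / (1 + 5 * y) ^ 4"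
    using assms(1) by (simp only: U0_mult)
  moreover have "x = f / v ^ (4 + k)" if "v ^ k * x = f / v ^ 4" "v \<noteq> 0" for x v
    using that by (simp add: field_simps power_add)
  ultimately show ?thesis by simp
qed

lemma U0_base:
  "U0 ((1 + 5 * y) / y ^ 2) = (1 + 39 * y + 240 * y ^ 2 + 400 * y ^ 3) / (1 + 5 * y) ^ 2"
  "U0 ((1 + 5 * y) / y ^ 3) = (- 5 - 205 * y - 2515 * y ^ 2 - 14100 * y ^ 3 - 38000 * y ^ 4 - 40000 * y ^ 5) / (1 + 5 * y) ^ 4"
  "U0 ((1 + 4 * y) * (1 + 5 * y) / y ^ 4) = (- 40 * y - 935 * y ^ 2 - 8100 * y ^ 3 - 30000 * y ^ 4 - 40000 * y ^ 5) / (1 + 5 * y) ^ 5"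
  "U0 ((1 + 4 * y) ^ 2 * (1 + 5 * y) / y ^ 5) = (10 + 380 * y + 4185 * y ^ 2 + 20300 * y ^ 3 + 46000 * y ^ 4 + 40000 * y ^ 5) / (1 + 5 * y) ^ 6"
  "U0 ((1 + 4 * y) ^ 3 * (1 + 5 * y) / y ^ 6) = (10 + 300 * y + 3165 * y ^ 2 + 16000 * y ^ 3 + 40000 * y ^ 4 + 40000 * y ^ 5) / (1 + 5 * y) ^ 7"
proof -
  show "U0 ((1 + 5 * y) / y ^ 2) = (1 + 39 * y + 240 * y ^ 2 + 400 * y ^ 3) / (1 + 5 * y) ^ 2"
    using U0_1_3 unfolding v_y2 .
  show "U0 ((1 + 5 * y) / y ^ 3) = (- 5 - 205 * y - 2515 * y ^ 2 - 14100 * y ^ 3 - 38000 * y ^ 4 - 40000 * y ^ 5) / (1 + 5 * y) ^ 4"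
    using U0_4_2 unfolding v_y3 .
  show "U0 ((1 + 4 * y) * (1 + 5 * y) / y ^ 4) = (- 40 * y - 935 * y ^ 2 - 8100 * y ^ 3 - 30000 * y ^ 4 - 40000 * y ^ 5) / (1 + 5 * y) ^ 5"
    using U0_quot_power[OF U0_3_3, of 1] by (simp add: mult_ac)
  show "U0 ((1 + 4 * y) ^ 2 * (1 + 5 * y) / y ^ 5) = (10 + 380 * y + 4185 * y ^ 2 + 20300 * y ^ 3 + 46000 * y ^ 4 + 40000 * y ^ 5) / (1 + 5 * y) ^ 6"
    using U0_quot_power[OF U0_2_4, of 2] by (simp add: mult_ac power2_eq_square)
  show "U0 ((1 + 4 * y) ^ 3 * (1 + 5 * y) / y ^ 6) = (10 + 300 * y + 3165 * y ^ 2 + 16000 * y ^ 3 + 40000 * y ^ 4 + 40000 * y ^ 5) / (1 + 5 * y) ^ 7"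
    using U0_quot_power[OF U0_1_5, of 3] by (simp add: mult_ac power3_eq_cube)
qed

end

section \<open>Recurrences for \<open>U0\<close> on monomials\<close>

text \<open>These facts leave the locale: r, s, qa and qb are eliminated, and only y
  remains.\<close>

lemma v_nz [simp]: "1 + 5 * y \<noteq> 0" and y_nz [simp]: "y \<noteq> 0"
  and y_degree_6: "(1 + 4 * \<sigma> y) * y ^ 5 * (1 + 5 * y) = \<sigma> y * \<sigma> (1 + 5 * y) ^ 5 * (1 + 4 * y) ^ 5"
  and y_cofactor: "\<sigma> (1 + 5 * y) + 5 * (1 + 4 * \<sigma> y) * y \<noteq> 0"
  and U0_base:
    "U0 ((1 + 5 * y) / y ^ 2) = (1 + 39 * y + 240 * y ^ 2 + 400 * y ^ 3) / (1 + 5 * y) ^ 2"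
    "U0 ((1 + 5 * y) / y ^ 3) = (- 5 - 205 * y - 2515 * y ^ 2 - 14100 * y ^ 3 - 38000 * y ^ 4 - 40000 * y ^ 5) / (1 + 5 * y) ^ 4"
    "U0 ((1 + 4 * y) * (1 + 5 * y) / y ^ 4) = (- 40 * y - 935 * y ^ 2 - 8100 * y ^ 3 - 30000 * y ^ 4 - 40000 * y ^ 5) / (1 + 5 * y) ^ 5"
    "U0 ((1 + 4 * y) ^ 2 * (1 + 5 * y) / y ^ 5) = (10 + 380 * y + 4185 * y ^ 2 + 20300 * y ^ 3 + 46000 * y ^ 4 + 40000 * y ^ 5) / (1 + 5 * y) ^ 6"
    "U0 ((1 + 4 * y) ^ 3 * (1 + 5 * y) / y ^ 6) = (10 + 300 * y + 3165 * y ^ 2 + 16000 * y ^ 3 + 40000 * y ^ 4 + 40000 * y ^ 5) / (1 + 5 * y) ^ 7"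
proof -
  obtain r s where "dissection r s"
    using rogers_ramanujan_dissection unfolding dissection_def by metis
  then interpret dissection r s .
  show "1 + 5 * y \<noteq> 0" "y \<noteq> 0" by (rule v_nz y_nz)+
  show "(1 + 4 * \<sigma> y) * y ^ 5 * (1 + 5 * y) = \<sigma> y * \<sigma> (1 + 5 * y) ^ 5 * (1 + 4 * y) ^ 5"
    by (rule modular_equation)
  have "y * (qb / qa + 1) = \<sigma> (1 + 5 * y) * (1 + 4 * y) + y"
    unfolding quot_y by (simp add: field_simps)
  also have "\<dots> = \<sigma> (1 + 5 * y) + 5 * (1 + 4 * \<sigma> y) * y"
    by (simp add: compose_power_numeral algebra_simps)
  finally show "\<sigma> (1 + 5 * y) + 5 * (1 + 4 * \<sigma> y) * y \<noteq> 0"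
    using quot_neq by (metis mult_eq_0_iff y_nz)
  show "U0 ((1 + 5 * y) / y ^ 2) = (1 + 39 * y + 240 * y ^ 2 + 400 * y ^ 3) / (1 + 5 * y) ^ 2"
    "U0 ((1 + 5 * y) / y ^ 3) = (- 5 - 205 * y - 2515 * y ^ 2 - 14100 * y ^ 3 - 38000 * y ^ 4 - 40000 * y ^ 5) / (1 + 5 * y) ^ 4"
    "U0 ((1 + 4 * y) * (1 + 5 * y) / y ^ 4) = (- 40 * y - 935 * y ^ 2 - 8100 * y ^ 3 - 30000 * y ^ 4 - 40000 * y ^ 5) / (1 + 5 * y) ^ 5"
    "U0 ((1 + 4 * y) ^ 2 * (1 + 5 * y) / y ^ 5) = (10 + 380 * y + 4185 * y ^ 2 + 20300 * y ^ 3 + 46000 * y ^ 4 + 40000 * y ^ 5) / (1 + 5 * y) ^ 6"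
    "U0 ((1 + 4 * y) ^ 3 * (1 + 5 * y) / y ^ 6) = (10 + 300 * y + 3165 * y ^ 2 + 16000 * y ^ 3 + 40000 * y ^ 4 + 40000 * y ^ 5) / (1 + 5 * y) ^ 7"
    by (rule U0_base)+
qed

text \<open>
  The relation \<open>y_degree_6\<close> has the spurious root \<open>qb / qa = -1\<close>, which is split off here.
\<close>

lemma y_degree_5: "y ^ 5 = ((\<sigma> y) + 20 * (\<sigma> y) ^ 2 + 150 * (\<sigma> y) ^ 3 + 500 * (\<sigma> y) ^ 4 + 625 * (\<sigma> y) ^ 5) * y ^ 0 + (15 * (\<sigma> y) + 305 * (\<sigma> y) ^ 2 + 2325 * (\<sigma> y) ^ 3 + 7875 * (\<sigma> y) ^ 4 + 10000 * (\<sigma> y) ^ 5) * y ^ 1 + (85 * (\<sigma> y) + 1750 * (\<sigma> y) ^ 2 + 13525 * (\<sigma> y) ^ 3 + 46500 * (\<sigma> y) ^ 4 + 60000 * (\<sigma> y) ^ 5) * y ^ 2 + (215 * (\<sigma> y) + 4475 * (\<sigma> y) ^ 2 + 35000 * (\<sigma> y) ^ 3 + 122000 * (\<sigma> y) ^ 4 + 160000 * (\<sigma> y) ^ 5) * y ^ 3 + (205 * (\<sigma> y) + 4300 * (\<sigma> y) ^ 2 + 34000 * (\<sigma> y) ^ 3 + 120000 * (\<sigma> y) ^ 4 + 160000 * (\<sigma> y) ^ 5) * y ^ 4"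
proof -
  have v: "\<sigma> (1 + 5 * y) = 1 + 5 * \<sigma> y" by (simp add: compose_power_numeral)
  have "(1 + 5 * w + 5 * (1 + 4 * w) * z) * (z ^ 5 - ((w + 20 * w ^ 2 + 150 * w ^ 3 + 500 * w ^ 4 + 625 * w ^ 5) * z ^ 0 + (15 * w + 305 * w ^ 2 + 2325 * w ^ 3 + 7875 * w ^ 4 + 10000 * w ^ 5) * z ^ 1 + (85 * w + 1750 * w ^ 2 + 13525 * w ^ 3 + 46500 * w ^ 4 + 60000 * w ^ 5) * z ^ 2 + (215 * w + 4475 * w ^ 2 + 35000 * w ^ 3 + 122000 * w ^ 4 + 160000 * w ^ 5) * z ^ 3 + (205 * w + 4300 * w ^ 2 + 34000 * w ^ 3 + 120000 * w ^ 4 + 160000 * w ^ 5) * z ^ 4)) =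
      (1 + 4 * w) * z ^ 5 * (1 + 5 * z) - w * (1 + 5 * w) ^ 5 * (1 + 4 * z) ^ 5" for w z :: "complex fls"
    by algebra
  from this[of "\<sigma> y" y] have "(\<sigma> (1 + 5 * y) + 5 * (1 + 4 * \<sigma> y) * y) * (y ^ 5 - (((\<sigma> y) + 20 * (\<sigma> y) ^ 2 + 150 * (\<sigma> y) ^ 3 + 500 * (\<sigma> y) ^ 4 + 625 * (\<sigma> y) ^ 5) * y ^ 0 + (15 * (\<sigma> y) + 305 * (\<sigma> y) ^ 2 + 2325 * (\<sigma> y) ^ 3 + 7875 * (\<sigma> y) ^ 4 + 10000 * (\<sigma> y) ^ 5) * y ^ 1 + (85 * (\<sigma> y) + 1750 * (\<sigma> y) ^ 2 + 13525 * (\<sigma> y) ^ 3 + 46500 * (\<sigma> y) ^ 4 + 60000 * (\<sigma> y) ^ 5) * y ^ 2 + (215 * (\<sigma> y) + 4475 * (\<sigma> y) ^ 2 + 35000 * (\<sigma> y) ^ 3 + 122000 * (\<sigma> y) ^ 4 + 160000 * (\<sigma> y) ^ 5) * y ^ 3 + (205 * (\<sigma> y) + 4300 * (\<sigma> y) ^ 2 + 34000 * (\<sigma> y) ^ 3 + 120000 * (\<sigma> y) ^ 4 + 160000 * (\<sigma> y) ^ 5) * y ^ 4)) = 0"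
    using y_degree_6 unfolding v by (simp only: diff_self)
  thus ?thesis using y_cofactor by (metis mult_eq_0_iff eq_iff_diff_eq_0)
qed

text \<open>With w = \<sigma> y, the monic degree 5 polynomial of y takes the value - (1 + 5 w)^5 /
  3125 at -1/5. Dividing it by 1 + 5 z with this remainder expresses (1 + 5 w)^5 / (1 + 5 y) as a
  polynomial of degree 4 in y.\<close>

lemma v_inverse: "\<sigma> (1 + 5 * y) ^ 5 = (1 + 5 * y) * ((1 - 3100 * (\<sigma> y) - 62250 * (\<sigma> y) ^ 2 - 467500 * (\<sigma> y) ^ 3 - 1559375 * (\<sigma> y) ^ 4 - 1950000 * (\<sigma> y) ^ 5) * y ^ 0 + (- 5 - 31375 * (\<sigma> y) - 641875 * (\<sigma> y) ^ 2 - 4928125 * (\<sigma> y) ^ 3 - 16812500 * (\<sigma> y) ^ 4 - 21500000 * (\<sigma> y) ^ 5) * y ^ 1 + (25 - 108750 * (\<sigma> y) - 2259375 * (\<sigma> y) ^ 2 - 17625000 * (\<sigma> y) ^ 3 - 61250000 * (\<sigma> y) ^ 4 - 80000000 * (\<sigma> y) ^ 5) * y ^ 2 + (- 125 - 128125 * (\<sigma> y) - 2687500 * (\<sigma> y) ^ 2 - 21250000 * (\<sigma> y) ^ 3 - 75000000 * (\<sigma> y) ^ 4 - 100000000 * (\<sigma> y) ^ 5) * y ^ 3 + (625) * y ^ 4)"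
proof -
  have v: "\<sigma> (1 + 5 * y) = 1 + 5 * \<sigma> y" by (simp add: compose_power_numeral)
  have "(1 + 5 * z) * ((1 - 3100 * w - 62250 * w ^ 2 - 467500 * w ^ 3 - 1559375 * w ^ 4 - 1950000 * w ^ 5) * z ^ 0 + (- 5 - 31375 * w - 641875 * w ^ 2 - 4928125 * w ^ 3 - 16812500 * w ^ 4 - 21500000 * w ^ 5) * z ^ 1 + (25 - 108750 * w - 2259375 * w ^ 2 - 17625000 * w ^ 3 - 61250000 * w ^ 4 - 80000000 * w ^ 5) * z ^ 2 + (- 125 - 128125 * w - 2687500 * w ^ 2 - 21250000 * w ^ 3 - 75000000 * w ^ 4 - 100000000 * w ^ 5) * z ^ 3 + (625) * z ^ 4) =
      (1 + 5 * w) ^ 5 + 3125 * (z ^ 5 - ((w + 20 * w ^ 2 + 150 * w ^ 3 + 500 * w ^ 4 + 625 * w ^ 5) * z ^ 0 + (15 * w + 305 * w ^ 2 + 2325 * w ^ 3 + 7875 * w ^ 4 + 10000 * w ^ 5) * z ^ 1 + (85 * w + 1750 * w ^ 2 + 13525 * w ^ 3 + 46500 * w ^ 4 + 60000 * w ^ 5) * z ^ 2 + (215 * w + 4475 * w ^ 2 + 35000 * w ^ 3 + 122000 * w ^ 4 + 160000 * w ^ 5) * z ^ 3 + (205 * w + 4300 * w ^ 2 + 34000 * w ^ 3 + 120000 * w ^ 4 + 160000 * w ^ 5) * z ^ 4))" for w z :: "complex fls"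
    by algebra
  from this[of y "\<sigma> y"] show ?thesis unfolding v y_degree_5[symmetric] by simp
qed

lemma v_mult: "x = f / (1 + 5 * y) ^ k \<Longrightarrow> (1 + 5 * y) ^ k * x = f"
  by simp

lemma v_cancel: "(1 + 5 * y) ^ k * f = (1 + 5 * y) ^ k * g \<Longrightarrow> f = g"
  by simp

lemma v_cancel_5: "5 * (1 + 5 * y) ^ k * f = 5 * (1 + 5 * y) ^ k * g \<Longrightarrow> f = g"
proof -
  assume *: "5 * (1 + 5 * y) ^ k * f = 5 * (1 + 5 * y) ^ k * g"
  have "5 * (1 + 5 * y) ^ k \<noteq> 0" by simp
  with * show "f = g" by (metis mult_left_cancel)
qed

definition Uvy :: "int \<Rightarrow> int \<Rightarrow> complex fls" where
  "Uvy n m = U0 ((1 + 5 * y) powi (- n) * y powi m)"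

lemma Uvy_rec: "Uvy n (m + 5) = (y + 20 * y ^ 2 + 150 * y ^ 3 + 500 * y ^ 4 + 625 * y ^ 5) * Uvy n (m + 0) + (15 * y + 305 * y ^ 2 + 2325 * y ^ 3 + 7875 * y ^ 4 + 10000 * y ^ 5) * Uvy n (m + 1) + (85 * y + 1750 * y ^ 2 + 13525 * y ^ 3 + 46500 * y ^ 4 + 60000 * y ^ 5) * Uvy n (m + 2) + (215 * y + 4475 * y ^ 2 + 35000 * y ^ 3 + 122000 * y ^ 4 + 160000 * y ^ 5) * Uvy n (m + 3) + (205 * y + 4300 * y ^ 2 + 34000 * y ^ 3 + 120000 * y ^ 4 + 160000 * y ^ 5) * Uvy n (m + 4)"
proof -
  have "y powi (m + 5) = y powi m * y ^ 5" by (simp add: power_int_add)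
  hence "(1 + 5 * y) powi (- n) * y powi (m + 5) = (1 + 5 * y) powi (- n) * y powi m * y ^ 5" by simp
  also have "\<dots> = (1 + 5 * y) powi (- n) * y powi m * (((\<sigma> y) + 20 * (\<sigma> y) ^ 2 + 150 * (\<sigma> y) ^ 3 + 500 * (\<sigma> y) ^ 4 + 625 * (\<sigma> y) ^ 5) * y ^ 0 + (15 * (\<sigma> y) + 305 * (\<sigma> y) ^ 2 + 2325 * (\<sigma> y) ^ 3 + 7875 * (\<sigma> y) ^ 4 + 10000 * (\<sigma> y) ^ 5) * y ^ 1 + (85 * (\<sigma> y) + 1750 * (\<sigma> y) ^ 2 + 13525 * (\<sigma> y) ^ 3 + 46500 * (\<sigma> y) ^ 4 + 60000 * (\<sigma> y) ^ 5) * y ^ 2 + (215 * (\<sigma> y) + 4475 * (\<sigma> y) ^ 2 + 35000 * (\<sigma> y) ^ 3 + 122000 * (\<sigma> y) ^ 4 + 160000 * (\<sigma> y) ^ 5) * y ^ 3 + (205 * (\<sigma> y) + 4300 * (\<sigma> y) ^ 2 + 34000 * (\<sigma> y) ^ 3 + 120000 * (\<sigma> y) ^ 4 + 160000 * (\<sigma> y) ^ 5) * y ^ 4)"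
    by (rule arg_cong[OF y_degree_5])
  also have "\<dots> = \<sigma> (y + 20 * y ^ 2 + 150 * y ^ 3 + 500 * y ^ 4 + 625 * y ^ 5) * ((1 + 5 * y) powi (- n) * y powi (m + 0)) + \<sigma> (15 * y + 305 * y ^ 2 + 2325 * y ^ 3 + 7875 * y ^ 4 + 10000 * y ^ 5) * ((1 + 5 * y) powi (- n) * y powi (m + 1)) + \<sigma> (85 * y + 1750 * y ^ 2 + 13525 * y ^ 3 + 46500 * y ^ 4 + 60000 * y ^ 5) * ((1 + 5 * y) powi (- n) * y powi (m + 2)) + \<sigma> (215 * y + 4475 * y ^ 2 + 35000 * y ^ 3 + 122000 * y ^ 4 + 160000 * y ^ 5) * ((1 + 5 * y) powi (- n) * y powi (m + 3)) + \<sigma> (205 * y + 4300 * y ^ 2 + 34000 * y ^ 3 + 120000 * y ^ 4 + 160000 * y ^ 5) * ((1 + 5 * y) powi (- n) * y powi (m + 4))"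
    by (simp add: compose_power_simps power_int_add algebra_simps)
  finally show ?thesis unfolding Uvy_def by (simp only: U0_add U0_mult)
qed

lemma Uvy_v: "(1 + 5 * y) ^ 5 * Uvy (n + 1) m = (1 - 3100 * y - 62250 * y ^ 2 - 467500 * y ^ 3 - 1559375 * y ^ 4 - 1950000 * y ^ 5) * Uvy n (m + 0) + (- 5 - 31375 * y - 641875 * y ^ 2 - 4928125 * y ^ 3 - 16812500 * y ^ 4 - 21500000 * y ^ 5) * Uvy n (m + 1) + (25 - 108750 * y - 2259375 * y ^ 2 - 17625000 * y ^ 3 - 61250000 * y ^ 4 - 80000000 * y ^ 5) * Uvy n (m + 2) + (- 125 - 128125 * y - 2687500 * y ^ 2 - 21250000 * y ^ 3 - 75000000 * y ^ 4 - 100000000 * y ^ 5) * Uvy n (m + 3) + (625) * Uvy n (m + 4)"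
proof -
  have "(1 + 5 * y) powi (- n) = (1 + 5 * y) powi (- (n + 1)) * (1 + 5 * y)"
    using power_int_add_1[of "1 + 5 * y" "- (n + 1)"] by simp
  hence "\<sigma> ((1 + 5 * y) ^ 5) * ((1 + 5 * y) powi (- (n + 1)) * y powi m) = (1 + 5 * y) powi (- n) * y powi m * ((1 - 3100 * (\<sigma> y) - 62250 * (\<sigma> y) ^ 2 - 467500 * (\<sigma> y) ^ 3 - 1559375 * (\<sigma> y) ^ 4 - 1950000 * (\<sigma> y) ^ 5) * y ^ 0 + (- 5 - 31375 * (\<sigma> y) - 641875 * (\<sigma> y) ^ 2 - 4928125 * (\<sigma> y) ^ 3 - 16812500 * (\<sigma> y) ^ 4 - 21500000 * (\<sigma> y) ^ 5) * y ^ 1 + (25 - 108750 * (\<sigma> y) - 2259375 * (\<sigma> y) ^ 2 - 17625000 * (\<sigma> y) ^ 3 - 61250000 * (\<sigma> y) ^ 4 - 80000000 * (\<sigma> y) ^ 5) * y ^ 2 + (- 125 - 128125 * (\<sigma> y) - 2687500 * (\<sigma> y) ^ 2 - 21250000 * (\<sigma> y) ^ 3 - 75000000 * (\<sigma> y) ^ 4 - 100000000 * (\<sigma> y) ^ 5) * y ^ 3 + (625) * y ^ 4)"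
    using v_inverse by (simp only: fls_compose_power_power zero_less_numeral simp_thms mult_ac)
  also have "\<dots> = \<sigma> (1 - 3100 * y - 62250 * y ^ 2 - 467500 * y ^ 3 - 1559375 * y ^ 4 - 1950000 * y ^ 5) * ((1 + 5 * y) powi (- n) * y powi (m + 0)) + \<sigma> (- 5 - 31375 * y - 641875 * y ^ 2 - 4928125 * y ^ 3 - 16812500 * y ^ 4 - 21500000 * y ^ 5) * ((1 + 5 * y) powi (- n) * y powi (m + 1)) + \<sigma> (25 - 108750 * y - 2259375 * y ^ 2 - 17625000 * y ^ 3 - 61250000 * y ^ 4 - 80000000 * y ^ 5) * ((1 + 5 * y) powi (- n) * y powi (m + 2)) + \<sigma> (- 125 - 128125 * y - 2687500 * y ^ 2 - 21250000 * y ^ 3 - 75000000 * y ^ 4 - 100000000 * y ^ 5) * ((1 + 5 * y) powi (- n) * y powi (m + 3)) + \<sigma> (625) * ((1 + 5 * y) powi (- n) * y powi (m + 4))"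
    by (simp add: compose_power_simps power_int_add algebra_simps)
  finally have "U0 (\<sigma> ((1 + 5 * y) ^ 5) * ((1 + 5 * y) powi (- (n + 1)) * y powi m)) = U0 (\<dots>)" by (rule arg_cong)
  thus ?thesis unfolding Uvy_def by (simp only: U0_add U0_mult)
qed

text \<open>Solved for \<open>Uvy n (m + 1)\<close>, this raises m at the price of a division by 5,
  and so spreads a single value at n to larger m.\<close>

lemma Uvy_diff: "Uvy (n - 1) m = Uvy n m + 5 * Uvy n (m + 1)"
proof -
  have "(1 + 5 * y) powi (- (n - 1)) = (1 + 5 * y) powi (- n) * (1 + 5 * y)"
    using power_int_add_1[of "1 + 5 * y" "- n"] by simp
  hence "(1 + 5 * y) powi (- (n - 1)) * y powi m = (1 + 5 * y) powi (- n) * y powi m + \<sigma> 5 * ((1 + 5 * y) powi (- n) * y powi (m + 1))"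
    by (simp add: power_int_add compose_power_numeral algebra_simps)
  thus ?thesis unfolding Uvy_def by (simp only: U0_add U0_mult)
qed

section \<open>Values for n = -1, 0, 1 (\<open>m\<close> before a digit means minus)\<close>

lemma Uvy_m1_m2: "(1 + 5 * y) ^ 2 * Uvy (- 1) (- 2) = 1 + 39 * y + 240 * y ^ 2 + 400 * y ^ 3"
  by (rule v_mult) (use U0_base(1) in \<open>simp add: Uvy_def power_int_minus divide_inverse\<close>)

lemma Uvy_m1_m3: "(1 + 5 * y) ^ 4 * Uvy (- 1) (- 3) = - 5 - 205 * y - 2515 * y ^ 2 - 14100 * y ^ 3 - 38000 * y ^ 4 - 40000 * y ^ 5"
  by (rule v_mult) (use U0_base(2) in \<open>simp add: Uvy_def power_int_minus divide_inverse\<close>)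

text \<open>Expanding (1 + 4 y)^k in the base values leaves one new power of y at a time. The
  constants 4, 8, 16, ... come from that expansion and are written under \<sigma> so that
  \<open>U0_mult\<close> applies.\<close>

lemma Uvy_m1_m4: "(1 + 5 * y) ^ 5 * Uvy (- 1) (- 4) = 20 + 880 * y + 13225 * y ^ 2 + 98600 * y ^ 3 + 404000 * y ^ 4 + 880000 * y ^ 5 + 800000 * y ^ 6"
proof -
  have "(1 + 4 * y) ^ 1 * (1 + 5 * y) / y ^ 4 = (1 + 5 * y) powi (- (- 1)) * y powi (- 4) + \<sigma> 4 * ((1 + 5 * y) powi (- (- 1)) * y powi (- 3))"
    by (simp add: compose_power_numeral power_int_minus field_simps eval_nat_numeral)
  hence "U0 ((1 + 4 * y) ^ 1 * (1 + 5 * y) / y ^ 4) = Uvy (- 1) (- 4) + 4 * Uvy (- 1) (- 3)"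
    unfolding Uvy_def by (simp only: U0_add U0_mult)
  hence "(1 + 5 * y) ^ 5 * (Uvy (- 1) (- 4) + 4 * Uvy (- 1) (- 3)) = - 40 * y - 935 * y ^ 2 - 8100 * y ^ 3 - 30000 * y ^ 4 - 40000 * y ^ 5"
    by (intro v_mult) (use U0_base(3) in \<open>simp only: power_one_right\<close>)
  note eq = this
  have "(1 + 5 * y) ^ 5 * Uvy (- 1) (- 4) = (1 + 5 * y) ^ 5 * (Uvy (- 1) (- 4) + 4 * Uvy (- 1) (- 3)) - 4 * ((1 + 5 * y) ^ 1 * ((1 + 5 * y) ^ 4 * Uvy (- 1) (- 3)))"
    by algebra
  also have "\<dots> = 20 + 880 * y + 13225 * y ^ 2 + 98600 * y ^ 3 + 404000 * y ^ 4 + 880000 * y ^ 5 + 800000 * y ^ 6"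
    unfolding eq Uvy_m1_m3 by algebra
  finally show ?thesis .
qed

lemma Uvy_m1_m5: "(1 + 5 * y) ^ 6 * Uvy (- 1) (- 5) = - 70 - 3380 * y - 61775 * y ^ 2 - 587500 * y ^ 3 - 3260000 * y ^ 4 - 10800000 * y ^ 5 - 20000000 * y ^ 6 - 16000000 * y ^ 7"
proof -
  have "(1 + 4 * y) ^ 2 * (1 + 5 * y) / y ^ 5 = (1 + 5 * y) powi (- (- 1)) * y powi (- 5) + \<sigma> 8 * ((1 + 5 * y) powi (- (- 1)) * y powi (- 4)) + \<sigma> 16 * ((1 + 5 * y) powi (- (- 1)) * y powi (- 3))"
    by (simp add: compose_power_numeral power_int_minus field_simps eval_nat_numeral)
  hence "U0 ((1 + 4 * y) ^ 2 * (1 + 5 * y) / y ^ 5) = Uvy (- 1) (- 5) + 8 * Uvy (- 1) (- 4) + 16 * Uvy (- 1) (- 3)"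
    unfolding Uvy_def by (simp only: U0_add U0_mult)
  hence "(1 + 5 * y) ^ 6 * (Uvy (- 1) (- 5) + 8 * Uvy (- 1) (- 4) + 16 * Uvy (- 1) (- 3)) = 10 + 380 * y + 4185 * y ^ 2 + 20300 * y ^ 3 + 46000 * y ^ 4 + 40000 * y ^ 5"
    by (intro v_mult) (use U0_base(4) in \<open>simp only: power_one_right\<close>)
  note eq = this
  have "(1 + 5 * y) ^ 6 * Uvy (- 1) (- 5) = (1 + 5 * y) ^ 6 * (Uvy (- 1) (- 5) + 8 * Uvy (- 1) (- 4) + 16 * Uvy (- 1) (- 3)) - 8 * ((1 + 5 * y) ^ 1 * ((1 + 5 * y) ^ 5 * Uvy (- 1) (- 4))) - 16 * ((1 + 5 * y) ^ 2 * ((1 + 5 * y) ^ 4 * Uvy (- 1) (- 3)))"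
    by algebra
  also have "\<dots> = - 70 - 3380 * y - 61775 * y ^ 2 - 587500 * y ^ 3 - 3260000 * y ^ 4 - 10800000 * y ^ 5 - 20000000 * y ^ 6 - 16000000 * y ^ 7"
    unfolding eq Uvy_m1_m4 Uvy_m1_m3 by algebra
  finally show ?thesis .
qed

lemma Uvy_m1_m6: "(1 + 5 * y) ^ 7 * Uvy (- 1) (- 6) = 210 + 11140 * y + 247825 * y ^ 2 + 2976500 * y ^ 3 + 21500000 * y ^ 4 + 97600000 * y ^ 5 + 276000000 * y ^ 6 + 448000000 * y ^ 7 + 320000000 * y ^ 8"
proof -
  have "(1 + 4 * y) ^ 3 * (1 + 5 * y) / y ^ 6 = (1 + 5 * y) powi (- (- 1)) * y powi (- 6) + \<sigma> 12 * ((1 + 5 * y) powi (- (- 1)) * y powi (- 5)) + \<sigma> 48 * ((1 + 5 * y) powi (- (- 1)) * y powi (- 4)) + \<sigma> 64 * ((1 + 5 * y) powi (- (- 1)) * y powi (- 3))"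
    by (simp add: compose_power_numeral power_int_minus field_simps eval_nat_numeral)
  hence "U0 ((1 + 4 * y) ^ 3 * (1 + 5 * y) / y ^ 6) = Uvy (- 1) (- 6) + 12 * Uvy (- 1) (- 5) + 48 * Uvy (- 1) (- 4) + 64 * Uvy (- 1) (- 3)"
    unfolding Uvy_def by (simp only: U0_add U0_mult)
  hence "(1 + 5 * y) ^ 7 * (Uvy (- 1) (- 6) + 12 * Uvy (- 1) (- 5) + 48 * Uvy (- 1) (- 4) + 64 * Uvy (- 1) (- 3)) = 10 + 300 * y + 3165 * y ^ 2 + 16000 * y ^ 3 + 40000 * y ^ 4 + 40000 * y ^ 5"
    by (intro v_mult) (use U0_base(5) in \<open>simp only: power_one_right\<close>)
  note eq = this
  have "(1 + 5 * y) ^ 7 * Uvy (- 1) (- 6) = (1 + 5 * y) ^ 7 * (Uvy (- 1) (- 6) + 12 * Uvy (- 1) (- 5) + 48 * Uvy (- 1) (- 4) + 64 * Uvy (- 1) (- 3)) - 12 * ((1 + 5 * y) ^ 1 * ((1 + 5 * y) ^ 6 * Uvy (- 1) (- 5))) - 48 * ((1 + 5 * y) ^ 2 * ((1 + 5 * y) ^ 5 * Uvy (- 1) (- 4))) - 64 * ((1 + 5 * y) ^ 3 * ((1 + 5 * y) ^ 4 * Uvy (- 1) (- 3)))"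
    by algebra
  also have "\<dots> = 210 + 11140 * y + 247825 * y ^ 2 + 2976500 * y ^ 3 + 21500000 * y ^ 4 + 97600000 * y ^ 5 + 276000000 * y ^ 6 + 448000000 * y ^ 7 + 320000000 * y ^ 8"
    unfolding eq Uvy_m1_m5 Uvy_m1_m4 Uvy_m1_m3 by algebra
  finally show ?thesis .
qed

text \<open>Five consecutive values are now known, so the degree 5 recurrence applies at m = -6. The
  common denominator (1 + 5 y)^7 reduces to a square.\<close>

lemma Uvy_m1_m1: "(1 + 5 * y) ^ 2 * Uvy (- 1) (- 1) = - 10 * y - 65 * y ^ 2 - 100 * y ^ 3"
proof -
  have "(1 + 5 * y) ^ 5 * ((1 + 5 * y) ^ 2 * Uvy (- 1) (- 1)) = (1 + 5 * y) ^ 7 * ((1 + 5 * y) ^ 0 * Uvy (- 1) (- 1))"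
    by algebra
  also have "\<dots> = (y + 20 * y ^ 2 + 150 * y ^ 3 + 500 * y ^ 4 + 625 * y ^ 5) * ((1 + 5 * y) ^ 0 * ((1 + 5 * y) ^ 7 * Uvy (- 1) (- 6))) + (15 * y + 305 * y ^ 2 + 2325 * y ^ 3 + 7875 * y ^ 4 + 10000 * y ^ 5) * ((1 + 5 * y) ^ 1 * ((1 + 5 * y) ^ 6 * Uvy (- 1) (- 5))) + (85 * y + 1750 * y ^ 2 + 13525 * y ^ 3 + 46500 * y ^ 4 + 60000 * y ^ 5) * ((1 + 5 * y) ^ 2 * ((1 + 5 * y) ^ 5 * Uvy (- 1) (- 4))) + (215 * y + 4475 * y ^ 2 + 35000 * y ^ 3 + 122000 * y ^ 4 + 160000 * y ^ 5) * ((1 + 5 * y) ^ 3 * ((1 + 5 * y) ^ 4 * Uvy (- 1) (- 3))) + (205 * y + 4300 * y ^ 2 + 34000 * y ^ 3 + 120000 * y ^ 4 + 160000 * y ^ 5) * ((1 + 5 * y) ^ 5 * ((1 + 5 * y) ^ 2 * Uvy (- 1) (- 2)))"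
    unfolding Uvy_rec[of "- 1" "- 6", simplified] by algebra
  also have "\<dots> = (1 + 5 * y) ^ 5 * (- 10 * y - 65 * y ^ 2 - 100 * y ^ 3)"
    unfolding Uvy_m1_m6 Uvy_m1_m5 Uvy_m1_m4 Uvy_m1_m3 Uvy_m1_m2 by algebra
  finally show ?thesis by (rule v_cancel)
qed

lemma Uvy_m1_0: "(1 + 5 * y) ^ 1 * Uvy (- 1) 0 = 20 * y + 205 * y ^ 2 + 500 * y ^ 3"
proof -
  have "(1 + 5 * y) ^ 5 * ((1 + 5 * y) ^ 1 * Uvy (- 1) 0) = (1 + 5 * y) ^ 6 * ((1 + 5 * y) ^ 0 * Uvy (- 1) 0)"
    by algebra
  also have "\<dots> = (y + 20 * y ^ 2 + 150 * y ^ 3 + 500 * y ^ 4 + 625 * y ^ 5) * ((1 + 5 * y) ^ 0 * ((1 + 5 * y) ^ 6 * Uvy (- 1) (- 5))) + (15 * y + 305 * y ^ 2 + 2325 * y ^ 3 + 7875 * y ^ 4 + 10000 * y ^ 5) * ((1 + 5 * y) ^ 1 * ((1 + 5 * y) ^ 5 * Uvy (- 1) (- 4))) + (85 * y + 1750 * y ^ 2 + 13525 * y ^ 3 + 46500 * y ^ 4 + 60000 * y ^ 5) * ((1 + 5 * y) ^ 2 * ((1 + 5 * y) ^ 4 * Uvy (- 1) (- 3))) + (215 * y + 4475 * y ^ 2 + 35000 * y ^ 3 + 122000 * y ^ 4 + 160000 * y ^ 5) * ((1 + 5 * y) ^ 4 * ((1 + 5 * y) ^ 2 * Uvy (- 1)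 (- 2))) + (205 * y + 4300 * y ^ 2 + 34000 * y ^ 3 + 120000 * y ^ 4 + 160000 * y ^ 5) * ((1 + 5 * y) ^ 4 * ((1 + 5 * y) ^ 2 * Uvy (- 1) (- 1)))"
    unfolding Uvy_rec[of "- 1" "- 5", simplified] by algebra
  also have "\<dots> = (1 + 5 * y) ^ 5 * (20 * y + 205 * y ^ 2 + 500 * y ^ 3)"
    unfolding Uvy_m1_m5 Uvy_m1_m4 Uvy_m1_m3 Uvy_m1_m2 Uvy_m1_m1 by algebra
  finally show ?thesis by (rule v_cancel)
qed

text \<open>\<open>Uvy_v\<close> consumes the values m = -4, ..., 0 at n = -1. This one value at n =
  0 suffices, since \<open>Uvy_diff\<close> yields the next ones.\<close>

lemma Uvy_0_m4: "(1 + 5 * y) ^ 5 * Uvy 0 (- 4) = 70 + 1505 * y + 5300 * y ^ 2 - 82400 * y ^ 3 - 816000 * y ^ 4 - 2720000 * y ^ 5 - 3200000 * y ^ 6"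
proof -
  have "(1 + 5 * y) ^ 5 * ((1 + 5 * y) ^ 5 * Uvy 0 (- 4)) = (1 - 3100 * y - 62250 * y ^ 2 - 467500 * y ^ 3 - 1559375 * y ^ 4 - 1950000 * y ^ 5) * ((1 + 5 * y) ^ 0 * ((1 + 5 * y) ^ 5 * Uvy (- 1) (- 4))) + (- 5 - 31375 * y - 641875 * y ^ 2 - 4928125 * y ^ 3 - 16812500 * y ^ 4 - 21500000 * y ^ 5) * ((1 + 5 * y) ^ 1 * ((1 + 5 * y) ^ 4 * Uvy (- 1) (- 3))) + (25 - 108750 * y - 2259375 * y ^ 2 - 17625000 * y ^ 3 - 61250000 * y ^ 4 - 80000000 * y ^ 5) * ((1 + 5 * y) ^ 3 * ((1 + 5 * y) ^ 2 * Uvy (- 1) (- 2))) + (- 125 - 128125 * y - 2687500 * y ^ 2 - 21250000 * y ^ 3 - 75000000 * y ^ 4 - 100000000 * y ^ 5) * ((1 + 5 * y) ^ 3 * ((1 + 5 * y) ^ 2 * Uvy (- 1) (- 1))) + (625) * ((1 + 5 * y) ^ 4 * ((1 + 5 * y) ^ 1 * Uvy (- 1) 0))"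
    unfolding Uvy_v[of "- 1" "- 4", simplified] by algebra
  also have "\<dots> = (1 + 5 * y) ^ 5 * (70 + 1505 * y + 5300 * y ^ 2 - 82400 * y ^ 3 - 816000 * y ^ 4 - 2720000 * y ^ 5 - 3200000 * y ^ 6)"
    unfolding Uvy_m1_m4 Uvy_m1_m3 Uvy_m1_m2 Uvy_m1_m1 Uvy_m1_0 by algebra
  finally show ?thesis by (rule v_cancel)
qed

lemma Uvy_0_m3: "(1 + 5 * y) ^ 4 * Uvy 0 (- 3) = - 10 - 75 * y + 1960 * y ^ 2 + 26400 * y ^ 3 + 112000 * y ^ 4 + 160000 * y ^ 5"
proof -
  have "5 * (1 + 5 * y) ^ 1 * ((1 + 5 * y) ^ 4 * Uvy 0 (- 3)) =
      (1 + 5 * y) ^ 0 * ((1 + 5 * y) ^ 5 * Uvy (- 1) (- 4)) - (1 + 5 * y) ^ 0 * ((1 + 5 * y) ^ 5 * Uvy 0 (- 4))"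
    using Uvy_diff[of 0 "- 4", simplified] by algebra
  also have "\<dots> = 5 * (1 + 5 * y) ^ 1 * (- 10 - 75 * y + 1960 * y ^ 2 + 26400 * y ^ 3 + 112000 * y ^ 4 + 160000 * y ^ 5)"
    unfolding Uvy_m1_m4 Uvy_0_m4 by algebra
  finally show ?thesis by (rule v_cancel_5)
qed

lemma Uvy_0_m2: "(1 + 5 * y) ^ 2 * Uvy 0 (- 2) = 1 - 36 * y - 560 * y ^ 2 - 1600 * y ^ 3"
proof -
  have "5 * (1 + 5 * y) ^ 2 * ((1 + 5 * y) ^ 2 * Uvy 0 (- 2)) =
      (1 + 5 * y) ^ 0 * ((1 + 5 * y) ^ 4 * Uvy (- 1) (- 3)) - (1 + 5 * y) ^ 0 * ((1 + 5 * y) ^ 4 * Uvy 0 (- 3))"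
    using Uvy_diff[of 0 "- 3", simplified] by algebra
  also have "\<dots> = 5 * (1 + 5 * y) ^ 2 * (1 - 36 * y - 560 * y ^ 2 - 1600 * y ^ 3)"
    unfolding Uvy_m1_m3 Uvy_0_m3 by algebra
  finally show ?thesis by (rule v_cancel_5)
qed

lemma Uvy_0_m1: "(1 + 5 * y) ^ 2 * Uvy 0 (- 1) = 15 * y + 160 * y ^ 2 + 400 * y ^ 3"
proof -
  have "5 * (1 + 5 * y) ^ 0 * ((1 + 5 * y) ^ 2 * Uvy 0 (- 1)) =
      (1 + 5 * y) ^ 0 * ((1 + 5 * y) ^ 2 * Uvy (- 1) (- 2)) - (1 + 5 * y) ^ 0 * ((1 + 5 * y) ^ 2 * Uvy 0 (- 2))"
    using Uvy_diff[of 0 "- 2", simplified] by algebra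
  also have "\<dots> = 5 * (1 + 5 * y) ^ 0 * (15 * y + 160 * y ^ 2 + 400 * y ^ 3)"
    unfolding Uvy_m1_m2 Uvy_0_m2 by algebra
  finally show ?thesis by (rule v_cancel_5)
qed

lemma Uvy_0_0: "(1 + 5 * y) ^ 2 * Uvy 0 0 = - 5 * y - 45 * y ^ 2 - 100 * y ^ 3"
proof -
  have "5 * (1 + 5 * y) ^ 0 * ((1 + 5 * y) ^ 2 * Uvy 0 0) =
      (1 + 5 * y) ^ 0 * ((1 + 5 * y) ^ 2 * Uvy (- 1) (- 1)) - (1 + 5 * y) ^ 0 * ((1 + 5 * y) ^ 2 * Uvy 0 (- 1))"
    using Uvy_diff[of 0 "- 1", simplified] by algebra
  also have "\<dots> = 5 * (1 + 5 * y) ^ 0 * (- 5 * y - 45 * y ^ 2 - 100 * y ^ 3)"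
    unfolding Uvy_m1_m1 Uvy_0_m1 by algebra
  finally show ?thesis by (rule v_cancel_5)
qed

lemma Uvy_0_1: "(1 + 5 * y) ^ 0 * Uvy 0 1 = 5 * y + 20 * y ^ 2"
proof -
  have "5 * (1 + 5 * y) ^ 2 * ((1 + 5 * y) ^ 0 * Uvy 0 1) =
      (1 + 5 * y) ^ 1 * ((1 + 5 * y) ^ 1 * Uvy (- 1) 0) - (1 + 5 * y) ^ 0 * ((1 + 5 * y) ^ 2 * Uvy 0 0)"
    using Uvy_diff[of 0 0, simplified] by algebra
  also have "\<dots> = 5 * (1 + 5 * y) ^ 2 * (5 * y + 20 * y ^ 2)"
    unfolding Uvy_m1_0 Uvy_0_0 by algebra
  finally show ?thesis by (rule v_cancel_5)
qed

lemma Uvy_1_m3: "(1 + 5 * y) ^ 4 * Uvy 1 (- 3) = - 15 + 4180 * y + 38560 * y ^ 2 + 54400 * y ^ 3 - 288000 * y ^ 4 - 640000 * y ^ 5"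
proof -
  have "(1 + 5 * y) ^ 5 * ((1 + 5 * y) ^ 4 * Uvy 1 (- 3)) = (1 + 5 * y) ^ 4 * ((1 + 5 * y) ^ 5 * Uvy 1 (- 3))"
    by algebra
  also have "\<dots> = (1 - 3100 * y - 62250 * y ^ 2 - 467500 * y ^ 3 - 1559375 * y ^ 4 - 1950000 * y ^ 5) * ((1 + 5 * y) ^ 0 * ((1 + 5 * y) ^ 4 * Uvy 0 (- 3))) + (- 5 - 31375 * y - 641875 * y ^ 2 - 4928125 * y ^ 3 - 16812500 * y ^ 4 - 21500000 * y ^ 5) * ((1 + 5 * y) ^ 2 * ((1 + 5 * y) ^ 2 * Uvy 0 (- 2))) + (25 - 108750 * y - 2259375 * y ^ 2 - 17625000 * y ^ 3 - 61250000 * y ^ 4 - 80000000 * y ^ 5) * ((1 + 5 * y) ^ 2 * ((1 + 5 * y) ^ 2 * Uvy 0 (- 1))) + (- 125 - 128125 * y - 2687500 * y ^ 2 - 21250000 * y ^ 3 - 75000000 * y ^ 4 - 100000000 * y ^ 5) * ((1 + 5 * y) ^ 2 * ((1 + 5 * y) ^ 2 * Uvy 0 0)) + (625) * ((1 + 5 * y) ^ 4 * ((1 + 5 * y) ^ 0 * Uvy 0 1))"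
    unfolding Uvy_v[of 0 "- 3", simplified] by algebra
  also have "\<dots> = (1 + 5 * y) ^ 5 * (- 15 + 4180 * y + 38560 * y ^ 2 + 54400 * y ^ 3 - 288000 * y ^ 4 - 640000 * y ^ 5)"
    unfolding Uvy_0_m3 Uvy_0_m2 Uvy_0_m1 Uvy_0_0 Uvy_0_1 by algebra
  finally show ?thesis by (rule v_cancel)
qed

lemma Uvy_1_m2: "(1 + 5 * y) ^ 3 * Uvy 1 (- 2) = 1 - 856 * y - 3040 * y ^ 2 + 9600 * y ^ 3 + 32000 * y ^ 4"
proof -
  have "5 * (1 + 5 * y) ^ 1 * ((1 + 5 * y) ^ 3 * Uvy 1 (- 2)) =
      (1 + 5 * y) ^ 0 * ((1 + 5 * y) ^ 4 * Uvy 0 (- 3)) - (1 + 5 * y) ^ 0 * ((1 + 5 * y) ^ 4 * Uvy 1 (- 3))"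
    using Uvy_diff[of 1 "- 3", simplified] by algebra
  also have "\<dots> = 5 * (1 + 5 * y) ^ 1 * (1 - 856 * y - 3040 * y ^ 2 + 9600 * y ^ 3 + 32000 * y ^ 4)"
    unfolding Uvy_0_m3 Uvy_1_m3 by algebra
  finally show ?thesis by (rule v_cancel_5)
qed

lemma Uvy_1_m1: "(1 + 5 * y) ^ 3 * Uvy 1 (- 1) = 165 * y + 460 * y ^ 2 - 2800 * y ^ 3 - 8000 * y ^ 4"
proof -
  have "5 * (1 + 5 * y) ^ 0 * ((1 + 5 * y) ^ 3 * Uvy 1 (- 1)) =
      (1 + 5 * y) ^ 1 * ((1 + 5 * y) ^ 2 * Uvy 0 (- 2)) - (1 + 5 * y) ^ 0 * ((1 + 5 * y) ^ 3 * Uvy 1 (- 2))"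
    using Uvy_diff[of 1 "- 2", simplified] by algebra
  also have "\<dots> = 5 * (1 + 5 * y) ^ 0 * (165 * y + 460 * y ^ 2 - 2800 * y ^ 3 - 8000 * y ^ 4)"
    unfolding Uvy_0_m2 Uvy_1_m2 by algebra
  finally show ?thesis by (rule v_cancel_5)
qed

lemma Uvy_1_0: "(1 + 5 * y) ^ 3 * Uvy 1 0 = - 30 * y - 45 * y ^ 2 + 800 * y ^ 3 + 2000 * y ^ 4"
proof -
  have "5 * (1 + 5 * y) ^ 0 * ((1 + 5 * y) ^ 3 * Uvy 1 0) =
      (1 + 5 * y) ^ 1 * ((1 + 5 * y) ^ 2 * Uvy 0 (- 1)) - (1 + 5 * y) ^ 0 * ((1 + 5 * y) ^ 3 * Uvy 1 (- 1))"
    using Uvy_diff[of 1 "- 1", simplified] by algebra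
  also have "\<dots> = 5 * (1 + 5 * y) ^ 0 * (- 30 * y - 45 * y ^ 2 + 800 * y ^ 3 + 2000 * y ^ 4)"
    unfolding Uvy_0_m1 Uvy_1_m1 by algebra
  finally show ?thesis by (rule v_cancel_5)
qed

lemma Uvy_1_1: "(1 + 5 * y) ^ 3 * Uvy 1 1 = 5 * y - 5 * y ^ 2 - 225 * y ^ 3 - 500 * y ^ 4"
proof -
  have "5 * (1 + 5 * y) ^ 0 * ((1 + 5 * y) ^ 3 * Uvy 1 1) =
      (1 + 5 * y) ^ 1 * ((1 + 5 * y) ^ 2 * Uvy 0 0) - (1 + 5 * y) ^ 0 * ((1 + 5 * y) ^ 3 * Uvy 1 0)"
    using Uvy_diff[of 1 0, simplified] by algebra
  also have "\<dots> = 5 * (1 + 5 * y) ^ 0 * (5 * y - 5 * y ^ 2 - 225 * y ^ 3 - 500 * y ^ 4)"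
    unfolding Uvy_0_0 Uvy_1_0 by algebra
  finally show ?thesis by (rule v_cancel_5)
qed

lemma Uvy_1_2: "(1 + 5 * y) ^ 3 * Uvy 1 2 = 20 * y ^ 2 + 180 * y ^ 3 + 525 * y ^ 4 + 500 * y ^ 5"
proof -
  have "5 * (1 + 5 * y) ^ 0 * ((1 + 5 * y) ^ 3 * Uvy 1 2) =
      (1 + 5 * y) ^ 3 * ((1 + 5 * y) ^ 0 * Uvy 0 1) - (1 + 5 * y) ^ 0 * ((1 + 5 * y) ^ 3 * Uvy 1 1)"
    using Uvy_diff[of 1 1, simplified] by algebra
  also have "\<dots> = 5 * (1 + 5 * y) ^ 0 * (20 * y ^ 2 + 180 * y ^ 3 + 525 * y ^ 4 + 500 * y ^ 5)"
    unfolding Uvy_0_1 Uvy_1_1 by algebra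
  finally show ?thesis by (rule v_cancel_5)
qed

section \<open>Divisibility by powers of 5\<close>

text \<open>The integers divisible by 5^e, placed among the constant Laurent series so that
  polynomials with such coefficients can be evaluated at y directly.\<close>

definition five_ideal :: "nat \<Rightarrow> complex fls set" where
  "five_ideal e = range (\<lambda>c :: int. of_int (5 ^ e * c))"

lemma five_ideal_of_int: "5 ^ e dvd c \<Longrightarrow> of_int c \<in> five_ideal e"
  by (auto simp: five_ideal_def elim!: dvdE)

lemma five_ideal_0 [simp]: "0 \<in> five_ideal e"
  using five_ideal_of_int[of e 0] by simp

lemma five_ideal_1: "1 \<in> five_ideal 0"
  using five_ideal_of_int[of 0 1] by simp

lemma five_ideal_numeral: "5 ^ e dvd (numeral k :: int) \<Longrightarrow> numeral k \<in> five_ideal e"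
  using five_ideal_of_int[of e "numeral k"] by simp

lemma five_ideal_uminus: "f \<in> five_ideal e \<Longrightarrow> - f \<in> five_ideal e"
  unfolding five_ideal_def by (metis (no_types, lifting) mult_minus_right of_int_minus rangeE rangeI)

lemma five_ideal_add: "f \<in> five_ideal e \<Longrightarrow> g \<in> five_ideal e \<Longrightarrow> f + g \<in> five_ideal e"
  unfolding five_ideal_def by (metis (no_types, lifting) distrib_left of_int_add rangeE rangeI)

lemma five_ideal_sum: "(\<And>i. i \<in> A \<Longrightarrow> f i \<in> five_ideal e) \<Longrightarrow> sum f A \<in> five_ideal e"
  by (induction A rule: infinite_finite_induct) (auto intro: five_ideal_add)

lemma five_ideal_mult:
  assumes "f \<in> five_ideal a" "g \<in> five_ideal b" "e \<le> a + b"
  shows "f * g \<in> five_ideal e"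
proof -
  obtain c d where "f = of_int (5 ^ a * c)" "g = of_int (5 ^ b * d)"
    using assms by (auto simp: five_ideal_def)
  hence "f * g = of_int (5 ^ (a + b) * (c * d))" by (simp add: power_add)
  moreover have "5 ^ e dvd 5 ^ (a + b) * (c * d)" using assms(3) by (simp add: le_imp_power_dvd)
  ultimately show ?thesis by (simp only: five_ideal_of_int)
qed

lemma five_ideal_mono: "f \<in> five_ideal a \<Longrightarrow> e \<le> a \<Longrightarrow> f \<in> five_ideal e"
  using five_ideal_mult[of f a 1 0 e] five_ideal_1 by simp

text \<open>This is max 0 \<lceil>t / 6\<rceil>; the clipping reflects that coefficients are
  integers even where the bound is negative.\<close>

definition weight :: "int \<Rightarrow> nat" where
  "weight t = nat ((t + 5) div 6)"

lemma weight_add: "weight (a + b) \<le> weight a + weight b"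
  unfolding weight_def by linarith

text \<open>
  \<open>y\<close> has weight 5 and 5 has weight 6: the coefficient of \<open>y^i\<close> is divisible by 5 to the power \<open>\<lceil>(5 i + d) / 6\<rceil>\<close> (or 0).
\<close>

definition in_lattice :: "int \<Rightarrow> complex fls poly \<Rightarrow> bool" where
  "in_lattice d p \<longleftrightarrow> (\<forall>i. coeff p i \<in> five_ideal (weight (5 * int i + d)))"

lemma in_lattice_0 [simp]: "in_lattice d 0"
  by (simp add: in_lattice_def)

lemma in_lattice_pCons: "a \<in> five_ideal (weight d) \<Longrightarrow> in_lattice (d + 5) p \<Longrightarrow> in_lattice d (pCons a p)"
  unfolding in_lattice_def by (auto simp: coeff_pCons algebra_simps split: nat.splits)

lemma in_lattice_add: "in_lattice d p \<Longrightarrow> in_lattice d q \<Longrightarrow> in_lattice d (p + q)"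
  by (simp add: in_lattice_def five_ideal_add)

lemma in_lattice_mult:
  assumes "in_lattice a p" "in_lattice b q" "a + b = d"
  shows "in_lattice d (p * q)"
  unfolding in_lattice_def
proof
  fix n
  have "coeff p i * coeff q (n - i) \<in> five_ideal (weight (5 * int n + d))" if "i \<le> n" for i
  proof (rule five_ideal_mult)
    show "coeff p i \<in> five_ideal (weight (5 * int i + a))" "coeff q (n - i) \<in> five_ideal (weight (5 * int (n - i) + b))"
      using assms by (auto simp: in_lattice_def)
    have "5 * int n + d = (5 * int i + a) + (5 * int (n - i) + b)" using that assms(3) by simp
    thus "weight (5 * int n + d) \<le> weight (5 * int i + a) + weight (5 * int (n - i) + b)"
      by (simp only: weight_add)
  qed
  thus "coeff (p * q) n \<in> five_ideal (weight (5 * int n + d))"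
    unfolding coeff_mult by (intro five_ideal_sum) simp
qed

lemmas in_lattice_intros = in_lattice_pCons in_lattice_0 five_ideal_numeral five_ideal_uminus five_ideal_1 five_ideal_0

section \<open>Weights of the two recurrences\<close>

definition alpha0 :: "complex fls poly" where "alpha0 = [:0, 1, 20, 150, 500, 625:]"
definition alpha1 :: "complex fls poly" where "alpha1 = [:0, 15, 305, 2325, 7875, 10000:]"
definition alpha2 :: "complex fls poly" where "alpha2 = [:0, 85, 1750, 13525, 46500, 60000:]"
definition alpha3 :: "complex fls poly" where "alpha3 = [:0, 215, 4475, 35000, 122000, 160000:]"
definition alpha4 :: "complex fls poly" where "alpha4 = [:0, 205, 4300, 34000, 120000, 160000:]"
definition beta0 :: "complex fls poly" where "beta0 = [:1, - 3100, - 62250, - 467500, - 1559375, - 1950000:]"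
definition beta1 :: "complex fls poly" where "beta1 = [:- 5, - 31375, - 641875, - 4928125, - 16812500, - 21500000:]"
definition beta2 :: "complex fls poly" where "beta2 = [:25, - 108750, - 2259375, - 17625000, - 61250000, - 80000000:]"
definition beta3 :: "complex fls poly" where "beta3 = [:- 125, - 128125, - 2687500, - 21250000, - 75000000, - 100000000:]"
definition beta4 :: "complex fls poly" where "beta4 = [:625:]"

text \<open>The weight j - 5 here, and j for the beta polynomials, is the change of a bound of the
  form - m - c on the way from m + j to m + 5, respectively to m. Both recurrences thus preserve
  such a bound.\<close>

lemma in_lattice_al: "in_lattice (- 5) alpha0" "in_lattice (- 4) alpha1" "in_lattice (- 3) alpha2" "in_lattice (- 2) alpha3" "in_lattice (- 1) alpha4"
  unfolding alpha0_def alpha1_def alpha2_def alpha3_def alpha4_def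
  by (intro in_lattice_intros; simp add: weight_def)+

lemma in_lattice_be: "in_lattice 0 beta0" "in_lattice 1 beta1" "in_lattice 2 beta2" "in_lattice 3 beta3" "in_lattice 4 beta4"
  unfolding beta0_def beta1_def beta2_def beta3_def beta4_def
  by (intro in_lattice_intros; simp add: weight_def)+

lemma Uvy_rec': "Uvy n (m + 5) = poly alpha0 y * Uvy n (m + 0) + poly alpha1 y * Uvy n (m + 1) + poly alpha2 y * Uvy n (m + 2) + poly alpha3 y * Uvy n (m + 3) + poly alpha4 y * Uvy n (m + 4)"
  unfolding Uvy_rec alpha0_def alpha1_def alpha2_def alpha3_def alpha4_def
  by (simp add: algebra_simps eval_nat_numeral)

lemma Uvy_v': "(1 + 5 * y) ^ 5 * Uvy (n + 1) m = poly beta0 y * Uvy n (m + 0) + poly beta1 y * Uvy n (m + 1) + poly beta2 y * Uvy n (m + 2) + poly beta3 y * Uvy n (m + 3) + poly beta4 y * Uvy n (m + 4)"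
  unfolding Uvy_v beta0_def beta1_def beta2_def beta3_def beta4_def
  by (simp add: algebra_simps eval_nat_numeral)

text \<open>The constant 7 is forced at n = 1, m = 2: the coefficient 180 of y^3 is divisible by 5
  only once. For m = -2 the constant coefficient is nonzero at n = 1, hence the restriction to m
  \<ge> -1. In the last clause the lattice bound on the coefficient of y is trivial, while the
  factor 1/5 demands one power of 5 and \<open>\<phi> m\<close> = 0 supplies none.\<close>

definition rep_U0 :: "nat \<Rightarrow> int \<Rightarrow> complex fls poly \<Rightarrow> bool" where
  "rep_U0 n m p \<longleftrightarrow> in_lattice (- m - 7) p \<and> (1 + 5 * y) ^ (5 * n - 2) * Uvy (int n) m = poly p y \<and>
     (m \<ge> - 1 \<longrightarrow> coeff p 0 = 0) \<and> (m \<in> {1, 2} \<longrightarrow> coeff p 1 \<in> five_ideal 1)"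

lemma rep_U0_lat: "rep_U0 n m p \<Longrightarrow> in_lattice (- m - 7) p"
  and rep_U0_eq: "rep_U0 n m p \<Longrightarrow> (1 + 5 * y) ^ (5 * n - 2) * Uvy (int n) m = poly p y"
  and rep_U0_coeff_0: "rep_U0 n m p \<Longrightarrow> m \<ge> - 1 \<Longrightarrow> coeff p 0 = 0"
  and rep_U0_coeff_1: "rep_U0 n m p \<Longrightarrow> m = 1 \<or> m = 2 \<Longrightarrow> coeff p 1 \<in> five_ideal 1"
  by (auto simp: rep_U0_def)

lemma rep_U0_1_m2: "rep_U0 1 (- 2) [:1, - 856, - 3040, 9600, 32000:]"
proof -
  have "in_lattice (- (- 2) - 7) [:1, - 856, - 3040, 9600, 32000:]"
    by (intro in_lattice_intros; simp add: weight_def)+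
  moreover have "(1 + 5 * y) ^ (5 * 1 - 2) * Uvy (int 1) (- 2) = poly [:1, - 856, - 3040, 9600, 32000:] y"
    using Uvy_1_m2 by (simp add: algebra_simps eval_nat_numeral)
  moreover have "(5 :: complex fls) \<in> five_ideal 1" by (rule five_ideal_numeral) simp
  ultimately show ?thesis by (simp add: rep_U0_def)
qed

lemma rep_U0_1_m1: "rep_U0 1 (- 1) [:0, 165, 460, - 2800, - 8000:]"
proof -
  have "in_lattice (- (- 1) - 7) [:0, 165, 460, - 2800, - 8000:]"
    by (intro in_lattice_intros; simp add: weight_def)+
  moreover have "(1 + 5 * y) ^ (5 * 1 - 2) * Uvy (int 1) (- 1) = poly [:0, 165, 460, - 2800, - 8000:] y"
    using Uvy_1_m1 by (simp add: algebra_simps eval_nat_numeral)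
  moreover have "(5 :: complex fls) \<in> five_ideal 1" by (rule five_ideal_numeral) simp
  ultimately show ?thesis by (simp add: rep_U0_def)
qed

lemma rep_U0_1_0: "rep_U0 1 0 [:0, - 30, - 45, 800, 2000:]"
proof -
  have "in_lattice (- (0) - 7) [:0, - 30, - 45, 800, 2000:]"
    by (intro in_lattice_intros; simp add: weight_def)+
  moreover have "(1 + 5 * y) ^ (5 * 1 - 2) * Uvy (int 1) (0) = poly [:0, - 30, - 45, 800, 2000:] y"
    using Uvy_1_0 by (simp add: algebra_simps eval_nat_numeral)
  moreover have "(5 :: complex fls) \<in> five_ideal 1" by (rule five_ideal_numeral) simp
  ultimately show ?thesis by (simp add: rep_U0_def)
qed

lemma rep_U0_1_1: "rep_U0 1 1 [:0, 5, - 5, - 225, - 500:]"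
proof -
  have "in_lattice (- (1) - 7) [:0, 5, - 5, - 225, - 500:]"
    by (intro in_lattice_intros; simp add: weight_def)+
  moreover have "(1 + 5 * y) ^ (5 * 1 - 2) * Uvy (int 1) (1) = poly [:0, 5, - 5, - 225, - 500:] y"
    using Uvy_1_1 by (simp add: algebra_simps eval_nat_numeral)
  moreover have "(5 :: complex fls) \<in> five_ideal 1" by (rule five_ideal_numeral) simp
  ultimately show ?thesis by (simp add: rep_U0_def)
qed

lemma rep_U0_1_2: "rep_U0 1 2 [:0, 0, 20, 180, 525, 500:]"
proof -
  have "in_lattice (- (2) - 7) [:0, 0, 20, 180, 525, 500:]"
    by (intro in_lattice_intros; simp add: weight_def)+
  moreover have "(1 + 5 * y) ^ (5 * 1 - 2) * Uvy (int 1) (2) = poly [:0, 0, 20, 180, 525, 500:] y"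
    using Uvy_1_2 by (simp add: algebra_simps eval_nat_numeral)
  moreover have "(5 :: complex fls) \<in> five_ideal 1" by (rule five_ideal_numeral) simp
  ultimately show ?thesis by (simp add: rep_U0_def)
qed

lemma coeff_0_mult: "coeff (p * q) 0 = coeff p 0 * coeff (q :: 'a :: comm_semiring_0 poly) 0"
  by (simp add: coeff_mult)

lemma rep_U0_1:
  assumes "m \<ge> - 2"
  shows "\<exists>p. rep_U0 1 m p"
proof -
  have "\<exists>p. rep_U0 1 (int k - 2) p" for k
  proof (induction k rule: less_induct)
    case (less k)
    show ?case
    proof (cases "k < 5")
      case True
      hence "k = 0 \<or> k = 1 \<or> k = 2 \<or> k = 3 \<or> k = 4" by auto
      thus ?thesis using rep_U0_1_m2 rep_U0_1_m1 rep_U0_1_0 rep_U0_1_1 rep_U0_1_2 by auto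
    next
      case False
      define l where "l = int k - 7"
      have l: "l \<ge> - 2" "int k - 2 = l + 5" using False by (auto simp: l_def)
      have "\<exists>p. rep_U0 1 (l + int j) p" if "j < 5" for j
        using less.IH[of "k - 5 + j"] that False by (simp add: l_def of_nat_diff algebra_simps)
      from this[of 0] this[of 1] this[of 2] this[of 3] this[of 4]
      obtain p0 p1 p2 p3 p4 where p: "rep_U0 1 (l + 0) p0" "rep_U0 1 (l + 1) p1" "rep_U0 1 (l + 2) p2"
        "rep_U0 1 (l + 3) p3" "rep_U0 1 (l + 4) p4" by auto
      define q where "q = alpha0 * p0 + alpha1 * p1 + alpha2 * p2 + alpha3 * p3 + alpha4 * p4"
      have "in_lattice (- (l + 5) - 7) q"
        unfolding q_def
        by (intro in_lattice_add in_lattice_mult[OF in_lattice_al(1), of "- (l + 0) - 7"] in_lattice_mult[OF in_lattice_al(2), of "- (l + 1) - 7"]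
              in_lattice_mult[OF in_lattice_al(3), of "- (l + 2) - 7"] in_lattice_mult[OF in_lattice_al(4), of "- (l + 3) - 7"]
              in_lattice_mult[OF in_lattice_al(5), of "- (l + 4) - 7"]) (use p in \<open>auto simp: rep_U0_def\<close>)
      moreover have "(1 + 5 * y) ^ 3 * Uvy 1 (l + 5) = poly q y"
      proof -
        have "(1 + 5 * y) ^ 3 * Uvy 1 (l + 5) = poly alpha0 y * ((1 + 5 * y) ^ 3 * Uvy 1 (l + 0)) + poly alpha1 y * ((1 + 5 * y) ^ 3 * Uvy 1 (l + 1))
            + poly alpha2 y * ((1 + 5 * y) ^ 3 * Uvy 1 (l + 2)) + poly alpha3 y * ((1 + 5 * y) ^ 3 * Uvy 1 (l + 3))
            + poly alpha4 y * ((1 + 5 * y) ^ 3 * Uvy 1 (l + 4))"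
          unfolding Uvy_rec' by (simp only: distrib_left mult_ac)
        also have "\<dots> = poly q y"
          using p by (simp add: rep_U0_def q_def)
        finally show ?thesis .
      qed
      \<comment> \<open>The alpha polynomials have no constant term, so the nonzero constant at m =
        -2 does not propagate. Since l + 5 \<ge> 3, the clause on the coefficient of y is
        void.\<close>
      moreover have "coeff q 0 = 0"
        by (simp add: q_def coeff_0_mult alpha0_def alpha1_def alpha2_def alpha3_def alpha4_def)
      ultimately have "rep_U0 1 (l + 5) q"
        using l by (simp add: rep_U0_def)
      thus ?thesis unfolding l(2) by blast
    qed
  qed
  from this[of "nat (m + 2)"] show ?thesis using assms by simp
qed

lemma coeff_1_mult: "coeff (p * q) 1 = coeff p 0 * coeff q 1 + coeff p 1 * coeff (q :: 'a :: comm_semiring_0 poly) 0"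
  by (simp add: coeff_mult)

lemma rep_U0:
  assumes "n \<ge> 1" "m \<ge> - 2"
  shows "\<exists>p. rep_U0 n m p"
  using assms
proof (induction n arbitrary: m rule: dec_induct)
  case base
  thus ?case by (intro rep_U0_1)
next
  case (step n)
  have "\<exists>p. rep_U0 n (m + int j) p" for j
    using step by simp
  from this[of 0] this[of 1] this[of 2] this[of 3] this[of 4]
  obtain p0 p1 p2 p3 p4 where p: "rep_U0 n (m + 0) p0" "rep_U0 n (m + 1) p1" "rep_U0 n (m + 2) p2"
    "rep_U0 n (m + 3) p3" "rep_U0 n (m + 4) p4" by auto
  define q where "q = beta0 * p0 + beta1 * p1 + beta2 * p2 + beta3 * p3 + beta4 * p4"
  have "in_lattice (- m - 7) q"
    unfolding q_def
    by (intro in_lattice_add in_lattice_mult[OF in_lattice_be(1), of "- (m + 0) - 7"] in_lattice_mult[OF in_lattice_be(2), of "- (m + 1) - 7"]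
          in_lattice_mult[OF in_lattice_be(3), of "- (m + 2) - 7"] in_lattice_mult[OF in_lattice_be(4), of "- (m + 3) - 7"]
          in_lattice_mult[OF in_lattice_be(5), of "- (m + 4) - 7"]) (use p in \<open>auto simp: rep_U0_def\<close>)
  moreover have "(1 + 5 * y) ^ (5 * Suc n - 2) * Uvy (int (Suc n)) m = poly q y"
  proof -
    define w where "w = (1 + 5 * y) ^ (5 * n - 2)"
    have "5 * Suc n - 2 = (5 * n - 2) + 5" using step.hyps by simp
    hence "(1 + 5 * y) ^ (5 * Suc n - 2) * Uvy (int (Suc n)) m = w * ((1 + 5 * y) ^ 5 * Uvy (int n + 1) m)"
      by (simp only: power_add w_def of_nat_Suc add.commute[of 1] mult.assoc)
    also have "\<dots> = poly beta0 y * (w * Uvy n (m + 0)) + poly beta1 y * (w * Uvy n (m + 1))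
            + poly beta2 y * (w * Uvy n (m + 2)) + poly beta3 y * (w * Uvy n (m + 3)) + poly beta4 y * (w * Uvy n (m + 4))"
      unfolding Uvy_v' by (simp only: distrib_left mult_ac)
    also have "\<dots> = poly q y"
      using p by (simp add: rep_U0_def q_def w_def)
    finally show ?thesis .
  qed
  moreover have "coeff q 0 = 0" if "m \<ge> - 1"
    using p that by (simp add: q_def coeff_0_mult rep_U0_def)
  \<comment> \<open>As the constant coefficients vanish, only those of the beta polynomials matter:
    1 for \<open>beta0\<close> and multiples of 5 for the others. Divisibility is inherited from the
    same m.\<close>
  moreover have "coeff q 1 \<in> five_ideal 1" if "m \<in> {1, 2}"
  proof -
    have c0: "coeff p0 0 = 0" "coeff p1 0 = 0" "coeff p2 0 = 0" "coeff p3 0 = 0" "coeff p4 0 = 0"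
      using p[THEN rep_U0_coeff_0] that by auto
    have int: "coeff r 1 \<in> five_ideal 0" if "in_lattice d r" for d r
    proof -
      have "coeff r 1 \<in> five_ideal (weight (5 * int 1 + d))" using that unfolding in_lattice_def by blast
      thus ?thesis by (rule five_ideal_mono) simp
    qed
    have c1: "coeff p0 1 \<in> five_ideal 1" "coeff p1 1 \<in> five_ideal 0" "coeff p2 1 \<in> five_ideal 0" "coeff p3 1 \<in> five_ideal 0" "coeff p4 1 \<in> five_ideal 0"
      using rep_U0_coeff_1[OF p(1)] that int[OF rep_U0_lat] p by auto
    have five: "- 5 \<in> five_ideal 1" "25 \<in> five_ideal 1" "- 125 \<in> five_ideal 1" "625 \<in> five_ideal 1"
      by (intro five_ideal_uminus five_ideal_numeral; simp)+
    have "coeff q 1 = coeff p0 1 + (- 5) * coeff p1 1 + 25 * coeff p2 1 + (- 125) * coeff p3 1 + 625 * coeff p4 1"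
      unfolding q_def coeff_add coeff_1_mult c0 by (simp add: beta0_def beta1_def beta2_def beta3_def beta4_def)
    also have "\<dots> \<in> five_ideal 1"
      by (intro five_ideal_add c1(1) five_ideal_mult[OF five(1) c1(2)] five_ideal_mult[OF five(2) c1(3)] five_ideal_mult[OF five(3) c1(4)] five_ideal_mult[OF five(4) c1(5)]) simp_all
    finally show ?thesis .
  qed
  ultimately show ?case unfolding rep_U0_def by blast
qed

section \<open>Comparison of exponents and conclusion\<close>

lemma phi_nonneg: "m \<ge> 1 \<Longrightarrow> \<phi> m \<ge> 0" and theta_nonneg: "m \<ge> 1 \<Longrightarrow> \<theta> m \<ge> 0"
  unfolding \<phi>_def \<theta>_def by auto

text \<open>The 1 beside \<open>\<theta> r\<close> pays for the factor 1/5. The margin grows with m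
  and exceeds the rounding losses from m = 4 on; m = 1, 2, 3 are inspected. For the excluded pairs
  the left side is 1 and the right side 0.\<close>

lemma weight_bound:
  assumes "m \<ge> 1" "r \<ge> 1" "\<not> (r = 1 \<and> m \<in> {1, 2})"
  shows "nat (\<theta> r + 1) \<le> weight (5 * r + (- m - 7)) + nat (\<phi> m)"
proof -
  \<comment> \<open>\<open>a\<close> is \<lceil>(5 r - m - 7) / 6\<rceil>, the ceiling written with
    \<open>div\<close>.\<close>
  define a b c where "a = (5 * r - m - 2) div 6" and "b = (5 * m - 5) div 6" and "c = (5 * r - 5) div 6"
  have 1: "6 * a \<ge> 5 * r - m - 7" "6 * b \<ge> 5 * m - 10" "6 * c \<le> 5 * r - 5"
    unfolding a_def b_def c_def by linarith+
  have weight: "int (weight (5 * r + (- m - 7))) = max 0 a"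
    unfolding weight_def a_def by (simp add: algebra_simps)
  have "\<theta> r + 1 \<le> max 0 a + \<phi> m"
  proof (cases "m \<ge> 4")
    case True
    hence "\<phi> m = b - 1" by (simp add: \<phi>_def b_def)
    moreover have "b \<ge> 2" unfolding b_def using True by linarith
    moreover have "\<theta> r \<le> 0 \<or> \<theta> r = c - 1"
      using assms(2) unfolding \<theta>_def c_def by auto
    ultimately show ?thesis using 1 True by linarith
  next
    case False
    hence "m = 1 \<or> m = 2 \<or> m = 3" using assms by auto
    hence phi: "\<phi> m = (if m = 3 then 1 else 0)" by (auto simp: \<phi>_def)
    show ?thesis
    proof (cases "r \<ge> 3")
      case True
      hence "\<theta> r = c - 1" by (simp add: \<theta>_def c_def)
      thus ?thesis using 1 \<open>m = 1 \<or> m = 2 \<or> m = 3\<close> unfolding phi by auto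
    next
      case r: False
      hence "\<theta> r = 0" using assms(2) by (auto simp: \<theta>_def)
      moreover have "a \<ge> 1 \<or> m = 3"
        using 1 assms r \<open>m = 1 \<or> m = 2 \<or> m = 3\<close> by auto
      ultimately show ?thesis unfolding phi by auto
    qed
  qed
  thus ?thesis using weight phi_nonneg[OF assms(1)] by linarith
qed

theorem theorem4p1:
  fixes n :: nat and f :: "complex fls"
  assumes "n \<ge> 1" and "f \<in> V0 n"
  shows "1 / 5 * U0 f \<in> V1 (5 * n - 2)"
proof -
  obtain s where s: "discrete_fun s" and f: "f = (1 + 5 * y) powi (- int n) *
      (\<Sum>m\<in>{m. m \<ge> 1 \<and> s m \<noteq> 0}. of_int (s m) * 5 powi \<phi> m * y powi m)"
    using assms(2) unfolding V0_def V_def by blast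
  define M where "M = {m. m \<ge> 1 \<and> s m \<noteq> 0}"
  have M: "finite M" "\<And>m. m \<in> M \<Longrightarrow> m \<ge> 1"
    unfolding M_def using finite_discrete_support[OF s] by auto
  have "\<exists>p. rep_U0 n m p" if "m \<in> M" for m
    using rep_U0[OF assms(1), of m] M(2)[OF that] by simp
  then obtain p where p: "\<And>m. m \<in> M \<Longrightarrow> rep_U0 n m (p m)" by metis
  \<comment> \<open>\<open>\<phi> m\<close> is nonnegative on M, so this is an integer; as a
    constant it is fixed by \<sigma> and leaves \<open>U0\<close>.\<close>
  define k where "k = (\<lambda>m. s m * 5 ^ nat (\<phi> m))"
  have k: "of_int (s m) * 5 powi \<phi> m = (of_int (k m) :: complex fls)" if "m \<in> M" for m
    using phi_nonneg[OF M(2)[OF that]] by (simp add: k_def power_int_def)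
  define q where "q = (\<Sum>m\<in>M. smult (of_int (k m)) (p m))"
  have sigma_int: "\<sigma> (of_int c) = of_int c" for c
    using fls_compose_power_const_left[of 5 "of_int c :: complex"] by (simp add: fls_of_int)
  have fsum: "f = (\<Sum>m\<in>M. \<sigma> (of_int (k m)) * ((1 + 5 * y) powi (- int n) * y powi m))"
    unfolding f M_def[symmetric] sum_distrib_left
    by (intro sum.cong refl) (simp add: k sigma_int mult_ac)
  have "U0 f = (\<Sum>m\<in>M. of_int (k m) * Uvy (int n) m)"
    by (rule trans[OF arg_cong[OF fsum]]) (simp only: U0_sum U0_mult Uvy_def)
  hence "(1 + 5 * y) ^ (5 * n - 2) * U0 f = (\<Sum>m\<in>M. of_int (k m) * ((1 + 5 * y) ^ (5 * n - 2) * Uvy (int n) m))"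
    by (simp only: sum_distrib_left mult.left_commute[of "(1 + 5 * y) ^ (5 * n - 2)"])
  also have "\<dots> = (\<Sum>m\<in>M. of_int (k m) * poly (p m) y)"
    by (intro sum.cong refl) (simp add: rep_U0_eq[OF p])
  also have "\<dots> = poly q y"
    by (simp add: q_def poly_sum)
  finally have Uq: "(1 + 5 * y) ^ (5 * n - 2) * U0 f = poly q y" .
  have q0: "coeff q 0 = 0"
    unfolding q_def coeff_sum coeff_smult
  proof (intro sum.neutral ballI)
    fix m assume m: "m \<in> M"
    have "coeff (p m) 0 = 0" using rep_U0_coeff_0[OF p[OF m]] M(2)[OF m] by simp
    thus "of_int (k m) * coeff (p m) 0 = 0" by simp
  qed
  have "coeff q r \<in> five_ideal (nat (\<theta> (int r) + 1))" if "r \<ge> 1" for r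
    unfolding q_def coeff_sum coeff_smult
  proof (rule five_ideal_sum)
    fix m assume m: "m \<in> M"
    have km: "of_int (k m) \<in> five_ideal (nat (\<phi> m))" by (rule five_ideal_of_int) (simp add: k_def)
    show "of_int (k m) * coeff (p m) r \<in> five_ideal (nat (\<theta> (int r) + 1))"
    proof (cases "r = 1 \<and> m \<in> {1, 2}")
      case True
      hence "coeff (p m) r \<in> five_ideal 1" using rep_U0_coeff_1[OF p[OF m]] by auto
      from five_ideal_mult[OF km this] show ?thesis using True by (auto simp: \<theta>_def)
    next
      case False
      have "coeff (p m) r \<in> five_ideal (weight (5 * int r + (- m - 7)))"
        using rep_U0_lat[OF p[OF m]] by (auto simp: in_lattice_def)
      from five_ideal_mult[OF km this] show ?thesis
        using weight_bound[of m "int r"] M(2)[OF m] that False by (simp add: add.commute)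
    qed
  qed
  hence "\<exists>c :: int. coeff q r = of_int (5 ^ nat (\<theta> (int r) + 1) * c)" if "r \<ge> 1" for r
    using that by (auto simp: five_ideal_def)
  then obtain t where t: "\<And>r. r \<ge> 1 \<Longrightarrow> coeff q r = of_int (5 ^ nat (\<theta> (int r) + 1) * t r)" by metis
  \<comment> \<open>\<open>t\<close> is constrained only at positive indices; cutting off at the
    degree makes the function discrete.\<close>
  define t' where "t' = (\<lambda>r :: int. if 1 \<le> r \<and> r \<le> int (degree q) then t (nat r) else 0)"
  have disc: "discrete_fun t'"
    unfolding discrete_fun_def t'_def by (rule exI[of _ "int (degree q) + 1"]) auto
  let ?g = "\<lambda>r. of_int (t' r) * 5 powi \<theta> r * y powi r"
  have "1 / 5 * poly q y = (\<Sum>r\<le>degree q. 1 / 5 * (coeff q r * y ^ r))"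
    unfolding poly_altdef sum_distrib_left ..
  also have "\<dots> = (\<Sum>r=1..degree q. 1 / 5 * (coeff q r * y ^ r))"
    using q0 by (intro sum.mono_neutral_right) (auto simp: Suc_le_eq)
  also have "\<dots> = (\<Sum>r=1..degree q. ?g (int r))"
  proof (intro sum.cong refl)
    fix r assume r: "r \<in> {1..degree q}"
    \<comment> \<open>The surplus power of 5 absorbs the factor 1/5.\<close>
    have "nat (\<theta> (int r) + 1) = Suc (nat (\<theta> (int r)))"
      using theta_nonneg[of "int r"] r by (simp add: Suc_nat_eq_nat_zadd1)
    thus "1 / 5 * (coeff q r * y ^ r) = ?g (int r)"
      using r t[of r] theta_nonneg[of "int r"] by (simp add: t'_def power_int_def)
  qed
  also have "\<dots> = (\<Sum>r\<in>int ` {1..degree q}. ?g r)"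
    by (simp add: sum.reindex)
  also have "\<dots> = (\<Sum>r\<in>{r. r \<ge> 1 \<and> t' r \<noteq> 0}. ?g r)"
  proof (rule sum.mono_neutral_right)
    show "{r. 1 \<le> r \<and> t' r \<noteq> 0} \<subseteq> int ` {1..degree q}"
    proof
      fix r assume "r \<in> {r. 1 \<le> r \<and> t' r \<noteq> 0}"
      hence "r = int (nat r)" "nat r \<in> {1..degree q}" by (auto simp: t'_def split: if_splits)
      thus "r \<in> int ` {1..degree q}" by blast
    qed
  qed auto
  finally have sum: "1 / 5 * poly q y = \<dots>" .
  have "1 / 5 * U0 f = (1 + 5 * y) powi (- int (5 * n - 2)) * (1 / 5 * poly q y)"
  proof -
    have "inverse a * (1 / 5 * (a * u)) = 1 / 5 * u" if "a \<noteq> 0" for a u :: "complex fls"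
      using that by (simp add: field_simps)
    from this[of "(1 + 5 * y) ^ (5 * n - 2)" "U0 f"] show ?thesis
      unfolding Uq[symmetric] by (simp only: power_int_minus power_int_of_nat) simp
  qed
  thus ?thesis
    unfolding V1_def V_def sum using disc by blast
qed

end
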